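(* Let $\mathcal A$ be a Laurent phenomenon (LP) algebra associated with a positive $LP$-pattern $\{({\bf x}_t,{\bf P}_t)\mid t\in\mathbb T_n\}$ of LP seeds of rank $n$ in the field $\mathbb F$ of rational functions in $m$ variables over $\mathbb Q$, and let $\mathbb L=(\mathbb F, \{{\bf x}_t\}_{t\in\mathbb T_n})$ be the corresponding positive ${\bf LP}$-space. Fix a cluster ${\bf x}_{t_0}$. Then: (i) If $u$ is a cluster monomial and $u\notin \{{\bf x}_{t_0}^{\bf h}\mid {\bf h}\in\mathbb N^m\}$, then the Laurent expansion of $u$ with respect to ${\bf x}_{t_0}$ is a linear combination of proper Laurent monomials in ${\bf x}_{t_0}$. (ii) The cluster monomials of $\mathcal A$ are linearly independent over $\mathbb Z$.
   Context: Fix integers $0<n\le m$, let $\mathbb F$ be the field of rational functions in $m$ variables over $\mathbb Q$, $\mathbb N=\mathbb Z_{\ge0}$, $[1,n]=\{1,\ldots,n\}$. For free generators ${\bf x}=(x_1,\ldots,x_m)$ of $\mathbb F$ over $\mathbb Q$, $\mathbb Q_{\rm sf}({\bf x})=\{F/H\mid 0\ne F,H\in\mathbb Z_{\ge0}[x_1,\ldots,x_m]\}$. An (LP) seed of rank $n$ in $\mathbb F$ is a pair $({\bf x},{\bf P})$ where ${\bf x}=(x_1,\ldots,x_m)$ is an ordered set of free generators of $\mathbb F$ over $\mathbb Q$ and ${\bf P}=(P_1,\ldots,P_n)$ is an ordered set of polynomials in $R=\mathbb Z[x_{n+1}^{\pm1},\ldots,x_m^{\pm1}][x_1,\ldots,x_n]$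 such that: each $P_i$ is irreducible in $R$; $P_i$ is not divisible by any $x_j$, $j\in[1,n]$; and $P_i$ does not depend on $x_i$. ${\bf x}$ is the cluster and its elements are the cluster variables ($x_1,\ldots,x_n$ unfrozen, $x_{n+1},\ldots,x_m$ frozen); the $P_i$ are the exchange polynomials. Notation: $P|_{x_j\leftarrow N}$ means substitution of $N$ for $x_j$ in $P$; a hat on a variable in a list of ring generators means it is omitted. The ${\bf LP}$-mutation of $({\bf x},{\bf P})$ in direction $k\in[1,n]$ is the seed $({\bf x}',{\bf P}')$ defined as follows. (1) $\widehat P_k=P_k/\prod_{j=1}^n x_j^{a_j}\in\mathbb Z[x_1^{\pm1},\ldots,x_m^{\pm1}]$, where $a_k=0$ and, for $k\ne j\in[1,n]$, $a_j=\max\{s\in\mathbb N\mid (P_k|_{x_j\leftarrow P_j/x_j})/P_j^s\in\mathbb Z[x_1^{\pm1},\ldots,x_m^{\pm1}]\}$. (2) $x_i'=x_i$ for $i\ne k$ and $x_k'=\widehat P_k/x_k$. (3) For $j\in[1,n]$, $G_j=P_j|_{x_k\leftarrow N_j}$, where $N_j=(\widehat P_k|_{x_j\leftarrow0})/x_k'$; then $G_j\in\mathbb Z[x_1'^{\pm1},\ldots,\hat x_j',\ldots,x_m'^{\pm1}]$. (4) $H_j=G_j/D_j$, where $D_j$ is the greatest common divisor of $G_j$ and $\widehat P_k|_{x_j\leftarrow0}$ in $\mathbb Z[x_1'^{\pm1},\ldots,\hat x_j',\ldots,x_m'^{\pm1}]$ (defined up to a unit). (5) $P_j'=M_jH_j$,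 where $M_j$ is the unique monic Laurent monomial in $x_1',\ldots,x_n'$ such that $P_j'\in\mathbb Z[x_{n+1}'^{\pm1},\ldots,x_m'^{\pm1}][x_1',\ldots,x_n']$ and $P_j'$ is not divisible by any $x_i'$, $i\in[1,n]$; $P'_j$ is defined up to a unit in $\mathbb Z[x_{n+1}^{\pm1},\ldots,x_m^{\pm1}]$. If $P_j$ does not depend on $x_k$, then $G_j=H_j=P_j$, $M_j=1$ and $P_j'=P_j$ (and well-definedness of $N_j$ is irrelevant). (6) $({\bf x}',{\bf P}')=((x_1',\ldots,x_m'),(P_1',\ldots,P_n'))$. It is known (Lam–Pylyavskyy) that this is a valid seed. $\mathbb T_n$ is the $n$-regular tree with edges labeled by $1,\ldots,n$ so that the $n$ edges at each vertex have different labels. An $LP$-pattern is an assignment of a seed $({\bf x}_t,{\bf P}_t)$ to each vertex $t$ of $\mathbb T_n$ such that $({\bf x}_{t'},{\bf P}_{t'})$ is obtained from $({\bf x}_t,{\bf P}_t)$ by ${\bf LP}$-mutation in direction $k$ whenever $t,t'$ are joined by an edge labeled $k$. It is positive if $\mathbb Q_{\rm sf}({\bf x}_t)=\mathbb Q_{\rm sf}({\bf x}_{t'})$ for all $t,t'\in\mathbb T_n$. The associated LP algebra is $\mathcal A=\mathbb Z[x_{1;t},\ldots,x_{n;t},x_{n+1;t}^{\pm1},\ldots,x_{m;t}^{\pm1}\mid t\in\mathbb T_n]\subseteq\mathbb F$. For a positive $LP$-pattern, the positive ${\bf LP}$-space is the pair $\mathbb L=(\mathbb F,\{{\bf x}_t\}_{t\in\mathbb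 T_n})$. By the Laurent phenomenon (Lam–Pylyavskyy), every cluster variable lies in $\mathbb Z[x_{1;t}^{\pm1},\ldots,x_{m;t}^{\pm1}]$ for each $t\in\mathbb T_n$. A cluster monomial is a monomial ${\bf x}_t^{\bf h}=x_{1;t}^{h_1}\cdots x_{m;t}^{h_m}$, ${\bf h}\in\mathbb N^m$, in cluster variables from one cluster ${\bf x}_t$. The Laurent expansion of $u$ with respect to ${\bf x}_{t_0}$ is its expression in $\mathbb Z[x_{1;t_0}^{\pm1},\ldots,x_{m;t_0}^{\pm1}]$. A Laurent monomial $x_{1;t_0}^{h_1}\cdots x_{m;t_0}^{h_m}$ is proper if $h_i<0$ for some $i\in\{1,\dots,m\}$. *)

theory Defs
  imports
    "HOL-Library.Poly_Mapping"
    "HOL-Algebra.Ring_Divisibility"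
    "HOL-Algebra.Generated_Rings"
    "HOL-Algebra.Algebraic_Closure_Type"
begin

section \<open>Laurent polynomials and their evaluation in a field\<close>

text \<open>A Laurent polynomial is a finitely supported function from exponent vectors
  (themselves finitely supported, the variables being numbered 1, 2, ...) to coefficients.\<close>

type_synonym 'c lpoly = "(nat \<Rightarrow>\<^sub>0 int) \<Rightarrow>\<^sub>0 'c"

text \<open>For disjoint \<open>A\<close> and \<open>B\<close>: the Laurent polynomials in the variables indexed by
  \<open>A \<union> B\<close> which are polynomial in those indexed by \<open>A\<close>.\<close>

definition laurent_polys :: "nat set \<Rightarrow> nat set \<Rightarrow> 'c::zero lpoly set" where
  "laurent_polys A B =
     {p. \<forall>e \<in> Poly_Mapping.keys p. Poly_Mapping.keys e \<subseteq> A \<union> B \<and>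
           (\<forall>i\<in>A. 0 \<le> Poly_Mapping.lookup e i)}"

definition depends_on :: "'c::zero lpoly \<Rightarrow> nat \<Rightarrow> bool" where
  "depends_on p i \<longleftrightarrow> (\<exists>e \<in> Poly_Mapping.keys p. Poly_Mapping.lookup e i \<noteq> 0)"

definition lvar :: "nat \<Rightarrow> 'c::zero_neq_one lpoly" where
  "lvar i = Poly_Mapping.single (Poly_Mapping.single i 1) 1"

definition laurent_monomial :: "(nat \<Rightarrow> 'f::field) \<Rightarrow> (nat \<Rightarrow>\<^sub>0 int) \<Rightarrow> 'f" where
  "laurent_monomial x e = (\<Prod>i \<in> Poly_Mapping.keys e. x i powi Poly_Mapping.lookup e i)"

text \<open>Evaluation at \<open>x\<close>, with the coefficients sent to the field by \<open>\<phi>\<close> (one of \<open>of_nat\<close>,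
  \<open>of_int\<close>, \<open>of_rat\<close>). The substitution of \<open>N\<close> for the \<open>j\<close>-th variable is evaluation at
  \<open>x(j := N)\<close>. A negative power of \<open>0\<close> evaluates to \<open>0\<close>; below, \<open>0\<close> is only
  substituted where no negative power of the variable occurs.\<close>

definition lp_eval :: "('c::zero \<Rightarrow> 'f::field) \<Rightarrow> (nat \<Rightarrow> 'f) \<Rightarrow> 'c lpoly \<Rightarrow> 'f" where
  "lp_eval \<phi> x p = (\<Sum>e \<in> Poly_Mapping.keys p. \<phi> (Poly_Mapping.lookup p e) * laurent_monomial x e)"

abbreviation ev :: "(nat \<Rightarrow> 'f::field_char_0) \<Rightarrow> int lpoly \<Rightarrow> 'f" where
  "ev \<equiv> lp_eval of_int"

text \<open>The subring $\mathbb{Z}[x_i^{\pm 1} \mid i \in S]$ of the ambient field.\<close>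

definition laurent_subring :: "(nat \<Rightarrow> 'f::field_char_0) \<Rightarrow> nat set \<Rightarrow> 'f ring" where
  "laurent_subring x S = ring_of_type_algebra\<lparr>carrier := ev x ` laurent_polys {} S\<rparr>"

text \<open>The ambient field is a type \<open>'f\<close> of characteristic 0. The existence of free generators
  \<open>x 1, ..., x m\<close> says exactly that \<open>'f\<close> is a field of rational functions in \<open>m\<close> variables over
  the rationals.\<close>

definition free_generators :: "nat \<Rightarrow> (nat \<Rightarrow> 'f::field_char_0) \<Rightarrow> bool" where
  "free_generators m x \<longleftrightarrow>
     (\<forall>p \<in> laurent_polys {1..m} {}. lp_eval of_rat x p = 0 \<longrightarrow> p = 0) \<and>
     (\<forall>f. \<exists>p \<in> laurent_polys {1..m} {}. \<exists>q \<in> laurent_polys {1..m} {}.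
        lp_eval of_rat x q \<noteq> 0 \<and> f = lp_eval of_rat x p / lp_eval of_rat x q)"

definition Q_sf :: "nat \<Rightarrow> (nat \<Rightarrow> 'f::field_char_0) \<Rightarrow> 'f set" where
  "Q_sf m x = {lp_eval of_nat x F / lp_eval of_nat x H | F H :: nat lpoly.
      F \<in> laurent_polys {1..m} {} \<and> H \<in> laurent_polys {1..m} {} \<and> F \<noteq> 0 \<and> H \<noteq> 0}"

section \<open>Seeds and mutation\<close>

text \<open>A seed is a cluster \<open>x\<close> (relevant at the indices 1, ..., m) together with exchange
  polynomials \<open>P\<close> (relevant at 1, ..., n). The polynomials are kept formal; since a cluster is
  algebraically independent, \<open>ev x\<close> identifies them with elements of the field.\<close>

type_synonym 'f seed = "(nat \<Rightarrow> 'f) \<times> (nat \<Rightarrow> int lpoly)"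

definition exchange_ring :: "nat \<Rightarrow> nat \<Rightarrow> int lpoly ring" where
  "exchange_ring n m = ring_of_type_algebra\<lparr>carrier := laurent_polys {1..n} {n+1..m}\<rparr>"

definition lp_seed :: "nat \<Rightarrow> nat \<Rightarrow> 'f::field_char_0 seed \<Rightarrow> bool" where
  "lp_seed n m = (\<lambda>(x, P).
     free_generators m x \<and>
     (\<forall>i\<in>{1..n}.
        P i \<in> carrier (exchange_ring n m) \<and>
        ring_irreducible\<^bsub>exchange_ring n m\<^esub> (P i) \<and>
        (\<forall>j\<in>{1..n}. \<not> (lvar j divides\<^bsub>exchange_ring n m\<^esub> P i)) \<and>
        \<not> depends_on (P i) i))"

text \<open>The exponents $a_j$ and the Laurent polynomial $\widehat P_k$. For a seed, the set whose
  maximum is taken is finite and contains 0.\<close>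

definition hat_exponent ::
    "nat \<Rightarrow> (nat \<Rightarrow> 'f::field_char_0) \<Rightarrow> (nat \<Rightarrow> int lpoly) \<Rightarrow> nat \<Rightarrow> nat \<Rightarrow> nat" where
  "hat_exponent m x P k j =
     (if j = k then 0
      else Max {s. ev (x(j := ev x (P j) / x j)) (P k) / ev x (P j) ^ s
                     \<in> carrier (laurent_subring x {1..m})})"

definition hat_poly ::
    "nat \<Rightarrow> nat \<Rightarrow> (nat \<Rightarrow> 'f::field_char_0) \<Rightarrow> (nat \<Rightarrow> int lpoly) \<Rightarrow> nat \<Rightarrow> int lpoly" where
  "hat_poly n m x P k =
     P k * Poly_Mapping.single
       (\<Sum>j\<in>{1..n}. Poly_Mapping.single j (- int (hat_exponent m x P k j))) 1"

text \<open>Mutation is a relation, because the new exchange polynomials are only defined up to a unit: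
  \<open>D\<close> ranges over all greatest common divisors. If \<open>P j\<close> depends on the \<open>k\<close>-th variable, then
  \<open>j \<noteq> k\<close> and $a_j = 0$, so that $\widehat P_k|_{x_j \leftarrow 0}$ is meaningful.\<close>

definition lp_mutation ::
    "nat \<Rightarrow> nat \<Rightarrow> nat \<Rightarrow> 'f::field_char_0 seed \<Rightarrow> 'f seed \<Rightarrow> bool" where
  "lp_mutation n m k = (\<lambda>(x, P) (x', P').
     (\<forall>i\<in>{1..m}. i \<noteq> k \<longrightarrow> x' i = x i) \<and>
     x' k = ev x (hat_poly n m x P k) / x k \<and>
     (\<forall>j\<in>{1..n}.
        if depends_on (P j) k then
          (let Q = ev (x(j := 0)) (hat_poly n m x P k);
               N = Q / x' k;
               G = ev (x(k := N)) (P j);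
               L = laurent_subring x' ({1..m} - {j})
           in \<exists>D \<in> carrier L. \<exists>e.
                D gcdof\<^bsub>L\<^esub> G Q \<and>
                Poly_Mapping.keys e \<subseteq> {1..n} \<and>
                ev x' (P' j) = laurent_monomial x' e * (G / D) \<and>
                P' j \<in> carrier (exchange_ring n m) \<and>
                (\<forall>i\<in>{1..n}. \<not> (lvar i divides\<^bsub>exchange_ring n m\<^esub> P' j)))
        else P' j = P j))"

section \<open>Patterns\<close>

text \<open>The \<open>n\<close>-regular edge-labelled tree (unique up to isomorphism), realised as the Cayley graph
  of the free product of \<open>n\<close> groups of order 2: the vertices are the words in 1, ..., n without
  equal adjacent letters, and an edge labelled \<open>k\<close> joins \<open>w\<close> and \<open>k # w\<close>.\<close>

definition tree_vertices :: "nat \<Rightarrow> nat list set" where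
  "tree_vertices n = {w. set w \<subseteq> {1..n} \<and> successively (\<noteq>) w}"

definition tree_edge :: "nat \<Rightarrow> nat \<Rightarrow> nat list \<Rightarrow> nat list \<Rightarrow> bool" where
  "tree_edge n k t t' \<longleftrightarrow>
     t \<in> tree_vertices n \<and> t' \<in> tree_vertices n \<and> (t' = k # t \<or> t = k # t')"

lemma tree_edge_sym: "tree_edge n k t t' \<longleftrightarrow> tree_edge n k t' t"
  by (auto simp: tree_edge_def)

lemma tree_edge_unique:
  assumes "t \<in> tree_vertices n" "k \<in> {1..n}"
  shows "\<exists>!t'. tree_edge n k t t'"
proof (cases "\<exists>w. t = k # w")
  case True
  then obtain w where "t = k # w" by blast
  with assms show ?thesis
    by (intro ex1I[of _ w]) (auto simp: tree_edge_def tree_vertices_def successively_Cons)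
next
  case False
  with assms show ?thesis
    by (intro ex1I[of _ "k # t"])
       (auto simp: tree_edge_def tree_vertices_def successively_Cons neq_Nil_conv)
qed

definition lp_pattern :: "nat \<Rightarrow> nat \<Rightarrow> (nat list \<Rightarrow> 'f::field_char_0 seed) \<Rightarrow> bool" where
  "lp_pattern n m \<Sigma> \<longleftrightarrow>
     (\<forall>t \<in> tree_vertices n. lp_seed n m (\<Sigma> t)) \<and>
     (\<forall>k\<in>{1..n}. \<forall>t t'. tree_edge n k t t' \<longrightarrow> lp_mutation n m k (\<Sigma> t) (\<Sigma> t'))"

definition positive_pattern :: "nat \<Rightarrow> nat \<Rightarrow> (nat list \<Rightarrow> 'f::field_char_0 seed) \<Rightarrow> bool" where
  "positive_pattern n m \<Sigma> \<longleftrightarrow>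
     (\<forall>t \<in> tree_vertices n. \<forall>t' \<in> tree_vertices n. Q_sf m (fst (\<Sigma> t)) = Q_sf m (fst (\<Sigma> t')))"

definition lp_algebra :: "nat \<Rightarrow> nat \<Rightarrow> (nat list \<Rightarrow> 'f::field_char_0 seed) \<Rightarrow> 'f set" where
  "lp_algebra n m \<Sigma> = generate_ring ring_of_type_algebra
     (\<Union>t \<in> tree_vertices n. fst (\<Sigma> t) ` {1..m} \<union> (\<lambda>i. inverse (fst (\<Sigma> t) i)) ` {n+1..m})"

definition monomials_of :: "nat \<Rightarrow> (nat \<Rightarrow> 'f::field_char_0) \<Rightarrow> 'f set" where
  "monomials_of m x = {(\<Prod>i\<in>{1..m}. x i ^ h i) | h :: nat \<Rightarrow> nat. True}"

definition cluster_monomials :: "nat \<Rightarrow> nat \<Rightarrow> (nat list \<Rightarrow> 'f::field_char_0 seed) \<Rightarrow> 'f set" where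
  "cluster_monomials n m \<Sigma> = (\<Union>t \<in> tree_vertices n. monomials_of m (fst (\<Sigma> t)))"

text \<open>By algebraic independence there is at most one expansion with respect to a cluster.\<close>

definition laurent_expansion :: "nat \<Rightarrow> (nat \<Rightarrow> 'f::field_char_0) \<Rightarrow> 'f \<Rightarrow> int lpoly \<Rightarrow> bool" where
  "laurent_expansion m x u p \<longleftrightarrow> p \<in> laurent_polys {} {1..m} \<and> ev x p = u"

definition proper_exponent :: "nat \<Rightarrow> (nat \<Rightarrow>\<^sub>0 int) \<Rightarrow> bool" where
  "proper_exponent m e \<longleftrightarrow> (\<exists>i\<in>{1..m}. Poly_Mapping.lookup e i < 0)"

end

theory Submission
  imports Defs
begin

text \<open>
  Laurent phenomenon: by Gauss's lemma, Laurent polynomials over the integers form a unique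
  factorization domain, so an exchange polynomial \<open>p\<close> in direction \<open>i\<close> is prime and defines a local
  ring \<open>O\<close>, the localization at \<open>p\<close> of the Laurent ring \<open>A\<close> of a seed. Consider three successive
  mutations in directions \<open>i\<close>, \<open>j\<close>, \<open>i\<close>. The first new variable is \<open>p\<close> times a unit of \<open>A\<close>, so the
  Laurent ring of the second seed lies in \<open>A[1/p]\<close>. The exponents in the modified exchange polynomials
  are orders of vanishing along \<open>p\<close>, which makes all variables of the fourth seed units of \<open>O\<close>, so its
  Laurent ring lies in \<open>O\<close>. As \<open>A[1/p]\<close> and \<open>O\<close> intersect in \<open>A\<close>, an element of the Laurent rings of
  the second and of the fourth seed belongs to \<open>A\<close>, and both seeds are nearer than the first one to the
  end of a walk that starts with \<open>i\<close>, \<open>j\<close>.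

  Corollary: positivity identifies the tropical points of all clusters. If a monomial
  \<open>x\<^sup>v\<close> with nonnegative exponents occurs in the expansion of a cluster monomial \<open>u\<close> in \<open>x\<close>, then
  the tropical value of \<open>x\<^sup>v\<close> is at least that of \<open>u\<close> at every tropical point, which forces
  \<open>x\<^sup>v = u\<close>. Linear independence follows by comparing coefficients in one cluster.
\<close>

section \<open>Divisibility in subrings\<close>

text \<open>The exchange polynomials of the intermediate seeds are known only through the mutation
  rule, with its monomials and greatest common divisors. They are therefore judged only by their
  order along \<open>p\<close>, the least power of \<open>p\<close> up to units of \<open>O\<close>.
  The hat exponent is defined by a substitution in the second cluster, while the order along
  \<open>p\<close> belongs to the first. The two are matched by using \<open>T = p / x1 i\<close> in
  place of \<open>x i\<close>: it is a unit of \<open>A\<close>, and in these coordinates the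
  mutation is a swap without a monomial factor. When \<open>P i\<close> involves \<open>x j\<close>,
  the second mutation changes it; an expansion in \<open>1 / x i\<close> shows that its new value
  still contains \<open>p\<close> exactly once, and this cancels against \<open>x1 i\<close>.
  Positivity speaks of fractions, whereas a Laurent expansion \<open>f\<close> may have coefficients
  of both signs, so its tropical value is not read off directly. The way out is that minimal weights
  are multiplicative on all nonzero Laurent polynomials: an equation \<open>f * B = A\<close> with
  positive \<open>A\<close> and \<open>B\<close> determines the minimal weight of
  \<open>f\<close>.\<close>

abbreviation (input) "lookup \<equiv> Poly_Mapping.lookup"
abbreviation (input) "keys \<equiv> Poly_Mapping.keys"
abbreviation (input) "single \<equiv> Poly_Mapping.single"

text \<open>Subrings are sets, and divisibility is relative to them, because many different rings
  live inside the same type: all polynomial and Laurent rings in \<open>int lpoly\<close>, and all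
  clusters' Laurent rings and their localizations in the ambient field.\<close>

definition is_subring :: "'a::comm_ring_1 set \<Rightarrow> bool" where
  "is_subring A \<longleftrightarrow> 1 \<in> A \<and> (\<forall>a\<in>A. - a \<in> A \<and> (\<forall>b\<in>A. a + b \<in> A \<and> a * b \<in> A))"

definition dvd_in :: "'a::comm_ring_1 set \<Rightarrow> 'a \<Rightarrow> 'a \<Rightarrow> bool" where
  "dvd_in A a b \<longleftrightarrow> (\<exists>c\<in>A. b = a * c)"

definition unit_in :: "'a::comm_ring_1 set \<Rightarrow> 'a \<Rightarrow> bool" where
  "unit_in A u \<longleftrightarrow> u \<in> A \<and> dvd_in A u 1"

definition prime_in :: "'a::comm_ring_1 set \<Rightarrow> 'a \<Rightarrow> bool" where
  "prime_in A p \<longleftrightarrow> p \<in> A \<and> p \<noteq> 0 \<and> \<not> unit_in A p \<and>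
     (\<forall>a\<in>A. \<forall>b\<in>A. dvd_in A p (a * b) \<longrightarrow> dvd_in A p a \<or> dvd_in A p b)"

text \<open>The factors are prime and not merely irreducible, so in a domain uniqueness of the
  factorization comes for free and no clause states it.\<close>

definition factorial_in :: "'a::comm_ring_1 set \<Rightarrow> bool" where
  "factorial_in A \<longleftrightarrow> is_subring A \<and>
     (\<forall>a\<in>A. a \<noteq> 0 \<longrightarrow>
        (\<exists>u ps. unit_in A u \<and> (\<forall>p\<in>set ps. prime_in A p) \<and> a = u * prod_list ps))"

lemma is_subringD:
  assumes "is_subring A"
  shows "1 \<in> A" "a \<in> A \<Longrightarrow> - a \<in> A" "a \<in> A \<Longrightarrow> b \<in> A \<Longrightarrow> a + b \<in> A"
    "a \<in> A \<Longrightarrow> b \<in> A \<Longrightarrow> a * b \<in> A"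
  using assms by (auto simp: is_subring_def)

lemma is_subring_zero: "is_subring A \<Longrightarrow> 0 \<in> A"
  using is_subringD(1,2,3)[of A] by (metis add.right_inverse)

lemma is_subring_diff: "is_subring A \<Longrightarrow> a \<in> A \<Longrightarrow> b \<in> A \<Longrightarrow> a - b \<in> A"
  using is_subringD(2,3)[of A] by (metis diff_conv_add_uminus)

lemma is_subring_sum:
  assumes "is_subring A" "\<And>i. i \<in> I \<Longrightarrow> f i \<in> A"
  shows "sum f I \<in> A"
  using assms(2)
  by (induction I rule: infinite_finite_induct)
     (auto intro: is_subringD[OF assms(1)] is_subring_zero[OF assms(1)])

lemma is_subring_prod:
  assumes "is_subring A" "\<And>i. i \<in> I \<Longrightarrow> f i \<in> A"
  shows "prod f I \<in> A"
  using assms(2)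
  by (induction I rule: infinite_finite_induct) (auto intro: is_subringD[OF assms(1)])

lemma is_subring_power: "is_subring A \<Longrightarrow> a \<in> A \<Longrightarrow> a ^ k \<in> A"
  by (induction k) (auto intro: is_subringD)

lemma is_subring_prod_list: "is_subring A \<Longrightarrow> set ps \<subseteq> A \<Longrightarrow> prod_list ps \<in> A"
  by (induction ps) (auto intro: is_subringD)

lemma is_subring_of_int: "is_subring A \<Longrightarrow> of_int c \<in> A"
proof -
  assume A: "is_subring A"
  have "of_nat k \<in> A" for k
    by (induction k) (auto intro: is_subringD[OF A] is_subring_zero[OF A])
  then show ?thesis
    using is_subringD(2)[OF A] by (cases c) (auto simp: simp del: of_nat_Suc)
qed

lemmas subring_intros =
  is_subringD is_subring_zero is_subring_diff is_subring_sum is_subring_prod is_subring_power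
  is_subring_prod_list is_subring_of_int

lemma dvd_inI: "c \<in> A \<Longrightarrow> b = a * c \<Longrightarrow> dvd_in A a b"
  by (auto simp: dvd_in_def)

lemma dvd_in_add: "is_subring A \<Longrightarrow> dvd_in A a b \<Longrightarrow> dvd_in A a c \<Longrightarrow> dvd_in A a (b + c)"
  unfolding dvd_in_def by (metis is_subringD(3) distrib_left)

lemma dvd_in_uminus: "is_subring A \<Longrightarrow> dvd_in A a b \<Longrightarrow> dvd_in A a (- b)"
  unfolding dvd_in_def by (metis is_subringD(2) mult_minus_right)

lemma dvd_in_diff: "is_subring A \<Longrightarrow> dvd_in A a b \<Longrightarrow> dvd_in A a c \<Longrightarrow> dvd_in A a (b - c)"
  using dvd_in_add[of A a b "- c"] dvd_in_uminus[of A a c] by simp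

lemma dvd_in_mult: "is_subring A \<Longrightarrow> dvd_in A a b \<Longrightarrow> c \<in> A \<Longrightarrow> dvd_in A a (b * c)"
  unfolding dvd_in_def by (metis is_subringD(4) mult.assoc)

lemma dvd_in_mult2: "is_subring A \<Longrightarrow> dvd_in A a b \<Longrightarrow> c \<in> A \<Longrightarrow> dvd_in A a (c * b)"
  using dvd_in_mult[of A a b c] by (simp add: mult.commute)

lemma dvd_in_trans: "is_subring A \<Longrightarrow> dvd_in A a b \<Longrightarrow> dvd_in A b c \<Longrightarrow> dvd_in A a c"
  unfolding dvd_in_def by (metis is_subringD(4) mult.assoc)

lemma dvd_in_sum:
  assumes "is_subring A" "\<And>i. i \<in> I \<Longrightarrow> dvd_in A a (f i)"
  shows "dvd_in A a (sum f I)"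
  using assms(2)
proof (induction I rule: infinite_finite_induct)
  case (insert i I)
  then show ?case by (auto intro: dvd_in_add[OF assms(1)])
qed (use is_subring_zero[OF assms(1)] in \<open>auto simp: dvd_in_def intro: bexI[of _ 0]\<close>)

lemma unit_in_mult: "is_subring A \<Longrightarrow> unit_in A u \<Longrightarrow> unit_in A v \<Longrightarrow> unit_in A (u * v)"
  unfolding unit_in_def dvd_in_def
  by (metis is_subringD(4) mult.assoc mult.left_commute mult.right_neutral)

lemma unit_in_one: "is_subring A \<Longrightarrow> unit_in A 1"
  unfolding unit_in_def dvd_in_def by (metis is_subringD(1) mult_1)

lemma unit_in_left:
  "is_subring A \<Longrightarrow> u \<in> A \<Longrightarrow> v \<in> A \<Longrightarrow> unit_in A (u * v) \<Longrightarrow> unit_in A u"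
  unfolding unit_in_def dvd_in_def by (metis is_subringD(4) mult.assoc)

lemma unit_in_inverse:
  assumes "unit_in A u"
  obtains v where "v \<in> A" "u * v = 1" "unit_in A v"
  using assms unfolding unit_in_def dvd_in_def by (metis mult.commute)

lemma prime_inD:
  assumes "prime_in A p"
  shows "p \<in> A" "p \<noteq> 0" "\<not> unit_in A p"
    "a \<in> A \<Longrightarrow> b \<in> A \<Longrightarrow> dvd_in A p (a * b) \<Longrightarrow> dvd_in A p a \<or> dvd_in A p b"
  using assms by (auto simp: prime_in_def)

lemma prime_in_unit_mult:
  assumes A: "is_subring A" and p: "prime_in A p" and u: "unit_in A u"
  shows "prime_in A (u * p)"
proof -
  obtain v where v: "v \<in> A" "u * v = 1"
    using unit_in_inverse[OF u] by blast
  have uA: "u \<in> A" using u by (simp add: unit_in_def)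
  have dvd: "dvd_in A (u * p) a \<longleftrightarrow> dvd_in A p a" for a
  proof
    assume "dvd_in A (u * p) a"
    then obtain c where c: "c \<in> A" "a = u * p * c" by (auto simp: dvd_in_def)
    then show "dvd_in A p a"
      using uA by (intro dvd_inI[of "u * c"]) (auto intro: is_subringD[OF A] simp: mult_ac)
  next
    assume "dvd_in A p a"
    then obtain c where c: "c \<in> A" "a = p * c" by (auto simp: dvd_in_def)
    have "u * p * (v * c) = (u * v) * (p * c)" by (simp add: mult_ac)
    then show "dvd_in A (u * p) a"
      using v c by (intro dvd_inI[of "v * c"]) (auto intro: is_subringD[OF A])
  qed
  have "u * p \<noteq> 0"
    using v prime_inD(2)[OF p] by (metis mult.assoc mult.commute mult_1 mult_zero_left)
  moreover have "\<not> unit_in A (u * p)"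
    using unit_in_left[OF A prime_inD(1)[OF p] uA] prime_inD(3)[OF p] by (auto simp: mult.commute)
  ultimately show ?thesis
    using prime_inD[OF p] uA is_subringD(4)[OF A] unfolding prime_in_def dvd by blast
qed

lemma prime_in_power:
  assumes A: "is_subring A" and p: "prime_in A p" and a: "a \<in> A" and d: "dvd_in A p (a ^ k)"
  shows "dvd_in A p a"
  using d
proof (induction k)
  case 0
  then show ?case using prime_inD(1,3)[OF p] by (simp add: unit_in_def)
next
  case (Suc k)
  then show ?case using prime_inD(4)[OF p a is_subring_power[OF A a, of k]] by auto
qed

text \<open>Each prime of \<open>ps\<close> divides \<open>f\<close> or \<open>g\<close>, so it can
  be cancelled there and charged to that factor; what is left over is a factorization of
  \<open>p\<close>. In this form unique factorization can be used without comparing lists up to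
  order and units.\<close>

lemma prime_factors_split:
  fixes B :: "'a::idom set"
  assumes B: "is_subring B" and u: "unit_in B u" and ps: "\<forall>q\<in>set ps. prime_in B q"
    and p: "p \<in> B"
    and "f \<in> B" "g \<in> B" "u * prod_list ps * p = f * g"
  shows "\<exists>u1 ps1 f' u2 ps2 g'. unit_in B u1 \<and> unit_in B u2 \<and> set ps1 \<union> set ps2 \<subseteq> set ps \<and>
    length ps1 + length ps2 = length ps \<and> f' \<in> B \<and> g' \<in> B \<and> p = f' * g' \<and>
    f = u1 * prod_list ps1 * f' \<and> g = u2 * prod_list ps2 * g'"
  using ps assms(5-)
proof (induction ps arbitrary: f g)
  case Nil
  obtain v where v: "v \<in> B" "u * v = 1" using unit_in_inverse[OF u] by blast
  have "p = (v * f) * g" "f = u * (v * f)"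
    using v Nil.prems(4) by (metis mult.assoc mult.commute mult_1 prod_list.Nil)+
  then show ?case using v u Nil.prems unit_in_one[OF B]
    by (intro exI[of _ u] exI[of _ "[]"] exI[of _ "v * f"] exI[of _ 1] exI[of _ g])
       (auto intro: is_subringD[OF B])
next
  case (Cons q ps)
  have q: "prime_in B q" and q0: "q \<noteq> 0" using Cons.prems(1) prime_inD(2) by auto
  define w where "w = u * prod_list ps * p"
  have qw: "q * w = f * g" using Cons.prems(4) by (simp add: w_def mult_ac)
  have main: "\<exists>u1 ps1 f' u2 ps2 g'. unit_in B u1 \<and> unit_in B u2 \<and> set ps1 \<union> set ps2 \<subseteq> set (q # ps) \<and>
    length ps1 + length ps2 = length (q # ps) \<and> f' \<in> B \<and> g' \<in> B \<and> p = f' * g' \<and>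
    f = u1 * prod_list ps1 * f' \<and> g = u2 * prod_list ps2 * g'"
    if qf: "dvd_in B q f" and g: "g \<in> B" and fg: "q * w = f * g" for f g
  proof -
    obtain f1 where f1: "f1 \<in> B" "f = q * f1" using qf by (auto simp: dvd_in_def)
    have "w = f1 * g" using fg f1 q0 by (simp add: mult.assoc)
    with Cons.IH[of f1 g] Cons.prems(1) f1 g obtain u1 ps1 f' u2 ps2 g' where
      "unit_in B u1" "unit_in B u2" "set ps1 \<union> set ps2 \<subseteq> set ps"
      "length ps1 + length ps2 = length ps" "f' \<in> B" "g' \<in> B" "p = f' * g'"
      "f1 = u1 * prod_list ps1 * f'" "g = u2 * prod_list ps2 * g'"
      unfolding w_def by auto
    then show ?thesis using f1
      by (intro exI[of _ u1] exI[of _ "q # ps1"] exI[of _ f'] exI[of _ u2] exI[of _ ps2] exI[of _ g'])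
         (auto simp: mult_ac)
  qed
  have "w \<in> B"
    unfolding w_def using Cons.prems(1) p u
    by (auto intro!: is_subringD[OF B] is_subring_prod_list[OF B] simp: prime_in_def unit_in_def)
  then have "dvd_in B q (f * g)" using qw by (intro dvd_inI[of w]) simp_all
  then consider "dvd_in B q f" | "dvd_in B q g"
    using prime_inD(4)[OF q Cons.prems(2,3)] by blast
  then show ?case
  proof cases
    case 1
    then show ?thesis using main Cons.prems(3) qw by blast
  next
    case 2
    have "q * w = g * f" using qw by (simp add: mult.commute)
    from main[OF 2 Cons.prems(2) this] obtain u1 ps1 f' u2 ps2 g' where
      "unit_in B u1" "unit_in B u2" "set ps1 \<union> set ps2 \<subseteq> set (q # ps)"
      "length ps1 + length ps2 = length (q # ps)" "f' \<in> B" "g' \<in> B" "p = f' * g'"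
      "g = u1 * prod_list ps1 * f'" "f = u2 * prod_list ps2 * g'"
      by blast
    then show ?thesis
      by (intro exI[of _ u2] exI[of _ ps2] exI[of _ g'] exI[of _ u1] exI[of _ ps1] exI[of _ f'])
         (auto simp: mult.commute)
  qed
qed

text \<open>A prime that does not divide \<open>p\<close> must divide the cofactor \<open>c\<close>,
  so the listed primes disappear one at a time. Primality is asked of the listed elements only,
  since the lemma serves to prove \<open>p\<close> prime.\<close>

lemma prime_factors_cancel:
  fixes B :: "'a::idom set"
  assumes B: "is_subring B" and u: "unit_in B u" and ps: "\<forall>q\<in>set ps. prime_in B q"
    and np: "\<forall>q\<in>set ps. \<not> dvd_in B q p" and p: "p \<in> B" and a: "a \<in> B"
    and "c \<in> B" "u * prod_list ps * a = p * c"
  shows "dvd_in B p a"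
  using ps np assms(7-)
proof (induction ps arbitrary: c)
  case Nil
  obtain v where v: "v \<in> B" "u * v = 1" using unit_in_inverse[OF u] by blast
  have "a = p * (v * c)" using v Nil.prems(4)
    by (metis mult.assoc mult.commute mult_1 prod_list.Nil)
  then show ?case using v Nil.prems(3) by (intro dvd_inI[of "v * c"]) (auto intro: is_subringD[OF B])
next
  case (Cons q ps)
  have q: "prime_in B q" and q0: "q \<noteq> 0" using Cons.prems(1) prime_inD(2) by auto
  define w where "w = u * prod_list ps * a"
  have qw: "p * c = q * w" using Cons.prems(4) by (simp add: w_def mult_ac)
  have "w \<in> B"
    unfolding w_def using Cons.prems(1) a u
    by (auto intro!: is_subringD[OF B] is_subring_prod_list[OF B] simp: prime_in_def unit_in_def)
  then have "dvd_in B q (p * c)" using qw by (intro dvd_inI[of w]) simp_all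
  then have "dvd_in B q c"
    using prime_inD(4)[OF q p Cons.prems(3)] Cons.prems(2) by auto
  then obtain d where d: "d \<in> B" "c = q * d" by (auto simp: dvd_in_def)
  have "w = p * d" using qw d q0 by (simp add: mult.left_commute)
  with Cons.IH[of d] Cons.prems d show ?case by (simp add: w_def)
qed

text \<open>Splitting the primes between \<open>p\<close> and the remaining cofactor gives at least
  one of them to \<open>p\<close>, since otherwise \<open>p\<close> would be a unit; so every power
  of \<open>p\<close> uses up an entry of the list.\<close>

lemma prime_power_bound:
  fixes B :: "'a::idom set"
  assumes B: "is_subring B" and u: "unit_in B u" and ps: "\<forall>q\<in>set ps. prime_in B q"
    and p: "prime_in B p" and "c \<in> B" "u * prod_list ps = p ^ s * c"
  shows "s \<le> length ps"
  using u ps assms(5-)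
proof (induction s arbitrary: u ps c)
  case (Suc s)
  have "p ^ s * c \<in> B" using Suc.prems prime_inD(1)[OF p]
    by (auto intro: is_subringD[OF B] is_subring_power[OF B])
  moreover have "u * prod_list ps * 1 = p * (p ^ s * c)" using Suc.prems by (simp add: mult_ac)
  ultimately obtain u1 ps1 f u2 ps2 g where *: "unit_in B u1" "unit_in B u2"
      "set ps1 \<union> set ps2 \<subseteq> set ps" "length ps1 + length ps2 = length ps" "f \<in> B" "g \<in> B"
      "1 = f * g" "p = u1 * prod_list ps1 * f" "p ^ s * c = u2 * prod_list ps2 * g"
    using prime_factors_split[OF B Suc.prems(1,2) is_subringD(1)[OF B] prime_inD(1)[OF p]]
    by blast
  have "unit_in B f" using * by (auto simp: unit_in_def dvd_in_def)
  then have ps1: "ps1 \<noteq> []" using *(1,8) unit_in_mult[OF B] prime_inD(3)[OF p] by fastforce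
  have "u2 * prod_list ps2 = p ^ s * (c * f)"
  proof -
    have "p ^ s * (c * f) = u2 * prod_list ps2 * (f * g)" using *(9)
      by (metis mult.assoc mult.commute)
    then show ?thesis using *(7) by simp
  qed
  moreover have "\<forall>q\<in>set ps2. prime_in B q" "c * f \<in> B"
    using *(3,5) Suc.prems(2,3) is_subringD(4)[OF B] by auto
  ultimately have "s \<le> length ps2"
    using Suc.IH[OF *(2)] by metis
  then show ?case using *(4) ps1 by (cases ps1) auto
qed simp

lemma factorial_in_power_bound:
  fixes B :: "'a::idom set"
  assumes "factorial_in B" "prime_in B p" "a \<in> B" "a \<noteq> 0"
  obtains N where "\<And>s. dvd_in B (p ^ s) a \<Longrightarrow> s \<le> N"
proof -
  obtain u ps where "unit_in B u" "\<forall>q\<in>set ps. prime_in B q" "a = u * prod_list ps"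
    using assms by (auto simp: factorial_in_def)
  then have "s \<le> length ps" if "dvd_in B (p ^ s) a" for s
    using prime_power_bound[of B u ps p] assms(1,2) that by (auto simp: factorial_in_def dvd_in_def)
  then show ?thesis by (rule that)
qed

section \<open>Prime factorization in images and in localizations\<close>

lemma dvd_in_image_iff:
  assumes A: "is_subring A" and inj: "inj_on h A"
    and hmult: "\<And>a b. a \<in> A \<Longrightarrow> b \<in> A \<Longrightarrow> h (a * b) = h a * h b"
    and ab: "a \<in> A" "b \<in> A"
  shows "dvd_in (h ` A) (h a) (h b) \<longleftrightarrow> dvd_in A a b"
proof -
  have "h b = h a * h c \<longleftrightarrow> b = a * c" if "c \<in> A" for c
    using inj_onD[OF inj, of b "a * c"] that ab is_subringD(4)[OF A] by (auto simp: hmult)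
  then show ?thesis by (auto simp: dvd_in_def)
qed

lemma prime_in_image:
  assumes A: "is_subring A" and inj: "inj_on h A" and h0: "h 0 = 0" and h1: "h 1 = 1"
    and hmult: "\<And>a b. a \<in> A \<Longrightarrow> b \<in> A \<Longrightarrow> h (a * b) = h a * h b"
    and p: "prime_in A p"
  shows "prime_in (h ` A) (h p)"
proof -
  note dvd = dvd_in_image_iff[OF A inj hmult]
  have pA: "p \<in> A" "p \<noteq> 0" using prime_inD[OF p] by auto
  then have "h p \<noteq> 0" using inj_onD[OF inj, of p 0] is_subring_zero[OF A] h0 by auto
  moreover have "\<not> unit_in (h ` A) (h p)"
    using dvd[of p 1] is_subringD(1)[OF A] pA prime_inD(3)[OF p] by (auto simp: unit_in_def h1)
  moreover have "dvd_in (h ` A) (h p) (h b) \<or> dvd_in (h ` A) (h p) (h c)"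
    if bc: "b \<in> A" "c \<in> A" "dvd_in (h ` A) (h p) (h b * h c)" for b c
  proof -
    have "dvd_in A p (b * c)"
      using bc dvd[of p "b * c"] pA is_subringD(4)[OF A] by (simp add: hmult)
    then show ?thesis using prime_inD(4)[OF p bc(1,2)] dvd pA bc by blast
  qed
  ultimately show ?thesis using pA unfolding prime_in_def by blast
qed

lemma factorial_in_image:
  fixes h :: "'a::idom \<Rightarrow> 'b::idom"
  assumes A: "factorial_in A" and inj: "inj_on h A" and h1: "h 1 = 1"
    and hadd: "\<And>a b. h (a + b) = h a + h b" and hmult: "\<And>a b. h (a * b) = h a * h b"
  shows "factorial_in (h ` A)"
proof -
  have sA: "is_subring A" using A by (simp add: factorial_in_def)
  have "h 0 + h 0 = h 0 + 0" unfolding hadd[symmetric] by simp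
  then have h0: "h 0 = 0" by (rule add_left_imp_eq)
  have hm: "h (- a) = - h a" for a using hadd[of a "- a"] h0 by (simp add: eq_neg_iff_add_eq_0 add.commute)
  have sB: "is_subring (h ` A)"
    unfolding is_subring_def
    using is_subringD[OF sA] by (auto simp flip: h1 hadd hmult hm)
  have unit: "unit_in (h ` A) (h a)" if "unit_in A a" for a
    using dvd_in_image_iff[OF sA inj hmult, of a 1] that is_subringD(1)[OF sA]
    by (auto simp: unit_in_def h1)
  have plist: "h (prod_list ps) = prod_list (map h ps)" for ps
    by (induction ps) (auto simp: h1 hmult)
  have "\<exists>u ps. unit_in (h ` A) u \<and> (\<forall>p\<in>set ps. prime_in (h ` A) p) \<and> h a = u * prod_list ps"
    if "a \<in> A" "h a \<noteq> 0" for a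
  proof -
    have "a \<noteq> 0" using that h0 by auto
    then obtain u ps where "unit_in A u" "\<forall>p\<in>set ps. prime_in A p" "a = u * prod_list ps"
      using A \<open>a \<in> A\<close> unfolding factorial_in_def by blast
    then show ?thesis using unit[of u] prime_in_image[OF sA inj h0 h1 hmult] plist
      by (intro exI[of _ "h u"] exI[of _ "map h ps"]) (auto simp: hmult)
  qed
  then show ?thesis using sB by (auto simp: factorial_in_def)
qed

text \<open>Split off one prime from a factorization of \<open>p\<close>: irreducibility makes the
  rest a unit, so \<open>p\<close> is associated to that prime.\<close>

lemma irreducible_prime_in:
  assumes A: "factorial_in A" and p: "p \<in> A" "p \<noteq> 0" "\<not> unit_in A p"
    and irr: "\<And>f g. f \<in> A \<Longrightarrow> g \<in> A \<Longrightarrow> p = f * g \<Longrightarrow> unit_in A f \<or> unit_in A g"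
  shows "prime_in A p"
proof -
  have sA: "is_subring A" using A by (simp add: factorial_in_def)
  obtain u ps where u: "unit_in A u" and ps: "\<forall>q\<in>set ps. prime_in A q" and eq: "p = u * prod_list ps"
    using A p by (auto simp: factorial_in_def)
  obtain q qs where qs: "ps = q # qs" using eq u p(3) by (cases ps) auto
  define v where "v = u * prod_list qs"
  have "set qs \<subseteq> A" using ps qs prime_inD(1) by auto
  then have v: "v \<in> A" unfolding v_def
    using u by (auto intro: is_subringD[OF sA] is_subring_prod_list[OF sA] simp: unit_in_def)
  have q: "prime_in A q" using ps qs by simp
  have eq': "p = v * q" using eq by (simp add: v_def qs mult_ac)
  then have "unit_in A v" using irr[OF v prime_inD(1)[OF q]] prime_inD(3)[OF q] by blast
  then show ?thesis using prime_in_unit_mult[OF sA q] eq' by simp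
qed

text \<open>Every element of \<open>L\<close> has a denominator in \<open>B\<close> that is a unit
  of \<open>L\<close>. A prime of \<open>B\<close> either becomes a unit of \<open>L\<close>, and is
  absorbed into the unit factor, or stays prime, because a divisibility in \<open>L\<close> can be
  multiplied by denominators and read in \<open>B\<close>.\<close>

lemma factorial_in_localization:
  fixes B L :: "'a::idom set"
  assumes B: "factorial_in B" and L: "is_subring L" and BL: "B \<subseteq> L"
    and S: "\<And>a. a \<in> L \<Longrightarrow> \<exists>s\<in>B. unit_in L s \<and> s * a \<in> B"
  shows "factorial_in L"
proof -
  have sB: "is_subring B" using B by (simp add: factorial_in_def)
  have dL: "dvd_in L p a" if "dvd_in B p a" for p a
    using that BL by (auto simp: dvd_in_def)
  have cancel: "dvd_in L p a" if s: "unit_in L s" and d: "dvd_in L p (s * a)" for p s a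
  proof -
    obtain c where c: "c \<in> L" "s * a = p * c" using d by (auto simp: dvd_in_def)
    obtain v where v: "v \<in> L" "s * v = 1" using unit_in_inverse[OF s] by blast
    have "a = (s * v) * a" using v by simp
    also have "\<dots> = v * (s * a)" by (simp only: mult_ac)
    finally have "a = p * (v * c)" unfolding c(2) by (simp only: mult_ac)
    then show ?thesis using c v by (intro dvd_inI[of "v * c"]) (auto intro: is_subringD[OF L])
  qed
  have prime: "prime_in L p" if p: "prime_in B p" and np: "\<not> unit_in L p" for p
  proof -
    have "dvd_in L p a \<or> dvd_in L p b" if ab: "a \<in> L" "b \<in> L" "dvd_in L p (a * b)" for a b
    proof -
      obtain c where c: "c \<in> L" "a * b = p * c" using ab by (auto simp: dvd_in_def)
      obtain s1 s2 s3 where s: "s1 \<in> B" "unit_in L s1" "s1 * a \<in> B" "s2 \<in> B" "unit_in L s2"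
          "s2 * b \<in> B" "s3 \<in> B" "unit_in L s3" "s3 * c \<in> B"
        using S ab c by meson
      have "s3 * ((s1 * a) * (s2 * b)) = s3 * s1 * s2 * (a * b)"
        by (simp add: mult_ac)
      also have "\<dots> = p * (s1 * s2 * (s3 * c))"
        by (simp add: c(2) mult_ac)
      finally have "s3 * ((s1 * a) * (s2 * b)) = p * (s1 * s2 * (s3 * c))" .
      then have "dvd_in B p (s3 * ((s1 * a) * (s2 * b)))"
        using s by (intro dvd_inI[of "s1 * s2 * (s3 * c)"]) (auto intro: is_subringD[OF sB])
      then have "dvd_in B p s3 \<or> dvd_in B p (s1 * a) \<or> dvd_in B p (s2 * b)"
        using prime_inD(4)[OF p] s is_subringD(4)[OF sB] by meson
      moreover have "\<not> dvd_in B p s3"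
        \<comment> \<open>A divisor of the unit \<open>s3\<close> would be a unit of
          \<open>L\<close>, which \<open>np\<close> excludes.\<close>
        using dL[of p s3] s(8) np cancel[of s3 p 1] dvd_in_trans[OF L, of p s3 1] prime_inD(1)[OF p] BL
        by (auto simp: unit_in_def)
      ultimately have "dvd_in L p (s1 * a) \<or> dvd_in L p (s2 * b)" using dL by blast
      then show ?thesis using cancel[OF s(2)] cancel[OF s(5)] by blast
    qed
    then show ?thesis using prime_inD[OF p] np BL unfolding prime_in_def by blast
  qed
  have split: "\<exists>u qs. unit_in L u \<and> (\<forall>q\<in>set qs. prime_in L q) \<and> prod_list ps = u * prod_list qs"
    if "\<forall>q\<in>set ps. prime_in B q" for ps
    using that
  proof (induction ps)
    case Nil
    then show ?case using unit_in_one[OF L] by (intro exI[of _ 1] exI[of _ "[]"]) auto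
  next
    case (Cons p ps)
    then obtain u qs where uq: "unit_in L u" "\<forall>q\<in>set qs. prime_in L q" "prod_list ps = u * prod_list qs"
      by auto
    show ?case
    proof (cases "unit_in L p")
      case True
      then show ?thesis using uq unit_in_mult[OF L]
        by (intro exI[of _ "p * u"] exI[of _ qs]) (auto simp: mult_ac)
    next
      case False
      then show ?thesis using uq prime Cons.prems
        by (intro exI[of _ u] exI[of _ "p # qs"]) (auto simp: mult_ac)
    qed
  qed
  have "\<exists>u ps. unit_in L u \<and> (\<forall>p\<in>set ps. prime_in L p) \<and> a = u * prod_list ps"
    if a: "a \<in> L" "a \<noteq> 0" for a
  proof -
    obtain s where s: "s \<in> B" "unit_in L s" "s * a \<in> B" using S a by blast
    obtain v where v: "s * v = 1" "unit_in L v" using unit_in_inverse[OF s(2)] by blast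
    have "s * a \<noteq> 0" using a v by auto
    then obtain u ps where u: "unit_in B u" "\<forall>p\<in>set ps. prime_in B p" "s * a = u * prod_list ps"
      using B s by (auto simp: factorial_in_def)
    obtain w qs where w: "unit_in L w" "\<forall>q\<in>set qs. prime_in L q" "prod_list ps = w * prod_list qs"
      using split[OF u(2)] by blast
    have "unit_in L u" using u BL dL by (auto simp: unit_in_def)
    then have "unit_in L (v * u * w)" by (intro unit_in_mult[OF L] v(2) w(1))
    moreover have "a = v * u * w * prod_list qs"
    proof -
      have "a = (s * v) * a" using v by simp
      also have "\<dots> = v * (s * a)" by (simp only: mult_ac)
      finally show ?thesis unfolding u(3) w(3) by (simp only: mult_ac)
    qed
    ultimately show ?thesis using w(2) by blast
  qed
  then show ?thesis using L by (auto simp: factorial_in_def)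
qed

section \<open>The lemma of Gauss\<close>

definition polys_over :: "'a::comm_ring_1 set \<Rightarrow> 'a poly set" where
  "polys_over A = {f. \<forall>i. poly.coeff f i \<in> A}"

lemma is_subring_polys_over:
  assumes A: "is_subring A"
  shows "is_subring (polys_over A)"
  unfolding is_subring_def polys_over_def
  by (auto simp: Polynomial.coeff_1 coeff_mult intro!: subring_intros[OF A])

lemma const_in_polys_over: "is_subring A \<Longrightarrow> a \<in> A \<Longrightarrow> [:a:] \<in> polys_over A"
  by (auto simp: polys_over_def coeff_pCons is_subring_zero split: nat.split)

lemma const_in_polys_overD: "[:a:] \<in> polys_over A \<Longrightarrow> a \<in> A"
  unfolding polys_over_def using coeff_pCons_0[of a 0] by (metis mem_Collect_eq)

lemma monom_in_polys_over: "is_subring A \<Longrightarrow> a \<in> A \<Longrightarrow> Polynomial.monom a k \<in> polys_over A"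
  by (auto simp: polys_over_def is_subring_zero)

lemma lead_coeff_in: "f \<in> polys_over A \<Longrightarrow> lead_coeff f \<in> A"
  by (auto simp: polys_over_def)

lemma const_dvd_in_polys_over:
  assumes A: "is_subring A"
  shows "dvd_in (polys_over A) [:q:] f \<longleftrightarrow> (\<forall>i. dvd_in A q (poly.coeff f i))"
proof
  assume "\<forall>i. dvd_in A q (poly.coeff f i)"
  then obtain c where c: "\<And>i. c i \<in> A" "\<And>i. poly.coeff f i = q * c i"
    unfolding dvd_in_def by metis
  define g where "g = (\<Sum>i\<le>Polynomial.degree f. Polynomial.monom (c i) i)"
  have cg: "poly.coeff g i = (if i \<le> Polynomial.degree f then c i else 0)" for i
    by (simp add: g_def coeff_sum sum.delta')
  have "f = [:q:] * g"
    by (intro poly_eqI) (auto simp: cg c(2)[symmetric] coeff_eq_0)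
  moreover have "g \<in> polys_over A" using c is_subring_zero[OF A] by (auto simp: polys_over_def cg)
  ultimately show "dvd_in (polys_over A) [:q:] f" by (auto simp: dvd_in_def)
qed (auto simp: dvd_in_def polys_over_def)

lemma const_unit_in_polys_over:
  assumes A: "is_subring A" and u: "unit_in A u"
  shows "unit_in (polys_over A) [:u:]"
proof -
  obtain v where v: "v \<in> A" "u * v = 1" using unit_in_inverse[OF u] by blast
  then show ?thesis using u const_in_polys_over[OF A]
    unfolding unit_in_def by (auto intro!: dvd_inI[of "[:v:]"] simp: one_pCons mult.commute)
qed

text \<open>If \<open>q\<close> divides neither factor, let \<open>i\<close> and \<open>j\<close> be
  the least indices of coefficients not divisible by \<open>q\<close>. In the coefficient of index
  \<open>i + j\<close> of the product, every other summand contains an earlier coefficient of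
  \<open>f\<close> or of \<open>g\<close>, so \<open>q\<close> would divide the product of the two
  chosen coefficients.\<close>

lemma const_prime_in_polys_over:
  fixes A :: "'a::idom set"
  assumes A: "is_subring A" and q: "prime_in A q"
  shows "prime_in (polys_over A) [:q:]"
proof -
  have "dvd_in (polys_over A) [:q:] f \<or> dvd_in (polys_over A) [:q:] g"
    if f: "f \<in> polys_over A" and g: "g \<in> polys_over A" and fg: "dvd_in (polys_over A) [:q:] (f * g)" for f g
  proof (rule ccontr)
    define D where "D = (\<lambda>h i. \<not> dvd_in A q (poly.coeff h i))"
    assume "\<not> ?thesis"
    then have ex: "\<exists>i. D f i" "\<exists>i. D g i"
      by (auto simp: const_dvd_in_polys_over[OF A] D_def)
    define i j where "i = (LEAST i. D f i)" and "j = (LEAST i. D g i)"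
    have ij: "D f i" "D g j" "\<And>k. k < i \<Longrightarrow> \<not> D f k" "\<And>k. k < j \<Longrightarrow> \<not> D g k"
      using LeastI_ex[OF ex(1)] LeastI_ex[OF ex(2)] not_less_Least by (auto simp: i_def j_def)
    have fgA: "poly.coeff f k \<in> A" "poly.coeff g k \<in> A" for k using f g by (auto simp: polys_over_def)
    have "poly.coeff (f * g) (i + j) =
        (\<Sum>k\<in>{..i+j} - {i}. poly.coeff f k * poly.coeff g (i + j - k)) + poly.coeff f i * poly.coeff g j"
      by (subst coeff_mult, subst sum.remove[of _ i]) auto
    then have eq: "poly.coeff f i * poly.coeff g j = poly.coeff (f * g) (i + j) -
        (\<Sum>k\<in>{..i+j} - {i}. poly.coeff f k * poly.coeff g (i + j - k))" by simp
    have "dvd_in A q (poly.coeff f k * poly.coeff g (i + j - k))" if "k \<in> {..i+j} - {i}" for k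
    proof (cases "k < i")
      case True
      then show ?thesis using ij(3) dvd_in_mult[OF A _ fgA(2)] by (auto simp: D_def)
    next
      case False
      then have "i + j - k < j" using that by auto
      then show ?thesis using ij(4) dvd_in_mult2[OF A _ fgA(1)] by (auto simp: D_def)
    qed
    then have "dvd_in A q (poly.coeff f i * poly.coeff g j)"
      unfolding eq using fg
      by (intro dvd_in_diff[OF A] dvd_in_sum[OF A]) (auto simp: const_dvd_in_polys_over[OF A])
    then show False using prime_inD(4)[OF q fgA] ij by (auto simp: D_def)
  qed
  moreover have "\<not> unit_in (polys_over A) [:q:]"
    using prime_inD(1,3)[OF q]
    by (auto simp: unit_in_def const_dvd_in_polys_over[OF A] Polynomial.coeff_1 dest: spec[of _ 0])
  ultimately show ?thesis
    using prime_inD(1,2)[OF q] const_in_polys_over[OF A] unfolding prime_in_def by auto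
qed

text \<open>The coefficients cannot be divided, so each round of the division multiplies by the
  leading coefficient of \<open>d\<close>; the factor \<open>s\<close> is a power of it.\<close>

lemma pseudo_division_in:
  fixes A :: "'a::idom set"
  assumes A: "is_subring A" and d: "d \<in> polys_over A" "d \<noteq> 0" and f: "f \<in> polys_over A"
  shows "\<exists>s q r. s \<in> A \<and> s \<noteq> 0 \<and> q \<in> polys_over A \<and> r \<in> polys_over A \<and>
    [:s:] * f = q * d + r \<and> (r = 0 \<or> Polynomial.degree r < Polynomial.degree d)"
  using f
proof (induction "Polynomial.degree f" arbitrary: f rule: less_induct)
  case less
  note B = is_subring_polys_over[OF A]
  show ?case
  proof (cases "f = 0 \<or> Polynomial.degree f < Polynomial.degree d")
    case True
    then show ?thesis using less.prems is_subringD(1)[OF A] is_subring_zero[OF B]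
      by (intro exI[of _ 1] exI[of _ 0] exI[of _ f]) auto
  next
    case False
    define M where "M = Polynomial.monom (lead_coeff f) (Polynomial.degree f - Polynomial.degree d)"
    define f' where "f' = [:lead_coeff d:] * f - M * d"
    have MB: "M \<in> polys_over A" unfolding M_def
      using lead_coeff_in[OF less.prems] by (rule monom_in_polys_over[OF A])
    have LB: "[:lead_coeff d:] \<in> polys_over A"
      using lead_coeff_in[OF d(1)] by (rule const_in_polys_over[OF A])
    have f'B: "f' \<in> polys_over A" unfolding f'_def
      using MB LB d less.prems by (auto intro!: subring_intros[OF B] simp del: mult_pCons_left)
    have dM: "Polynomial.degree M = Polynomial.degree f - Polynomial.degree d"
      using False by (simp add: M_def degree_monom_eq)
    have deg: "Polynomial.degree f' \<le> Polynomial.degree f"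
      unfolding f'_def using degree_mult_le[of M d] dM False
      by (intro degree_diff_le) (auto intro: degree_smult_le)
    have "poly.coeff (M * d) (Polynomial.degree f) = lead_coeff f * lead_coeff d"
      using coeff_mult_degree_sum[of M d] dM False by (simp add: M_def)
    then have c0: "poly.coeff f' (Polynomial.degree f) = 0" by (simp add: f'_def)
    show ?thesis
    proof (cases "Polynomial.degree f' < Polynomial.degree f")
      case True
      then obtain s q r where s: "s \<in> A" "s \<noteq> 0" "q \<in> polys_over A" "r \<in> polys_over A"
          "[:s:] * f' = q * d + r" "r = 0 \<or> Polynomial.degree r < Polynomial.degree d"
        using less.hyps[OF _ f'B] by blast
      have "[:s * lead_coeff d:] * f = [:s:] * (f' + M * d)" by (simp add: f'_def mult.commute)
      also have "\<dots> = (q + [:s:] * M) * d + r" using s(5) by (simp add: algebra_simps)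
      finally have "[:s * lead_coeff d:] * f = (q + [:s:] * M) * d + r" .
      moreover have "q + [:s:] * M \<in> polys_over A"
        using s(3) MB const_in_polys_over[OF A s(1)] is_subringD(3,4)[OF B] by blast
      moreover have "s * lead_coeff d \<in> A" "s * lead_coeff d \<noteq> 0"
        using s(1,2) d(2) lead_coeff_in[OF d(1)] is_subringD(4)[OF A] by auto
      ultimately show ?thesis using s(4,6) by blast
    next
      case F: False
      then have "f' = 0" using deg c0 by (metis leading_coeff_0_iff le_neq_implies_less)
      then show ?thesis using d lead_coeff_in[OF d(1)] MB is_subring_zero[OF B]
        by (intro exI[of _ "lead_coeff d"] exI[of _ M] exI[of _ 0]) (auto simp: f'_def)
    qed
  qed
qed

lemma const_prime_factors:
  fixes A :: "'a::idom set"
  assumes "factorial_in A" "a \<in> A" "a \<noteq> 0"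
  obtains u ps where "unit_in A u" "\<forall>q\<in>set ps. prime_in A q" "a = u * prod_list ps"
    "unit_in (polys_over A) [:u:]" "\<forall>q\<in>set (map (\<lambda>q. [:q:]) ps). prime_in (polys_over A) q"
    "[:a:] = [:u:] * prod_list (map (\<lambda>q. [:q:]) ps)"
proof -
  have A: "is_subring A" using assms by (simp add: factorial_in_def)
  obtain u ps where *: "unit_in A u" "\<forall>q\<in>set ps. prime_in A q" "a = u * prod_list ps"
    using assms by (auto simp: factorial_in_def)
  have "prod_list (map (\<lambda>q. [:q:]) ps) = [:prod_list ps:]" for ps :: "'a list"
    by (induction ps) (simp_all add: one_pCons)
  then have "[:a:] = [:u:] * prod_list (map (\<lambda>q. [:q:]) ps)" by (simp add: *(3))
  then show thesis
    using that[of u ps] * const_unit_in_polys_over[OF A] const_prime_in_polys_over[OF A] by auto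
qed

text \<open>The ideal generated by \<open>p\<close> and \<open>a\<close> contains, up to constant factors, a greatest common
  divisor \<open>d\<close> over the fraction field; \<open>p\<close> being irreducible, \<open>d\<close> is either a constant
  or \<open>p\<close> up to constants, and constants can be cancelled prime by prime.\<close>

lemma irreducible_prime_in_polys_over:
  fixes A :: "'a::idom set"
  assumes fA: "factorial_in A" and p: "p \<in> polys_over A" and deg: "Polynomial.degree p > 0"
    and irr: "\<And>f g. f \<in> polys_over A \<Longrightarrow> g \<in> polys_over A \<Longrightarrow> p = f * g \<Longrightarrow>
      unit_in (polys_over A) f \<or> unit_in (polys_over A) g"
  shows "prime_in (polys_over A) p"
proof -
  let ?B = "polys_over A"
  have A: "is_subring A" using fA by (simp add: factorial_in_def)
  note B = is_subring_polys_over[OF A]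
  have unit_deg: "Polynomial.degree u = 0" if u: "unit_in ?B u" for u
  proof -
    obtain v where "u * v = 1" using unit_in_inverse[OF u] by blast
    then show ?thesis by (metis degree_1 degree_mult_eq_0 mult_eq_0_iff zero_neq_one add_is_0 degree_mult_eq)
  qed
  have deg0: "Polynomial.degree s = 0 \<and> Polynomial.degree t = 0" if "s * t = [:a:]" "a \<noteq> 0" for s t :: "'a poly" and a
  proof -
    have "s \<noteq> 0" "t \<noteq> 0" using that by auto
    then show ?thesis using degree_mult_eq[of s t] that(1) by simp
  qed
  have const_nd: "\<not> dvd_in ?B [:q:] p" if q: "prime_in A q" for q
  proof
    assume "dvd_in ?B [:q:] p"
    then obtain c where c: "c \<in> ?B" "p = [:q:] * c" by (auto simp: dvd_in_def)
    then have "unit_in ?B c"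
      using irr[of "[:q:]" c] prime_inD[OF const_prime_in_polys_over[OF A q]] by auto
    then show False using unit_deg[of c] c deg by (auto split: if_splits)
  qed
  have cancel: "dvd_in ?B p b" if s: "s \<in> A" "s \<noteq> 0" and b: "b \<in> ?B" and d: "dvd_in ?B p ([:s:] * b)" for s b
  proof -
    obtain u ps where u: "\<forall>q\<in>set ps. prime_in A q" "unit_in ?B [:u:]"
        "\<forall>q\<in>set (map (\<lambda>q. [:q:]) ps). prime_in ?B q" "[:s:] = [:u:] * prod_list (map (\<lambda>q. [:q:]) ps)"
      using const_prime_factors[OF fA s] by metis
    obtain c where c: "c \<in> ?B" "[:s:] * b = p * c" using d by (auto simp: dvd_in_def)
    show ?thesis
      by (rule prime_factors_cancel[OF B u(2,3) _ p b c(1)]) (use u(1) const_nd c u(4) in auto)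
  qed
  have "dvd_in ?B p a \<or> dvd_in ?B p b"
    if a: "a \<in> ?B" and b: "b \<in> ?B" and ab: "dvd_in ?B p (a * b)" for a b
  proof -
    define I where "I = {u * p + v * a | u v. u \<in> ?B \<and> v \<in> ?B}"
    have I_lin: "s * f - t * g \<in> I" if st: "s \<in> ?B" "t \<in> ?B" and fg: "f \<in> I" "g \<in> I" for s t f g
    proof -
      obtain u v u' v' where *: "f = u * p + v * a" "g = u' * p + v' * a" "u \<in> ?B" "v \<in> ?B" "u' \<in> ?B" "v' \<in> ?B"
        using fg by (auto simp: I_def)
      have "s * f - t * g = (s * u - t * u') * p + (s * v - t * v') * a"
        by (simp add: * algebra_simps)
      moreover have "s * u - t * u' \<in> ?B" "s * v - t * v' \<in> ?B"
        using * st by (auto intro!: subring_intros[OF B])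
      ultimately show ?thesis unfolding I_def by blast
    qed
    have pI: "p \<in> I" and aI: "a \<in> I"
      unfolding I_def using is_subring_zero[OF B] is_subringD(1)[OF B]
      by (force intro: exI[of _ 1] exI[of _ 0])+
    have I_B: "I \<subseteq> ?B" using p a by (auto simp: I_def intro!: is_subringD[OF B])
    have "\<exists>d. (d \<in> I \<and> d \<noteq> 0) \<and> (\<forall>f. f \<in> I \<and> f \<noteq> 0 \<longrightarrow> Polynomial.degree d \<le> Polynomial.degree f)"
      using pI deg by (intro ex_has_least_nat[of _ p]) auto
    then obtain d where d: "d \<in> I" "d \<noteq> 0"
      and min: "\<And>f. f \<in> I \<Longrightarrow> f \<noteq> 0 \<Longrightarrow> Polynomial.degree d \<le> Polynomial.degree f" by blast
    have dB: "d \<in> ?B" using d I_B by blast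
    have ddvd: "\<exists>s q. s \<in> A \<and> s \<noteq> 0 \<and> q \<in> ?B \<and> [:s:] * f = q * d" if f: "f \<in> I" for f
    proof -
      obtain s q r where s: "s \<in> A" "s \<noteq> 0" "q \<in> ?B" "r \<in> ?B" "[:s:] * f = q * d + r"
          "r = 0 \<or> Polynomial.degree r < Polynomial.degree d"
        using pseudo_division_in[OF A dB d(2), of f] f I_B by blast
      have "r = [:s:] * f - q * d" using s by simp
      then have "r \<in> I" using I_lin[OF const_in_polys_over[OF A s(1)] s(3) f d(1)] by simp
      then have "r = 0" using min s(6) by force
      then show ?thesis using s by auto
    qed
    obtain s q where s: "s \<in> A" "s \<noteq> 0" "q \<in> ?B" "[:s:] * p = q * d" using ddvd[OF pI] by blast
    \<comment> \<open>Unique factorization replaces the fraction field here: in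
      \<open>[:s:] * p = q * d\<close> the primes of \<open>s\<close> are distributed over
      \<open>q\<close> and \<open>d\<close>, and the remaining parts \<open>f'\<close> and
      \<open>g'\<close> multiply to \<open>p\<close>, so one of them is a unit.\<close>
    obtain u ps where u: "unit_in ?B [:u:]"
        "\<forall>q\<in>set (map (\<lambda>q. [:q:]) ps). prime_in ?B q" "[:s:] = [:u:] * prod_list (map (\<lambda>q. [:q:]) ps)"
      using const_prime_factors[OF fA s(1,2)] by metis
    obtain u1 ps1 f' u2 ps2 g' where sp: "unit_in ?B u1" "unit_in ?B u2"
        "set ps1 \<union> set ps2 \<subseteq> set (map (\<lambda>q. [:q:]) ps)" "f' \<in> ?B" "g' \<in> ?B" "p = f' * g'"
        "q = u1 * prod_list ps1 * f'" "d = u2 * prod_list ps2 * g'"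
      using prime_factors_split[OF B u(1,2) p s(3) dB] s(4) u(3) by metis
    define s1 where "s1 = u1 * prod_list ps1"
    define s2 where "s2 = u2 * prod_list ps2"
    have "(s1 * s2) * p = [:s:] * p" using s(4) sp(6,7,8) by (simp add: s1_def s2_def mult_ac)
    then have s12: "s1 * s2 = [:s:]" using deg by (auto simp del: mult_pCons_left)
    have deg12: "Polynomial.degree s2 = 0" "Polynomial.degree s1 = 0" using deg0[OF s12 s(2)] by auto
    have ps_B: "set ps1 \<union> set ps2 \<subseteq> ?B" using sp(3) u(2) prime_inD(1) by blast
    have s2B: "s2 \<in> ?B"
      unfolding s2_def using sp(2) ps_B
      by (auto intro!: is_subringD(4)[OF B] is_subring_prod_list[OF B] simp: unit_in_def)
    obtain t where t: "s2 = [:t:]" "t \<in> A" "t \<noteq> 0"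
    proof -
      obtain t where "s2 = [:t:]" using deg12(1) by (rule degree_eq_zeroE)
      moreover have "s2 \<noteq> 0" using s12 s(2) by auto
      ultimately show thesis using that s2B const_in_polys_overD[of t A] by auto
    qed
    consider "unit_in ?B f'" | "unit_in ?B g'" using irr[OF sp(4-6)] by blast
    then show ?thesis
    proof cases
      case 1
      obtain h where h: "h \<in> ?B" "f' * h = 1" using unit_in_inverse[OF 1] by blast
      have d_eq: "d = [:t:] * (p * h)"
        using sp(6,8) h(2) by (simp add: s2_def[symmetric] t(1) mult_ac del: mult_pCons_left)
           (metis mult.assoc mult.commute mult_1)
      obtain s' q' where s': "s' \<in> A" "s' \<noteq> 0" "q' \<in> ?B" "[:s':] * a = q' * d" using ddvd[OF aI] by blast
      have "[:s':] * a = p * ([:t:] * h * q')" unfolding s'(4) d_eq by (simp only: mult_ac)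
      then have "dvd_in ?B p ([:s':] * a)"
        using h s' const_in_polys_over[OF A t(2)]
        by (intro dvd_inI[of "[:t:] * h * q'"]) (auto intro!: is_subringD(4)[OF B] simp del: mult_pCons_left)
      then show ?thesis using cancel[OF s'(1,2) a] by simp
    next
      case 2
      \<comment> \<open>The ideal now contains a nonzero constant \<open>c\<close>, which gives a
        Bezout identity; multiplied by \<open>b\<close>, both of its terms are divisible by
        \<open>p\<close>.\<close>
      have "Polynomial.degree d = 0" using unit_deg[OF 2] deg12 sp(8)
        by (auto simp: s2_def[symmetric] degree_mult_eq_0)
      then obtain c where c: "d = [:c:]" by (rule degree_eq_zeroE)
      then have cA: "c \<in> A" "c \<noteq> 0" using dB d(2) by (auto dest: const_in_polys_overD)
      obtain x y where xy: "x \<in> ?B" "y \<in> ?B" "d = x * p + y * a" using d(1) by (auto simp: I_def)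
      have "[:c:] * b = p * (x * b) + y * (a * b)" by (simp only: c[symmetric] xy) (simp add: algebra_simps)
      moreover have "dvd_in ?B p (p * (x * b))" "dvd_in ?B p (y * (a * b))"
        using xy b ab by (auto intro!: dvd_inI[OF _ refl] dvd_in_mult2[OF B] is_subringD(4)[OF B])
      ultimately have "dvd_in ?B p ([:c:] * b)" using dvd_in_add[OF B] by metis
      then show ?thesis using cancel[OF cA b] by simp
    qed
  qed
  moreover have "\<not> unit_in ?B p" using unit_deg deg by auto
  ultimately show ?thesis using p deg unfolding prime_in_def by auto
qed

text \<open>The induction runs on the degree plus the number of primes in the leading coefficient.
  Both contributions are additive on products, and irreducible elements of positive degree are
  prime, so splitting into nonunits ends with primes.\<close>

theorem factorial_in_polys_over:
  fixes A :: "'a::idom set"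
  assumes fA: "factorial_in A"
  shows "factorial_in (polys_over A)"
proof -
  let ?B = "polys_over A"
  have A: "is_subring A" using fA by (simp add: factorial_in_def)
  note B = is_subring_polys_over[OF A]
  have "\<exists>u ps. unit_in ?B u \<and> (\<forall>p\<in>set ps. prime_in ?B p) \<and> f = u * prod_list ps"
    if "f \<in> ?B" "f \<noteq> 0" "unit_in A v" "\<forall>q\<in>set qs. prime_in A q" "lead_coeff f = v * prod_list qs" for f v qs
    using that
  proof (induction "Polynomial.degree f + length qs" arbitrary: f v qs rule: less_induct)
    case less
    show ?case
    proof (cases "Polynomial.degree f = 0")
      case True
      then obtain c where c: "f = [:c:]" by (rule degree_eq_zeroE)
      then have "c \<in> A" "c \<noteq> 0" using less.prems by (auto dest: const_in_polys_overD)
      then show ?thesis using const_prime_factors[OF fA] c by metis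
    next
      case False
      show ?thesis
      proof (cases "\<exists>g\<in>?B. \<exists>h\<in>?B. f = g * h \<and> \<not> unit_in ?B g \<and> \<not> unit_in ?B h")
        case nonirr: False
        then have "prime_in ?B f"
          using False less.prems(1) by (intro irreducible_prime_in_polys_over[OF fA]) auto
        then show ?thesis using unit_in_one[OF B] by (intro exI[of _ 1] exI[of _ "[f]"]) auto
      next
        case True
        then obtain g h where gh: "g \<in> ?B" "h \<in> ?B" "f = g * h" "\<not> unit_in ?B g" "\<not> unit_in ?B h" by blast
        have nz: "g \<noteq> 0" "h \<noteq> 0" using gh less.prems(2) by auto
        have "v * prod_list qs * 1 = lead_coeff g * lead_coeff h"
          using less.prems(5) gh(3) by (simp add: lead_coeff_mult)
        then obtain u1 ps1 f' u2 ps2 g' where sp: "unit_in A u1" "unit_in A u2" "set ps1 \<union> set ps2 \<subseteq> set qs"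
            "length ps1 + length ps2 = length qs" "f' \<in> A" "g' \<in> A" "1 = f' * g'"
            "lead_coeff g = u1 * prod_list ps1 * f'" "lead_coeff h = u2 * prod_list ps2 * g'"
          using prime_factors_split[OF A less.prems(3,4) is_subringD(1)[OF A]
              lead_coeff_in[OF gh(1)] lead_coeff_in[OF gh(2)]] by metis
        have "unit_in A f'"
          unfolding unit_in_def using sp(5,6,7) by (auto intro: dvd_inI)
        moreover have "unit_in A g'"
          unfolding unit_in_def using sp(5,6,7) by (auto intro: dvd_inI simp: mult.commute)
        ultimately have units: "unit_in A (u1 * f')" "unit_in A (u2 * g')"
          using sp(1,2) unit_in_mult[OF A] by blast+
        have lc: "lead_coeff g = (u1 * f') * prod_list ps1" "lead_coeff h = (u2 * g') * prod_list ps2"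
          using sp(8,9) by (simp_all add: mult_ac)
        \<comment> \<open>Only units have measure 0, so each of the two nonunit factors has a
          measure strictly below that of \<open>f\<close>.\<close>
        have pos: "Polynomial.degree k + length ps > 0"
          if k: "k \<in> ?B" "\<not> unit_in ?B k" and w: "unit_in A w" "lead_coeff k = w * prod_list ps" for k w ps
        proof (rule ccontr)
          assume "\<not> ?thesis"
          then have *: "Polynomial.degree k = 0" "ps = []" by auto
          then obtain c where "k = [:c:]" using degree_eq_zeroE by blast
          then have "k = [:w:]" using w * by simp
          then show False using const_unit_in_polys_over[OF A w(1)] k by simp
        qed
        have dgh: "Polynomial.degree f = Polynomial.degree g + Polynomial.degree h"
          using nz by (simp add: gh(3) degree_mult_eq)
        have pg: "\<forall>q\<in>set ps1. prime_in A q" and ph: "\<forall>q\<in>set ps2. prime_in A q"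
          using sp(3) less.prems(4) by auto
        obtain u ps where ups: "unit_in ?B u" "\<forall>p\<in>set ps. prime_in ?B p" "g = u * prod_list ps"
          using less.hyps[OF _ gh(1) nz(1) units(1) pg lc(1)] pos[OF gh(2,5) units(2) lc(2)] dgh sp(4) by auto
        obtain u' ps' where ups': "unit_in ?B u'" "\<forall>p\<in>set ps'. prime_in ?B p" "h = u' * prod_list ps'"
          using less.hyps[OF _ gh(2) nz(2) units(2) ph lc(2)] pos[OF gh(1,4) units(1) lc(1)] dgh sp(4) by auto
        show ?thesis using ups ups' unit_in_mult[OF B]
          by (intro exI[of _ "u * u'"] exI[of _ "ps @ ps'"]) (auto simp: gh(3) mult_ac)
      qed
    qed
  qed
  note factors = this
  have "\<exists>u ps. unit_in ?B u \<and> (\<forall>p\<in>set ps. prime_in ?B p) \<and> f = u * prod_list ps"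
    if f: "f \<in> ?B" "f \<noteq> 0" for f
  proof -
    have "lead_coeff f \<in> A" "lead_coeff f \<noteq> 0" using f lead_coeff_in by auto
    then obtain v qs where "unit_in A v" "\<forall>q\<in>set qs. prime_in A q" "lead_coeff f = v * prod_list qs"
      using fA unfolding factorial_in_def by blast
    then show ?thesis by (rule factors[OF f])
  qed
  then show ?thesis using B by (auto simp: factorial_in_def)
qed

section \<open>Laurent polynomials\<close>

lemma factorial_in_int: "factorial_in (UNIV :: int set)"
proof -
  have dvd: "dvd_in UNIV a b \<longleftrightarrow> a dvd b" for a b :: int
    by (auto simp: dvd_in_def dvd_def)
  have prime: "prime_in UNIV p" if "Factorial_Ring.prime p" for p :: int
    using that prime_dvd_mult_iff[OF that] not_prime_unit[of p] by (auto simp: prime_in_def unit_in_def dvd)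
  have "\<exists>u ps. unit_in UNIV u \<and> (\<forall>p\<in>set ps. prime_in UNIV p) \<and> a = u * prod_list ps"
    if "a \<noteq> 0" for a :: int
  proof -
    obtain ps where ps: "mset ps = prime_factorization a" using ex_mset by blast
    have "a = unit_factor a * normalize a" by (rule unit_factor_mult_normalize[symmetric])
    also have "normalize a = prod_list ps"
      using prod_mset_prime_factorization[OF that] ps by (simp flip: prod_mset_prod_list)
    finally have "a = unit_factor a * prod_list ps" .
    moreover have "\<forall>p\<in>set ps. prime_in UNIV p"
      using ps prime by (metis in_prime_factors_imp_prime set_mset_mset)
    moreover have "unit_in UNIV (unit_factor a)"
      using that by (simp add: unit_in_def dvd)
    ultimately show ?thesis by blast
  qed
  then show ?thesis by (auto simp: factorial_in_def is_subring_def)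
qed

lemma lookup_mult_single:
  fixes f :: "'a::ab_group_add \<Rightarrow>\<^sub>0 'b::semiring_0"
  shows "lookup (f * single a c) e = lookup f (e - a) * c"
proof -
  have eq: "e = l + a \<longleftrightarrow> l = e - a" for l by auto
  have "lookup (f * single a c) e =
      (\<Sum>l. lookup f l * (\<Sum>q. ((c when a = q) when e = l + q)))"
    by (simp add: lookup_mult lookup_single)
  also have "(\<lambda>l. \<Sum>q. ((c when a = q) when e = l + q)) = (\<lambda>l. c when e = l + a)"
  proof
    fix l
    have "(\<lambda>q. ((c when a = q) when e = l + q)) = (\<lambda>q. (c when e = l + q) when a = q)"
      by (auto simp: when_def)
    then show "(\<Sum>q. ((c when a = q) when e = l + q)) = (c when e = l + a)"
      by (simp only: Sum_any_when_equal')
  qed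
  also have "(\<Sum>l. lookup f l * (c when e = l + a)) =
      (\<Sum>l. (lookup f l * c) when l = e - a)"
    by (simp add: eq mult_when)
  finally show ?thesis by simp
qed

lemma poly_mapping_sum_single:
  "p = (\<Sum>e\<in>keys p. single e (lookup p e))"
  by (intro poly_mapping_eqI)
     (auto simp: lookup_sum lookup_single when_def in_keys_iff sum.delta')

lemma keys_subset_iff: "keys e \<subseteq> S \<longleftrightarrow> (\<forall>i. i \<notin> S \<longrightarrow> lookup e i = 0)"
  by (auto simp: in_keys_iff)

lemma laurent_polys_iff:
  "p \<in> laurent_polys A B \<longleftrightarrow> (\<forall>e. lookup p e \<noteq> 0 \<longrightarrow>
     (\<forall>i. i \<notin> A \<union> B \<longrightarrow> lookup e i = 0) \<and> (\<forall>i\<in>A. 0 \<le> lookup e i))"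
  by (simp add: laurent_polys_def keys_subset_iff in_keys_iff Ball_def)

lemma is_subring_laurent_polys: "is_subring (laurent_polys A B :: int lpoly set)"
proof -
  have "f * g \<in> laurent_polys A B" if fg: "f \<in> laurent_polys A B" "g \<in> laurent_polys A B" for f g :: "int lpoly"
    unfolding laurent_polys_iff
  proof (intro allI impI)
    fix e assume "lookup (f * g) e \<noteq> 0"
    then have "e \<in> keys (f * g)" by (simp add: in_keys_iff)
    then obtain a b where "a \<in> keys f" "b \<in> keys g" "e = a + b"
      using keys_mult by blast
    then show "(\<forall>i. i \<notin> A \<union> B \<longrightarrow> lookup e i = 0) \<and> (\<forall>i\<in>A. 0 \<le> lookup e i)"
      using fg by (auto simp: laurent_polys_iff in_keys_iff lookup_add)
  qed
  moreover have "f + g \<in> laurent_polys A B" if "f \<in> laurent_polys A B" "g \<in> laurent_polys A B" for f g :: "int lpoly"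
    unfolding laurent_polys_def
  proof (intro CollectI ballI)
    fix e assume "e \<in> keys (f + g)"
    then have "e \<in> keys f \<or> e \<in> keys g" using keys_add[of f g] by blast
    then show "keys e \<subseteq> A \<union> B \<and> (\<forall>i\<in>A. 0 \<le> lookup e i)"
      using that by (auto simp: laurent_polys_def)
  qed
  moreover have "1 \<in> (laurent_polys A B :: int lpoly set)"
    by (auto simp: laurent_polys_iff lookup_one when_def split: if_splits)
  moreover have "- f \<in> laurent_polys A B" if "f \<in> laurent_polys A B" for f :: "int lpoly"
    using that by (simp add: laurent_polys_iff)
  ultimately show ?thesis unfolding is_subring_def by blast
qed

lemma single_in_laurent_polys:
  "(\<forall>i. i \<notin> A \<union> B \<longrightarrow> lookup e i = 0) \<Longrightarrow> (\<forall>i\<in>A. 0 \<le> lookup e i) \<Longrightarrow>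
    single e c \<in> laurent_polys A B"
  by (auto simp: laurent_polys_iff lookup_single when_def)

lemma lookup_sum_single:
  "finite S \<Longrightarrow> lookup (\<Sum>i\<in>S. single i (v i)) j = (if j \<in> S then v j else 0)"
  by (auto simp: lookup_sum lookup_single when_def sum.delta')

lemma lvar_power:
  "(lvar i :: int lpoly) ^ k = single (single i (int k)) 1"
  by (induction k) (auto simp: lvar_def mult_single single_add[symmetric])

text \<open>Polynomials in \<open>Suc k\<close> variables are univariate polynomials over those in
  \<open>k\<close> variables: the isomorphism \<open>h\<close> evaluates a univariate polynomial at
  the last variable \<open>T\<close>, and the theorem on univariate polynomials is carried across
  it.\<close>

lemma factorial_in_polys: "factorial_in (laurent_polys {1..k} {} :: int lpoly set)"
proof (induction k)
  case 0
  have "laurent_polys {1..0} {} = range (single 0 :: int \<Rightarrow> int lpoly)"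
  proof (intro equalityI subsetI)
    fix p :: "int lpoly" assume p: "p \<in> laurent_polys {1..0} {}"
    then have "e = 0" if "lookup p e \<noteq> 0" for e
      using that by (intro poly_mapping_eqI) (auto simp: laurent_polys_iff)
    then have "p = single 0 (lookup p 0)"
      by (intro poly_mapping_eqI) (metis lookup_single_eq lookup_single_not_eq)
    then show "p \<in> range (single 0)" by blast
  qed (auto simp: single_in_laurent_polys)
  moreover have "factorial_in (range (single 0 :: int \<Rightarrow> int lpoly))"
    by (rule factorial_in_image[OF factorial_in_int])
       (auto simp: mult_single single_add intro: inj_onI dest: arg_cong[where f = "\<lambda>p. lookup p 0"])
  ultimately show ?case by simp
next
  case (Suc k)
  let ?A = "laurent_polys {1..k} {} :: int lpoly set"
  let ?A' = "laurent_polys {1..Suc k} {} :: int lpoly set"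
  define T where "T = (lvar (Suc k) :: int lpoly)"
  define h where "h = (\<lambda>f. poly f T)"
  have h_eq: "h f = (\<Sum>i\<le>Polynomial.degree f. poly.coeff f i * single (single (Suc k) (int i)) 1)" for f
    by (simp add: h_def poly_altdef T_def lvar_power)
  \<comment> \<open>The coefficients of \<open>f\<close> are free of the last variable, so different
    powers of \<open>T\<close> contribute different exponents; this makes \<open>h\<close>
    injective.\<close>
  have look: "lookup (h f) (e + single (Suc k) (int j)) = lookup (poly.coeff f j) e"
    if f: "f \<in> polys_over ?A" and e: "lookup e (Suc k) = 0" for f e j
  proof -
    have *: "lookup (poly.coeff f i) (e + single (Suc k) (int j) - single (Suc k) (int i))
        = (if i = j then lookup (poly.coeff f j) e else 0)" for i
    proof (cases "i = j")
      case False
      have "poly.coeff f i \<in> ?A" using f by (simp add: polys_over_def)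
      then have "lookup (poly.coeff f i) d = 0" if "lookup d (Suc k) \<noteq> 0" for d
        using that unfolding laurent_polys_iff by (metis Un_empty_right atLeastAtMost_iff not_less_eq_eq order_refl)
      then show ?thesis using False e by (auto simp: lookup_add lookup_minus)
    qed auto
    show ?thesis
      by (auto simp: h_eq lookup_sum lookup_mult_single * sum.delta' coeff_eq_0)
  qed
  have hadd: "h (f + g) = h f + h g" and hmult: "h (f * g) = h f * h g" for f g by (auto simp: h_def)
  have A: "is_subring ?A" and A': "is_subring ?A'" by (rule is_subring_laurent_polys)+
  note B = is_subring_polys_over[OF A]
  have inj: "inj_on h (polys_over ?A)"
  proof (intro inj_onI poly_eqI poly_mapping_eqI)
    fix f g j e assume fg: "f \<in> polys_over ?A" "g \<in> polys_over ?A" "h f = h g"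
    show "lookup (poly.coeff f j) e = lookup (poly.coeff g j) e"
    proof (cases "lookup e (Suc k) = 0")
      case True
      then show ?thesis using look[of f e j] look[of g e j] fg by simp
    next
      case False
      have "lookup p e = 0" if "p \<in> ?A" for p
        using that False unfolding laurent_polys_iff by (metis Un_empty_right atLeastAtMost_iff not_less_eq_eq order_refl)
      then show ?thesis using fg by (simp add: polys_over_def)
    qed
  qed
  have "h ` polys_over ?A = ?A'"
  proof (intro equalityI subsetI)
    fix p assume "p \<in> h ` polys_over ?A"
    then obtain f where f: "f \<in> polys_over ?A" "p = h f" by auto
    have "?A \<subseteq> ?A'"
    proof
      fix p assume p: "p \<in> ?A"
      have "0 \<le> lookup e i" if "lookup p e \<noteq> 0" for e i
        using p that by (cases "i \<in> {1..k}") (auto simp: laurent_polys_iff)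
      then show "p \<in> ?A'" using p by (auto simp: laurent_polys_iff)
    qed
    then have "poly.coeff f i \<in> ?A'" for i using f by (auto simp: polys_over_def)
    then show "p \<in> ?A'" unfolding f h_eq
      by (intro is_subring_sum[OF A'] is_subringD(4)[OF A'] single_in_laurent_polys)
         (auto simp: lookup_single when_def)
  next
    fix p assume p: "p \<in> ?A'"
    define e' where "e' = (\<lambda>e::nat \<Rightarrow>\<^sub>0 int. e - single (Suc k) (lookup e (Suc k)))"
    define q where "q = (\<lambda>e. Polynomial.monom (single (e' e) (lookup p e)) (nat (lookup e (Suc k))))"
    have pe: "i \<notin> {1..Suc k} \<Longrightarrow> lookup e i = 0" "i \<in> {1..Suc k} \<Longrightarrow> 0 \<le> lookup e i"
      if "e \<in> keys p" for e i
      using p that by (auto simp: laurent_polys_iff in_keys_iff)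
    have "q e \<in> polys_over ?A" if e: "e \<in> keys p" for e
      unfolding q_def using pe[OF e]
      by (intro monom_in_polys_over[OF A] single_in_laurent_polys)
         (auto simp: e'_def lookup_minus lookup_single when_def le_Suc_eq)
    then have "sum q (keys p) \<in> polys_over ?A" by (intro is_subring_sum[OF B])
    moreover have "h (q e) = single e (lookup p e)" if e: "e \<in> keys p" for e
      using pe(2)[OF e, of "Suc k"]
      by (simp add: h_def q_def poly_monom T_def lvar_power mult_single e'_def)
    then have "h (sum q (keys p)) = p"
      using poly_mapping_sum_single[of p] by (simp add: h_def poly_sum)
    ultimately show "p \<in> h ` polys_over ?A" by (metis image_eqI)
  qed
  moreover have "factorial_in (h ` polys_over ?A)"
    by (rule factorial_in_image[OF factorial_in_polys_over[OF Suc.IH] inj _ hadd hmult]) (simp add: h_def)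
  ultimately show ?case by simp
qed

section \<open>Minimal weights of Laurent polynomials\<close>

definition lp_part :: "((nat \<Rightarrow>\<^sub>0 int) \<Rightarrow> bool) \<Rightarrow> 'c::comm_monoid_add lpoly \<Rightarrow> 'c lpoly" where
  "lp_part Q f = (\<Sum>e\<in>{e \<in> keys f. Q e}. single e (lookup f e))"

lemma lookup_lp_part: "lookup (lp_part Q f) e = (if Q e then lookup f e else 0)"
  by (auto simp: lp_part_def lookup_sum lookup_single when_def sum.delta' in_keys_iff)

lemma keys_lp_part: "keys (lp_part Q f) = {e \<in> keys f. Q e}"
  by (auto simp: in_keys_iff lookup_lp_part split: if_splits)

text \<open>For additive \<open>w\<close> this is the monomial valuation with weights
  \<open>w\<close>. At the zero polynomial it is the unspecified minimum of the empty set, whence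
  the nonzero hypotheses below.\<close>

definition trop :: "((nat \<Rightarrow>\<^sub>0 int) \<Rightarrow> int) \<Rightarrow> 'c::zero lpoly \<Rightarrow> int" where
  "trop w f = Min (w ` keys f)"

lemma trop_le: "e \<in> keys f \<Longrightarrow> trop w f \<le> w e"
  by (simp add: trop_def)

lemma trop_attained: "f \<noteq> 0 \<Longrightarrow> \<exists>e\<in>keys f. w e = trop w f"
  unfolding trop_def using Min_in[of "w ` keys f"] by fastforce

lemma trop_eqI:
  "e \<in> keys f \<Longrightarrow> w e = k \<Longrightarrow> (\<And>e. e \<in> keys f \<Longrightarrow> k \<le> w e) \<Longrightarrow> trop w f = k"
  unfolding trop_def by (intro Min_eqI) auto

lemma trop_single: "c \<noteq> 0 \<Longrightarrow> trop w (single e c) = w e"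
  by (simp add: trop_def)

text \<open>The weight \<open>w\<close> may take equal values at different exponents, so the terms
  of minimal weight form initial parts \<open>f0\<close> and \<open>g0\<close> with possibly many
  terms. Their product is nonzero in a domain, and all terms of the rest \<open>r\<close> have
  larger weight, so nothing cancels it.\<close>

lemma trop_mult:
  fixes f g :: "'c::idom lpoly"
  assumes w: "\<And>a b. w (a + b) = w a + w b" and f: "f \<noteq> 0" and g: "g \<noteq> 0"
  shows "trop w (f * g) = trop w f + trop w g"
proof -
  define f0 g0 where "f0 = lp_part (\<lambda>e. w e = trop w f) f" and "g0 = lp_part (\<lambda>e. w e = trop w g) g"
  have keys0: "w e = trop w f" if "e \<in> keys f0" for e
    using that by (auto simp: f0_def in_keys_iff lookup_lp_part split: if_splits)
  have keys0': "w e = trop w g" if "e \<in> keys g0" for e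
    using that by (auto simp: g0_def in_keys_iff lookup_lp_part split: if_splits)
  have keys1: "w e > trop w f" if "e \<in> keys (f - f0)" for e
    using that trop_le[of e f w] by (auto simp: f0_def in_keys_iff lookup_lp_part lookup_minus split: if_splits)
  have keys1': "w e > trop w g" if "e \<in> keys (g - g0)" for e
    using that trop_le[of e g w] by (auto simp: g0_def in_keys_iff lookup_lp_part lookup_minus split: if_splits)
  have nz: "lp_part (\<lambda>e. w e = trop w h) h \<noteq> 0" if h: "h \<noteq> 0" for h :: "'c lpoly"
  proof -
    obtain e where "e \<in> keys h" "w e = trop w h" using trop_attained[OF h, of w] by blast
    then show ?thesis using keys_lp_part[of "\<lambda>e. w e = trop w h" h] by auto
  qed
  have "f0 \<noteq> 0" "g0 \<noteq> 0" using nz[OF f] nz[OF g] by (simp_all add: f0_def g0_def)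
  then have "f0 * g0 \<noteq> 0" by simp
  then obtain e where e: "e \<in> keys (f0 * g0)" by (metis keys_eq_empty all_not_in_conv)
  obtain a b where "a \<in> keys f0" "b \<in> keys g0" "e = a + b"
    using e keys_mult by blast
  then have we: "w e = trop w f + trop w g" using keys0 keys0' w by simp
  define r where "r = (f - f0) * g + f0 * (g - g0)"
  have wr: "w d > trop w f + trop w g" if d: "d \<in> keys r" for d
  proof -
    have "d \<in> keys ((f - f0) * g) \<or> d \<in> keys (f0 * (g - g0))"
      using subsetD[OF keys_add d[unfolded r_def]] by simp
    then show ?thesis
    proof
      assume "d \<in> keys ((f - f0) * g)"
      then obtain a b where "a \<in> keys (f - f0)" "b \<in> keys g" "d = a + b"
        using keys_mult by blast
      then show ?thesis using keys1[of a] trop_le[of b g w] w by simp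
    next
      assume "d \<in> keys (f0 * (g - g0))"
      then obtain a b where "a \<in> keys f0" "b \<in> keys (g - g0)" "d = a + b"
        using keys_mult by blast
      then show ?thesis using keys0[of a] keys1'[of b] w by simp
    qed
  qed
  have fg: "f * g = f0 * g0 + r" by (simp add: r_def algebra_simps)
  have "e \<notin> keys r" using wr[of e] we by auto
  then have ek: "e \<in> keys (f * g)" using e by (simp add: fg in_keys_iff lookup_add)
  show ?thesis
  proof (rule trop_eqI[where w = w, OF ek we])
    fix d assume "d \<in> keys (f * g)"
    then obtain a b where "a \<in> keys f" "b \<in> keys g" "d = a + b"
      using keys_mult by blast
    then show "trop w f + trop w g \<le> w d" using trop_le[of a f w] trop_le[of b g w] w by simp
  qed
qed

text \<open>With a coordinate as weight this is the order along the corresponding variable; its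
  additivity turns questions on divisibility by variables into integer arithmetic.\<close>

abbreviation low :: "nat \<Rightarrow> 'c::zero lpoly \<Rightarrow> int" where
  "low i \<equiv> trop (\<lambda>e. lookup e i)"

lemma low_mult: "f \<noteq> 0 \<Longrightarrow> g \<noteq> 0 \<Longrightarrow> low i (f * g) = low i f + low i (g :: 'c::idom lpoly)"
  by (rule trop_mult) (auto simp: lookup_add)

lemma unit_in_single:
  assumes "\<And>i. i \<notin> S \<Longrightarrow> lookup e i = 0"
  shows "unit_in (laurent_polys {} S) (single e 1 :: int lpoly)"
  unfolding unit_in_def using assms
  by (auto intro!: single_in_laurent_polys dvd_inI[of "single (- e) 1"] simp: mult_single)

lemma clear_denominators:
  fixes a :: "int lpoly"
  assumes a: "a \<in> laurent_polys {} {1..m}"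
  obtains d where "\<And>i. i \<notin> {1..m} \<Longrightarrow> lookup d i = 0"
    "single d 1 \<in> (laurent_polys {1..m} {} :: int lpoly set)"
    "single d 1 * a \<in> laurent_polys {1..m} {}"
proof
  define d where "d = (\<Sum>i\<in>{1..m}. single i (max 0 (- low i a)))"
  have d: "lookup d i = (if i \<in> {1..m} then max 0 (- low i a) else 0)" for i
    by (simp add: d_def lookup_sum_single del: atLeastAtMost_iff)
  show "\<And>i. i \<notin> {1..m} \<Longrightarrow> lookup d i = 0" unfolding d by (rule if_not_P)
  show "single d 1 \<in> (laurent_polys {1..m} {} :: int lpoly set)"
    using d by (auto intro!: single_in_laurent_polys split: if_splits)
  show "single d 1 * a \<in> laurent_polys {1..m} {}"
    unfolding laurent_polys_iff
  proof (intro allI impI)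
    fix e assume "lookup (single d 1 * a) e \<noteq> 0"
    then have k: "e - d \<in> keys a"
      by (subst (asm) mult.commute) (simp add: lookup_mult_single in_keys_iff)
    have "lookup e i = 0" if "i \<notin> {1..m}" for i
      using a k that d[of i] by (auto simp: laurent_polys_iff in_keys_iff lookup_minus)
    moreover have "0 \<le> lookup e i" if "i \<in> {1..m}" for i
      using trop_le[OF k, of "\<lambda>e. lookup e i"] d[of i] that by (simp add: lookup_minus del: atLeastAtMost_iff)
    ultimately show "(\<forall>i. i \<notin> {1..m} \<union> {} \<longrightarrow> lookup e i = 0) \<and> (\<forall>i\<in>{1..m}. 0 \<le> lookup e i)"
      by simp
  qed
qed

text \<open>The Laurent ring is the localization of the polynomial ring at the monomials.\<close>

theorem factorial_in_laurent_polys: "factorial_in (laurent_polys {} {1..m} :: int lpoly set)"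
proof (rule factorial_in_localization[OF factorial_in_polys[of m] is_subring_laurent_polys])
  show "laurent_polys {1..m} {} \<subseteq> (laurent_polys {} {1..m} :: int lpoly set)"
    by (auto simp: laurent_polys_def)
next
  fix a :: "int lpoly" assume "a \<in> laurent_polys {} {1..m}"
  then show "\<exists>s\<in>laurent_polys {1..m} {}. unit_in (laurent_polys {} {1..m}) s \<and> s * a \<in> laurent_polys {1..m} {}"
    using clear_denominators[of a m] unit_in_single[of "{1..m}"] by metis
qed

section \<open>Exchange polynomials are prime\<close>

lemma mem_exchange_ring: "p \<in> carrier (exchange_ring n m) \<longleftrightarrow> p \<in> laurent_polys {1..n} {n+1..m}"
  by (simp add: exchange_ring_def)

lemma divides_exchange_ring:
  "a divides\<^bsub>exchange_ring n m\<^esub> b \<longleftrightarrow> dvd_in (laurent_polys {1..n} {n+1..m}) a b"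
  by (simp add: factor_def dvd_in_def exchange_ring_def ring_of_type_algebra_def)

lemma divides_laurent_subring:
  "a divides\<^bsub>laurent_subring x S\<^esub> b \<longleftrightarrow> dvd_in (ev x ` laurent_polys {} S) a b"
  unfolding factor_def dvd_in_def laurent_subring_def ring_of_type_algebra_def by simp

lemma exchange_irreducibleD:
  assumes irr: "ring_irreducible\<^bsub>exchange_ring n m\<^esub> p" and p: "p \<in> laurent_polys {1..n} {n+1..m}"
  shows "p \<noteq> 0" "\<not> unit_in (laurent_polys {1..n} {n+1..m}) p"
    "\<And>f g. f \<in> laurent_polys {1..n} {n+1..m} \<Longrightarrow> g \<in> laurent_polys {1..n} {n+1..m} \<Longrightarrow> p = f * g \<Longrightarrow>
      unit_in (laurent_polys {1..n} {n+1..m}) f \<or> unit_in (laurent_polys {1..n} {n+1..m}) g"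
proof -
  let ?R = "laurent_polys {1..n} {n+1..m} :: int lpoly set"
  have units: "a \<in> Units (exchange_ring n m) \<longleftrightarrow> unit_in ?R a" for a
    unfolding Units_def unit_in_def dvd_in_def exchange_ring_def ring_of_type_algebra_def
    by (auto simp: mult.commute intro: sym)
  show p0: "p \<noteq> 0"
    using irr by (simp add: ring_irreducible_def exchange_ring_def ring_of_type_algebra_def)
  show "\<not> unit_in ?R p"
    using irr units[of p] by (simp add: ring_irreducible_def Divisibility.irreducible_def)
  show "unit_in ?R f \<or> unit_in ?R g" if fg: "f \<in> ?R" "g \<in> ?R" "p = f * g" for f g
  proof (cases "dvd_in ?R p f")
    case True
    then obtain c where c: "c \<in> ?R" "f = p * c" by (auto simp: dvd_in_def)
    have "f * (g * c) = f * 1" using c(2) fg(3) by (simp add: mult_ac)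
    then have "g * c = 1" using fg(3) p0 by (simp only: mult_left_cancel) auto
    then have "unit_in ?R g" unfolding unit_in_def using fg(2) c(1) by (auto intro: dvd_inI)
    then show ?thesis ..
  next
    case False
    then have "properfactor (exchange_ring n m) f p"
      using fg by (auto simp: properfactor_def divides_exchange_ring intro: dvd_inI)
    then show ?thesis
      using irr fg by (auto simp: ring_irreducible_def Divisibility.irreducible_def units mem_exchange_ring)
  qed
qed

lemma low_nonneg: "f \<in> laurent_polys A B \<Longrightarrow> f \<noteq> 0 \<Longrightarrow> j \<in> A \<Longrightarrow> 0 \<le> low j f"
  using trop_attained[of f "\<lambda>e. lookup e j"]
  unfolding laurent_polys_def by (metis (mono_tags, lifting) mem_Collect_eq)

lemma in_exchange_polys_iff:
  fixes n m :: nat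
  assumes "n \<le> m" "f \<noteq> 0"
  shows "f \<in> laurent_polys {1..n} {n+1..m} \<longleftrightarrow> f \<in> laurent_polys {} {1..m} \<and> (\<forall>j\<in>{1..n}. 0 \<le> low j f)"
proof -
  have "{1..n} \<union> {n+1..m} = {} \<union> {1..m}" using assms by auto
  moreover have "0 \<le> low j f \<longleftrightarrow> (\<forall>e. lookup f e \<noteq> 0 \<longrightarrow> 0 \<le> lookup e j)" for j
    using trop_le[of _ f "\<lambda>e. lookup e j"] trop_attained[OF assms(2), of "\<lambda>e. lookup e j"]
    unfolding in_keys_iff by fastforce
  ultimately show ?thesis unfolding laurent_polys_iff by auto
qed

text \<open>Membership in the exchange ring means that all orders along unfrozen variables are
  nonnegative, so a variable of positive order could be divided out inside that ring.\<close>

lemma low_eq_0: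
  fixes n m :: nat
  assumes nm: "n \<le> m" and f: "f \<in> laurent_polys {1..n} {n+1..m}" "f \<noteq> 0" and j: "j \<in> {1..n}"
    and nd: "\<not> dvd_in (laurent_polys {1..n} {n+1..m}) (lvar j) f"
  shows "low j (f :: int lpoly) = 0"
proof (rule ccontr)
  assume "low j f \<noteq> 0"
  then have pos: "low j f \<ge> 1" using low_nonneg[OF f j] by simp
  define g where "g = f * single (single j (- 1)) 1"
  have fg: "f = lvar j * g"
    by (simp add: g_def lvar_def mult.left_commute[of _ f] mult_single flip: single_add)
  then have g0: "g \<noteq> 0" using f by auto
  have "g \<in> laurent_polys {} {1..m}"
    unfolding g_def using f nm j unfolding in_exchange_polys_iff[OF nm f(2)]
    by (auto intro!: is_subringD[OF is_subring_laurent_polys] single_in_laurent_polys simp: lookup_single when_def)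
  moreover have "0 \<le> low i g" if "i \<in> {1..n}" for i
  proof -
    have "low i f = low i (lvar j :: int lpoly) + low i g"
      unfolding fg using g0 by (intro low_mult) (auto simp: lvar_def single_zero)
    also have "low i (lvar j :: int lpoly) = (if i = j then 1 else 0)"
      by (simp add: lvar_def trop_single lookup_single when_def)
    finally show ?thesis using pos low_nonneg[OF f that] by (auto split: if_splits)
  qed
  ultimately have "g \<in> laurent_polys {1..n} {n+1..m}"
    using in_exchange_polys_iff[OF nm g0] by blast
  then show False using nd fg by (auto intro: dvd_inI)
qed

text \<open>A factorization in the Laurent ring can be normalized by monomials until both factors
  have order 0 along every unfrozen variable. As \<open>p\<close> has order 0 as well, the
  normalizing monomials cancel and the factorization takes place in the exchange ring. So
  \<open>p\<close> is irreducible in a factorial ring.\<close>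

theorem exchange_poly_prime:
  fixes n m :: nat and p :: "int lpoly"
  assumes nm: "n \<le> m" and pR: "p \<in> laurent_polys {1..n} {n+1..m}"
    and irr: "ring_irreducible\<^bsub>exchange_ring n m\<^esub> p"
    and nd: "\<And>j. j \<in> {1..n} \<Longrightarrow> \<not> dvd_in (laurent_polys {1..n} {n+1..m}) (lvar j) p"
  shows "prime_in (laurent_polys {} {1..m}) p"
proof -
  let ?R = "laurent_polys {1..n} {n+1..m} :: int lpoly set"
  let ?L = "laurent_polys {} {1..m} :: int lpoly set"
  note irrD = exchange_irreducibleD[OF irr pR]
  have L: "is_subring ?L" and R: "is_subring ?R" by (rule is_subring_laurent_polys)+
  have RL: "?R \<subseteq> ?L"
  proof
    fix f assume "f \<in> ?R"
    then show "f \<in> ?L"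
      using in_exchange_polys_iff[OF nm, of f] is_subring_zero[OF L] by (cases "f = 0") simp_all
  qed
  have lowp: "low j p = 0" if "j \<in> {1..n}" for j
    by (rule low_eq_0[OF nm pR irrD(1) that nd[OF that]])
  have normal: "\<exists>d. (\<forall>i. i \<notin> {1..n} \<longrightarrow> lookup d i = 0) \<and>
      single d 1 * f \<in> ?R \<and> (\<forall>j\<in>{1..n}. low j (single d 1 * f) = 0)"
    if f: "f \<in> ?L" "f \<noteq> 0" for f
  proof -
    define d where "d = (\<Sum>i\<in>{1..n}. single i (- low i f))"
    have d: "lookup d i = (if i \<in> {1..n} then - low i f else 0)" for i
      by (simp add: d_def lookup_sum_single del: atLeastAtMost_iff)
    have s: "single d 1 \<in> ?L"
      using d nm by (auto intro!: single_in_laurent_polys)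
    have low: "low j (single d 1 * f) = 0" if "j \<in> {1..n}" for j
      using low_mult[of "single d 1" f j] f(2) d[of j] that
      by (simp add: trop_single del: atLeastAtMost_iff)
    have "single d 1 * f \<in> ?R"
      using is_subringD(4)[OF L s f(1)] low f(2)
      by (subst in_exchange_polys_iff[OF nm]) auto
    then show ?thesis using low d by (intro exI[of _ d]) auto
  qed
  have "unit_in ?L f \<or> unit_in ?L g" if fg: "f \<in> ?L" "g \<in> ?L" "p = f * g" for f g
  proof -
    have nz: "f \<noteq> 0" "g \<noteq> 0" using fg irrD(1) by auto
    obtain a where a: "\<forall>i. i \<notin> {1..n} \<longrightarrow> lookup a i = 0" "single a 1 * f \<in> ?R"
        "\<forall>j\<in>{1..n}. low j (single a 1 * f) = 0" using normal[OF fg(1) nz(1)] by blast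
    obtain b where b: "\<forall>i. i \<notin> {1..n} \<longrightarrow> lookup b i = 0" "single b 1 * g \<in> ?R"
        "\<forall>j\<in>{1..n}. low j (single b 1 * g) = 0" using normal[OF fg(2) nz(2)] by blast
    have eq: "(single a 1 * f) * (single b 1 * g) = single (a + b) 1 * p"
    proof -
      have "(single a 1 * f) * (single b 1 * g) = (single a 1 * single b 1) * (f * g)"
        by (simp only: mult_ac)
      then show ?thesis by (simp add: mult_single fg(3))
    qed
    \<comment> \<open>Both \<open>p\<close> and the product of the normalized factors have order 0
      along each unfrozen variable, which leaves no room for the monomial with exponent
      \<open>a + b\<close>.\<close>
    have "a + b = 0"
    proof (rule poly_mapping_eqI)
      fix j
      show "lookup (a + b) j = lookup 0 j"
      proof (cases "j \<in> {1..n}")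
        case True
        have "low j (single (a + b) 1 * p) = 0"
          unfolding eq[symmetric] using a b nz True by (subst low_mult) auto
        then show ?thesis using low_mult[of "single (a + b) 1" p j] irrD(1) lowp[OF True]
          by (simp add: trop_single)
      qed (use a b in \<open>simp add: lookup_add\<close>)
    qed
    then have "p = (single a 1 * f) * (single b 1 * g)" using eq by simp
    then have "unit_in ?R (single a 1 * f) \<or> unit_in ?R (single b 1 * g)"
      using irrD(3)[OF a(2) b(2)] by blast
    moreover have "unit_in ?L u" if "unit_in ?R u" for u
      using that RL by (auto simp: unit_in_def dvd_in_def)
    moreover have "single c 1 \<in> ?L" if "\<forall>i. i \<notin> {1..n} \<longrightarrow> lookup c i = 0" for c
      using that nm by (auto intro!: single_in_laurent_polys)
    ultimately show ?thesis
      using unit_in_left[OF L] fg(1,2) a(1) b(1) by (metis mult.commute)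
  qed
  \<comment> \<open>An inverse in the Laurent ring would have the opposite orders, all 0, and hence
    lie in the exchange ring.\<close>
  moreover have "\<not> unit_in ?L p"
  proof
    assume "unit_in ?L p"
    then obtain v where v: "v \<in> ?L" "p * v = 1" by (rule unit_in_inverse)
    have v0: "v \<noteq> 0" using v by auto
    have "low j v = 0" if "j \<in> {1..n}" for j
    proof -
      have "low j (p * v) = 0" unfolding v(2) using trop_single[of 1 _ 0] by (metis lookup_zero one_neq_zero single_one)
      then show ?thesis using low_mult[OF irrD(1) v0, of j] lowp[OF that] by simp
    qed
    then have "v \<in> ?R" using in_exchange_polys_iff[OF nm v0] v by simp
    then show False using irrD(2) pR v by (auto simp: unit_in_def dvd_in_def intro: sym)
  qed
  moreover have "p \<in> ?L" using pR RL by blast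
  ultimately show ?thesis
    using irreducible_prime_in[OF factorial_in_laurent_polys _ irrD(1)] by blast
qed

section \<open>Localization and evaluation in the field\<close>

definition localization :: "'f::field set \<Rightarrow> 'f \<Rightarrow> 'f set" where
  "localization A p = {a / b | a b. a \<in> A \<and> b \<in> A \<and> \<not> dvd_in A p b}"

context
  fixes A :: "'f::field set" and p :: 'f
  assumes A: "is_subring A" and p: "prime_in A p"
begin

lemma not_dvd_nonzero: "\<not> dvd_in A p b \<Longrightarrow> b \<noteq> 0"
  using is_subring_zero[OF A] by (auto simp: dvd_in_def)

lemma not_dvd_mult: "a \<in> A \<Longrightarrow> b \<in> A \<Longrightarrow> \<not> dvd_in A p a \<Longrightarrow> \<not> dvd_in A p b \<Longrightarrow> \<not> dvd_in A p (a * b)"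
  using prime_inD(4)[OF p] by blast

lemma not_dvd_one: "\<not> dvd_in A p 1"
  using prime_inD(1,3)[OF p] by (simp add: unit_in_def)

lemma localizationI: "a \<in> A \<Longrightarrow> b \<in> A \<Longrightarrow> \<not> dvd_in A p b \<Longrightarrow> a / b \<in> localization A p"
  by (auto simp: localization_def)

lemma subset_localization: "A \<subseteq> localization A p"
  using localizationI[OF _ is_subringD(1)[OF A] not_dvd_one] by fastforce

lemma is_subring_localization: "is_subring (localization A p)"
proof -
  have "- (a / b) \<in> localization A p" if "a \<in> A" "b \<in> A" "\<not> dvd_in A p b" for a b
    using localizationI[of "- a" b] is_subringD(2)[OF A] that by simp
  moreover have "a / b + c / d \<in> localization A p" "a / b * (c / d) \<in> localization A p"
    if "a \<in> A" "b \<in> A" "\<not> dvd_in A p b" "c \<in> A" "d \<in> A" "\<not> dvd_in A p d" for a b c d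
    using localizationI[of "a * d + c * b" "b * d"] localizationI[of "a * c" "b * d"]
      not_dvd_mult[of b d] is_subringD(3,4)[OF A] that not_dvd_nonzero
    by (simp_all add: add_frac_eq)
  moreover have "1 \<in> localization A p" using subset_localization is_subringD(1)[OF A] by blast
  moreover have "\<exists>a b. x = a / b \<and> a \<in> A \<and> b \<in> A \<and> \<not> dvd_in A p b" if "x \<in> localization A p" for x
    using that by (auto simp: localization_def)
  ultimately show ?thesis unfolding is_subring_def by metis
qed

lemma unit_in_localizationI: "a \<in> A \<Longrightarrow> \<not> dvd_in A p a \<Longrightarrow> unit_in (localization A p) a"
  using subset_localization localizationI[OF is_subringD(1)[OF A], of a] not_dvd_nonzero[of a]
  by (auto simp: unit_in_def intro!: dvd_inI[of "1 / a"])

lemma unit_in_localizationD: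
  assumes "a \<in> A" "unit_in (localization A p) a"
  shows "\<not> dvd_in A p a"
proof
  assume "dvd_in A p a"
  then obtain c where c: "c \<in> A" "a = p * c" by (auto simp: dvd_in_def)
  obtain v where "v \<in> localization A p" "a * v = 1" using unit_in_inverse[OF assms(2)] by blast
  then obtain s t where st: "s \<in> A" "t \<in> A" "\<not> dvd_in A p t" "a * (s / t) = 1"
    by (auto simp: localization_def)
  then have "t = p * (c * s)" using not_dvd_nonzero[OF st(3)] c by (simp add: field_simps)
  then show False using st c is_subringD(4)[OF A] by (auto intro: dvd_inI)
qed

text \<open>If \<open>y = a / b\<close>, then \<open>p\<close> divides
  \<open>p ^ Suc s * y * b\<close> but not \<open>b\<close>, so it divides
  \<open>p ^ Suc s * y\<close>; the powers of \<open>p\<close> are thus removed one at a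
  time.\<close>

lemma in_ring_if_localization:
  assumes "y \<in> localization A p" "p ^ s * y \<in> A"
  shows "y \<in> A"
proof -
  obtain a b where ab: "a \<in> A" "b \<in> A" "\<not> dvd_in A p b" "y = a / b"
    using assms(1) by (auto simp: localization_def)
  have b0: "b \<noteq> 0" using not_dvd_nonzero ab by blast
  have p0: "p \<noteq> 0" using prime_inD[OF p] by simp
  show ?thesis using assms(2)
  proof (induction s)
    case (Suc s)
    define c where "c = p ^ Suc s * y"
    have c: "c \<in> A" using Suc.prems by (simp add: c_def)
    have "c * b = p * (p ^ s * a)" using b0 by (simp add: c_def ab)
    moreover have "p ^ s * a \<in> A"
      using ab prime_inD(1)[OF p] by (auto intro: is_subringD[OF A] is_subring_power[OF A])
    ultimately have "dvd_in A p (c * b)" by (auto intro: dvd_inI)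
    then have "dvd_in A p c" using prime_inD(4)[OF p c ab(2)] ab(3) by blast
    then obtain d where d: "d \<in> A" "c = p * d" by (auto simp: dvd_in_def)
    then have "d = p ^ s * y" using p0 by (simp add: c_def)
    then show ?case using Suc.IH d by simp
  qed simp
qed

end

lemma unit_in_field:
  fixes A :: "'f::field set"
  shows "unit_in A u \<longleftrightarrow> u \<noteq> 0 \<and> u \<in> A \<and> inverse u \<in> A"
proof
  assume "unit_in A u"
  then obtain v where "v \<in> A" "u * v = 1" by (rule unit_in_inverse)
  moreover from this have "v = inverse u" by (simp add: inverse_unique)
  ultimately show "u \<noteq> 0 \<and> u \<in> A \<and> inverse u \<in> A"
    using \<open>unit_in A u\<close> by (auto simp: unit_in_def)
qed (auto simp: unit_in_def intro!: dvd_inI[of "inverse u"])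

lemma unit_in_field_inverse: "unit_in A (u::'f::field) \<Longrightarrow> unit_in A (inverse u)"
  by (auto simp: unit_in_field)

lemma unit_in_field_divide: "is_subring A \<Longrightarrow> unit_in A u \<Longrightarrow> unit_in A v \<Longrightarrow> unit_in A (u / v :: 'f::field)"
  unfolding divide_inverse by (intro unit_in_mult unit_in_field_inverse)

lemma unit_in_power: "is_subring A \<Longrightarrow> unit_in A u \<Longrightarrow> unit_in A (u ^ k)"
  by (induction k) (auto intro: unit_in_mult unit_in_one)

lemma unit_in_powi: "is_subring A \<Longrightarrow> unit_in A u \<Longrightarrow> unit_in A (u powi k :: 'f::field)"
  by (auto simp: power_int_def intro: unit_in_power unit_in_field_inverse)

lemma unit_in_prod: "is_subring A \<Longrightarrow> (\<And>i. i \<in> I \<Longrightarrow> unit_in A (f i)) \<Longrightarrow> unit_in A (prod f I)"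
  by (induction I rule: infinite_finite_induct) (auto intro: unit_in_mult unit_in_one)


section \<open>Evaluation of Laurent polynomials and the Laurent rings inside the field\<close>

lemma laurent_monomial_superset:
  assumes "finite S" "keys e \<subseteq> S"
  shows "laurent_monomial x e = (\<Prod>i\<in>S. x i powi lookup e i)"
  unfolding laurent_monomial_def
  by (rule prod.mono_neutral_left) (use assms in \<open>auto simp: in_keys_iff\<close>)

lemma laurent_monomial_0 [simp]: "laurent_monomial x 0 = 1"
  by (simp add: laurent_monomial_def)

lemma laurent_monomial_single [simp]: "laurent_monomial x (single i k) = x i powi k"
  by (simp add: laurent_monomial_def)

lemma laurent_monomial_add:
  assumes "\<And>i. i \<in> keys d \<union> keys e \<Longrightarrow> x i \<noteq> 0"
  shows "laurent_monomial x (d + e) = laurent_monomial x d * laurent_monomial x e"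
proof -
  let ?S = "keys d \<union> keys e"
  have "laurent_monomial x (d + e) = (\<Prod>i\<in>?S. x i powi lookup (d + e) i)"
    by (rule laurent_monomial_superset) (use keys_add[of d e] in auto)
  also have "\<dots> = (\<Prod>i\<in>?S. x i powi lookup d i * x i powi lookup e i)"
    using assms by (intro prod.cong) (auto simp: lookup_add power_int_add)
  also have "\<dots> = laurent_monomial x d * laurent_monomial x e"
    by (simp add: prod.distrib laurent_monomial_superset[of ?S])
  finally show ?thesis .
qed

lemma laurent_monomial_nonzero:
  "(\<And>i. i \<in> keys e \<Longrightarrow> x i \<noteq> 0) \<Longrightarrow> laurent_monomial x e \<noteq> 0"
  by (simp add: laurent_monomial_def)

lemma laurent_monomial_uminus: "laurent_monomial x (- e) = inverse (laurent_monomial x e)"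
  by (simp add: laurent_monomial_def power_int_minus prod_inversef[unfolded comp_def])

lemma laurent_monomial_cong:
  "(\<And>i. i \<in> keys e \<Longrightarrow> x i = y i) \<Longrightarrow> laurent_monomial x e = laurent_monomial y e"
  by (simp add: laurent_monomial_def)

text \<open>With \<open>v = x i\<close> this also splits the power of one variable off a
  monomial.\<close>

lemma laurent_monomial_upd:
  "laurent_monomial (x(i := v)) e =
    v powi lookup e i * laurent_monomial x (e - single i (lookup e i))"
proof -
  let ?e = "e - single i (lookup e i)"
  have k: "keys ?e = keys e - {i}"
    by (auto simp: in_keys_iff lookup_minus lookup_single when_def split: if_splits)
  have "laurent_monomial (x(i := v)) e = (\<Prod>j\<in>insert i (keys e). (x(i := v)) j powi lookup e j)"
    by (rule laurent_monomial_superset) auto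
  also have "\<dots> = v powi lookup e i * (\<Prod>j\<in>keys e - {i}. (x(i := v)) j powi lookup e j)"
    by (subst prod.insert_remove) auto
  also have "(\<Prod>j\<in>keys e - {i}. (x(i := v)) j powi lookup e j) = laurent_monomial x ?e"
    unfolding laurent_monomial_def k by (rule prod.cong) (auto simp: lookup_minus lookup_single when_def)
  finally show ?thesis .
qed

lemma lp_eval_superset:
  assumes "\<phi> 0 = 0" "finite E" "keys p \<subseteq> E"
  shows "lp_eval \<phi> x p = (\<Sum>e\<in>E. \<phi> (lookup p e) * laurent_monomial x e)"
  unfolding lp_eval_def
  by (rule sum.mono_neutral_left) (use assms in \<open>auto simp: in_keys_iff\<close>)

lemma ev_0 [simp]: "ev x 0 = 0"
  by (simp add: lp_eval_def)

lemma ev_single [simp]: "ev x (single e c) = of_int c * laurent_monomial x e"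
  by (simp add: lp_eval_def)

lemma ev_1 [simp]: "ev x 1 = 1"
  using ev_single[of x 0 1] by (simp del: ev_single)

lemma ev_add: "ev x (f + g) = ev x f + ev x g"
proof -
  let ?E = "keys f \<union> keys g"
  have *: "ev x h = (\<Sum>e\<in>?E. of_int (lookup h e) * laurent_monomial x e)"
    if "keys h \<subseteq> ?E" for h
    using that by (intro lp_eval_superset) auto
  show ?thesis
    using keys_add[of f g] by (simp add: * lookup_add ring_distribs sum.distrib)
qed

lemma ev_sum: "ev x (sum f I) = (\<Sum>i\<in>I. ev x (f i))"
  by (induction I rule: infinite_finite_induct) (auto simp: ev_add)

lemma ev_uminus: "ev x (- f) = - ev x f"
  using ev_add[of x f "- f"] by (simp add: eq_neg_iff_add_eq_0 add.commute)

text \<open>Nonzero values are essential: \<open>0 powi k\<close> vanishes for negative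
  \<open>k\<close>, so at 0 a variable and its inverse would not multiply to 1.\<close>

lemma ev_mult:
  assumes f: "f \<in> laurent_polys {} S" and g: "g \<in> laurent_polys {} S" and x: "\<And>i. i \<in> S \<Longrightarrow> x i \<noteq> 0"
  shows "ev x (f * g) = ev x f * ev x g"
proof -
  have "f * g = (\<Sum>a\<in>keys f. \<Sum>b\<in>keys g.
      single (a + b) (lookup f a * lookup g b))"
    by (subst poly_mapping_sum_single[of f], subst poly_mapping_sum_single[of g])
       (simp only: sum_product mult_single)
  then have "ev x (f * g) = (\<Sum>a\<in>keys f. \<Sum>b\<in>keys g.
      of_int (lookup f a * lookup g b) * laurent_monomial x (a + b))"
    by (simp add: ev_sum)
  also have "\<dots> = (\<Sum>a\<in>keys f. \<Sum>b\<in>keys g.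
      (of_int (lookup f a) * laurent_monomial x a) * (of_int (lookup g b) * laurent_monomial x b))"
  proof (intro sum.cong refl)
    fix a b assume "a \<in> keys f" "b \<in> keys g"
    then have "keys a \<union> keys b \<subseteq> S" using f g by (auto simp: laurent_polys_def)
    then show "of_int (lookup f a * lookup g b) * laurent_monomial x (a + b) =
      (of_int (lookup f a) * laurent_monomial x a) * (of_int (lookup g b) * laurent_monomial x b)"
      using x by (subst laurent_monomial_add) (auto simp: mult_ac)
  qed
  also have "\<dots> = ev x f * ev x g" by (simp add: lp_eval_def sum_product)
  finally show ?thesis .
qed

lemma ev_power:
  "f \<in> laurent_polys {} S \<Longrightarrow> (\<And>i. i \<in> S \<Longrightarrow> x i \<noteq> 0) \<Longrightarrow> ev x (f ^ k) = ev x f ^ k"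
  by (induction k) (auto simp: ev_mult[of _ S] is_subring_power is_subring_laurent_polys)

lemma ev_cong:
  assumes "f \<in> laurent_polys A B" "\<And>i. i \<in> A \<union> B \<Longrightarrow> x i = y i"
  shows "ev x f = ev y f"
  unfolding lp_eval_def
  by (intro sum.cong refl arg_cong2[where f = "(*)"] laurent_monomial_cong)
     (use assms in \<open>auto simp: laurent_polys_def\<close>)

lemma ev_upd_indep: "\<not> depends_on f i \<Longrightarrow> ev (x(i := v)) f = ev x f"
  unfolding lp_eval_def
  by (intro sum.cong refl arg_cong2[where f = "(*)"] laurent_monomial_cong)
     (auto simp: depends_on_def in_keys_iff)

definition laurent_ring :: "nat set \<Rightarrow> (nat \<Rightarrow> 'f::field_char_0) \<Rightarrow> 'f set" where
  "laurent_ring S x = ev x ` laurent_polys {} S"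

lemma carrier_laurent_subring: "carrier (laurent_subring x S) = laurent_ring S x"
  by (simp add: laurent_subring_def laurent_ring_def)

lemma is_subring_ev_image:
  assumes "is_subring B" "B \<subseteq> laurent_polys {} S" "\<And>i. i \<in> S \<Longrightarrow> x i \<noteq> 0"
  shows "is_subring (ev x ` B)"
proof -
  have "ev x (f * g) = ev x f * ev x g" if "f \<in> B" "g \<in> B" for f g
    using that assms(2,3) by (intro ev_mult) auto
  moreover have "1 \<in> ev x ` B" using is_subringD(1)[OF assms(1)] by (force intro: image_eqI[of _ _ 1])
  ultimately show ?thesis
    unfolding is_subring_def using is_subringD[OF assms(1)]
    by (auto simp flip: ev_uminus ev_add) (metis image_eqI)
qed

lemma is_subring_laurent_ring: "(\<And>i. i \<in> S \<Longrightarrow> x i \<noteq> 0) \<Longrightarrow> is_subring (laurent_ring S x)"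
  unfolding laurent_ring_def by (rule is_subring_ev_image[OF is_subring_laurent_polys subset_refl])

lemma unit_in_laurent_monomial:
  assumes A: "is_subring A" and x: "\<And>i. i \<in> keys e \<Longrightarrow> unit_in A (x i)"
  shows "unit_in A (laurent_monomial x e :: 'f::field)"
  unfolding laurent_monomial_def using x by (intro unit_in_prod[OF A] unit_in_powi[OF A])

text \<open>The universal property that yields all inclusions between Laurent rings and
  localizations: it suffices to see that the variables are units of the larger ring.\<close>

lemma laurent_ring_least:
  assumes A: "is_subring A" and x: "\<And>i. i \<in> S \<Longrightarrow> unit_in A (x i)"
  shows "laurent_ring S x \<subseteq> A"
proof
  fix y assume "y \<in> laurent_ring S x"
  then obtain f where f: "f \<in> laurent_polys {} S" "y = ev x f" by (auto simp: laurent_ring_def)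
  have "laurent_monomial x e \<in> A" if "e \<in> keys f" for e
    using unit_in_laurent_monomial[OF A, of e x] x f(1) that by (auto simp: unit_in_def laurent_polys_def)
  then show "y \<in> A"
    unfolding f(2) lp_eval_def
    by (intro is_subring_sum[OF A] is_subringD(4)[OF A] is_subring_of_int[OF A])
qed

lemma laurent_monomial_in_laurent_ring:
  "keys e \<subseteq> S \<Longrightarrow> laurent_monomial x e \<in> laurent_ring S x"
  unfolding laurent_ring_def
  by (rule image_eqI[of _ _ "single e 1"]) (auto simp: laurent_polys_def)

lemma unit_in_laurent_ring:
  assumes "keys e \<subseteq> S" "\<And>i. i \<in> S \<Longrightarrow> x i \<noteq> 0"
  shows "unit_in (laurent_ring S x) (laurent_monomial x e)"
  using laurent_monomial_in_laurent_ring[OF assms(1), of x] laurent_monomial_nonzero[of e x]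
    laurent_monomial_in_laurent_ring[of "- e" S x] assms
  by (auto simp: unit_in_field laurent_monomial_uminus)

lemma unit_in_laurent_ring_var:
  "i \<in> S \<Longrightarrow> (\<And>i. i \<in> S \<Longrightarrow> x i \<noteq> 0) \<Longrightarrow> unit_in (laurent_ring S x) (x i)"
  using unit_in_laurent_ring[of "single i 1" S x] by simp

text \<open>Algebraic independence in the form in which it is applied: \<open>ev x\<close> is
  injective on Laurent polynomials, so identities in the field lift to formal ones.\<close>

definition laurent_independent :: "nat \<Rightarrow> (nat \<Rightarrow> 'f::field_char_0) \<Rightarrow> bool" where
  "laurent_independent m x \<longleftrightarrow>
     (\<forall>i\<in>{1..m}. x i \<noteq> 0) \<and> (\<forall>f\<in>laurent_polys {} {1..m}. ev x f = 0 \<longrightarrow> f = 0)"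

lemma laurent_independentD:
  assumes "laurent_independent m x"
  shows "i \<in> {1..m} \<Longrightarrow> x i \<noteq> 0"
    "f \<in> laurent_polys {} {1..m} \<Longrightarrow> g \<in> laurent_polys {} {1..m} \<Longrightarrow> ev x f = ev x g \<Longrightarrow> f = g"
proof -
  show "i \<in> {1..m} \<Longrightarrow> x i \<noteq> 0" using assms by (simp add: laurent_independent_def)
next
  assume fg: "f \<in> laurent_polys {} {1..m}" "g \<in> laurent_polys {} {1..m}" "ev x f = ev x g"
  then have "f + - g \<in> laurent_polys {} {1..m}" "ev x (f + - g) = 0"
    by (auto intro: is_subringD[OF is_subring_laurent_polys] simp: ev_add ev_uminus simp del: add_uminus_conv_diff)
  then have "f + - g = 0" using assms unfolding laurent_independent_def by blast
  then show "f = g" by simp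
qed

text \<open>A Laurent relation becomes a polynomial relation after multiplication by a monomial; the
  map \<open>q\<close> then reads its integer coefficients as rational ones.\<close>

lemma free_generators_independent:
  assumes "free_generators m x"
  shows "laurent_independent m x"
proof -
  define q where "q = (Poly_Mapping.map of_int :: int lpoly \<Rightarrow> rat lpoly)"
  have lookq: "lookup (q f) e = of_int (lookup f e)" for f e
    by (auto simp: q_def map.rep_eq when_def)
  have keysq: "keys (q f) = keys f" for f
    by (auto simp: in_keys_iff lookq)
  have free: "f = 0" if f: "f \<in> laurent_polys {1..m} {}" "ev x f = 0" for f
  proof -
    have "lp_eval of_rat x (q f) = ev x f" by (simp add: lp_eval_def keysq lookq)
    moreover have "q f \<in> laurent_polys {1..m} {}" using f(1) by (simp add: laurent_polys_def keysq)
    ultimately have "q f = 0" using assms f(2) by (simp add: free_generators_def)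
    then show ?thesis using keysq[of f] by (metis keys_zero keys_eq_empty)
  qed
  have x0: "x i \<noteq> 0" if "i \<in> {1..m}" for i
  proof
    assume "x i = 0"
    then have "lvar i = (0 :: int lpoly)"
      using that by (intro free) (auto simp: lvar_def lookup_single when_def intro!: single_in_laurent_polys split: if_splits)
    then show False by (simp add: lvar_def)
  qed
  moreover have "f = 0" if f: "f \<in> laurent_polys {} {1..m}" "ev x f = 0" for f
  proof -
    obtain d where d: "\<And>i. i \<notin> {1..m} \<Longrightarrow> lookup d i = 0"
        "single d 1 * f \<in> laurent_polys {1..m} {}"
      using clear_denominators[OF f(1)] by metis
    have "ev x (single d 1 * f) = 0"
      using f x0 d(1) by (subst ev_mult[of _ "{1..m}"]) (auto intro!: single_in_laurent_polys)
    then have "single d 1 * f = 0" using free d(2) by blast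
    then show ?thesis by (metis mult_eq_0_iff single_zero single_one lookup_single_eq lookup_zero one_neq_zero)
  qed
  ultimately show ?thesis by (simp add: laurent_independent_def)
qed

lemma inj_on_ev: "laurent_independent m x \<Longrightarrow> inj_on (ev x) (laurent_polys {} {1..m})"
  using laurent_independentD(2) by (intro inj_onI)

lemma dvd_in_laurent_ring_iff:
  assumes x: "laurent_independent m x" and fg: "f \<in> laurent_polys {} {1..m}" "g \<in> laurent_polys {} {1..m}"
  shows "dvd_in (laurent_ring {1..m} x) (ev x f) (ev x g) \<longleftrightarrow> dvd_in (laurent_polys {} {1..m}) f g"
  unfolding laurent_ring_def
  by (intro dvd_in_image_iff is_subring_laurent_polys inj_on_ev[OF x] fg ev_mult[of _ "{1..m}"] laurent_independentD(1)[OF x])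

lemma prime_in_laurent_ring:
  assumes x: "laurent_independent m x" and p: "prime_in (laurent_polys {} {1..m}) p"
  shows "prime_in (laurent_ring {1..m} x) (ev x p)"
  unfolding laurent_ring_def
  by (intro prime_in_image is_subring_laurent_polys inj_on_ev[OF x] p ev_mult[of _ "{1..m}"] laurent_independentD(1)[OF x])
     auto

section \<open>Mutation\<close>

text \<open>\<open>frag_cmul\<close> is the integer multiple of an exponent vector.\<close>

lemma laurent_monomial_frag_cmul:
  "laurent_monomial x (frag_cmul k e) = laurent_monomial x e powi k"
proof -
  have "laurent_monomial x (frag_cmul k e) = (\<Prod>i\<in>keys e. x i powi (lookup e i * k))"
    by (subst laurent_monomial_superset[of "keys e"]) (auto simp: mult.commute)
  also have "\<dots> = (\<Prod>i\<in>keys e. (x i powi lookup e i) powi k)"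
    by (simp only: power_int_mult)
  also have "\<dots> = laurent_monomial x e powi k"
    unfolding laurent_monomial_def by (induction rule: infinite_finite_induct) (auto simp: power_int_mult_distrib)
  finally show ?thesis .
qed

lemma lp_part_add: "lp_part Q (f + g) = lp_part Q f + lp_part Q g"
  by (intro poly_mapping_eqI) (simp add: lookup_lp_part lookup_add)

lemma lp_part_id: "(\<And>e. e \<in> keys f \<Longrightarrow> Q e) \<Longrightarrow> lp_part Q f = f"
  by (intro poly_mapping_eqI) (auto simp: lookup_lp_part in_keys_iff)

lemma lp_part_eq_0: "(\<And>e. e \<in> keys f \<Longrightarrow> \<not> Q e) \<Longrightarrow> lp_part Q f = 0"
  by (intro poly_mapping_eqI) (auto simp: lookup_lp_part in_keys_iff)

lemma lp_part_split: "f = lp_part Q f + lp_part (\<lambda>e. \<not> Q e) f"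
  by (intro poly_mapping_eqI) (simp add: lookup_lp_part lookup_add)

lemma lp_part_in_laurent_polys: "f \<in> laurent_polys A B \<Longrightarrow> lp_part Q f \<in> laurent_polys A B"
  by (auto simp: laurent_polys_def keys_lp_part)

abbreviation free_part :: "nat \<Rightarrow> int lpoly \<Rightarrow> int lpoly" where
  "free_part i \<equiv> lp_part (\<lambda>e. lookup e i = 0)"

text \<open>Multiplication by an \<open>f\<close> free of the variable preserves the grading by the
  exponent of that variable.\<close>

lemma free_part_mult:
  assumes "\<not> depends_on f i"
  shows "free_part i (f * g) = f * free_part i g"
proof -
  let ?N = "\<lambda>e. lookup e i \<noteq> 0"
  have *: "lookup e i = lookup b i"
    if "e = a + b" "a \<in> keys f" for a b e
    using that assms by (auto simp: depends_on_def lookup_add)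
  have "free_part i (f * free_part i g) = f * free_part i g"
  proof (rule lp_part_id)
    fix e assume "e \<in> keys (f * free_part i g)"
    then obtain a b where ab: "e = a + b" "a \<in> keys f" "b \<in> keys (free_part i g)"
      using keys_mult by blast
    show "lookup e i = 0" using *[OF ab(1,2)] ab(3) by (simp add: keys_lp_part)
  qed
  moreover have "free_part i (f * lp_part ?N g) = 0"
  proof (rule lp_part_eq_0)
    fix e assume "e \<in> keys (f * lp_part ?N g)"
    then obtain a b where ab: "e = a + b" "a \<in> keys f" "b \<in> keys (lp_part ?N g)"
      using keys_mult by blast
    show "lookup e i \<noteq> 0" using *[OF ab(1,2)] ab(3) by (simp add: keys_lp_part)
  qed
  moreover have "f * g = f * free_part i g + f * lp_part ?N g"
    using lp_part_split[of g "\<lambda>e. lookup e i = 0"] by (metis distrib_left)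
  ultimately show ?thesis by (simp add: lp_part_add)
qed

lemma depends_on_mult: "\<not> depends_on f i \<Longrightarrow> \<not> depends_on g i \<Longrightarrow> \<not> depends_on (f * g) i"
proof
  assume f: "\<not> depends_on f i" and g: "\<not> depends_on g i" and "depends_on (f * g) i"
  then obtain e where "e \<in> keys (f * g)" "lookup e i \<noteq> 0" by (auto simp: depends_on_def)
  then obtain a b where "e = a + b" "a \<in> keys f" "b \<in> keys g"
    using keys_mult by blast
  then show False using f g \<open>lookup e i \<noteq> 0\<close> by (auto simp: depends_on_def lookup_add)
qed

lemma depends_on_power: "\<not> depends_on f i \<Longrightarrow> \<not> depends_on (f ^ k) i"
  by (induction k) (auto simp: depends_on_mult depends_on_def[of 1])

lemma not_depends_on_free_part: "\<not> depends_on (free_part i f) i"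
  by (auto simp: depends_on_def keys_lp_part)

text \<open>Every nonzero power of 0 evaluates to 0, negative powers included, so exactly the terms
  free of the variable survive.\<close>

lemma ev_upd_0: "ev (x(i := 0)) f = ev x (free_part i f)"
proof -
  have "ev x (free_part i f) = (\<Sum>e\<in>{e \<in> keys f. lookup e i = 0}.
      of_int (lookup f e) * laurent_monomial x e)"
    by (auto simp: lp_eval_def keys_lp_part lookup_lp_part intro: sum.cong)
  also have "\<dots> = (\<Sum>e\<in>keys f. of_int (lookup f e) * laurent_monomial (x(i := 0)) e)"
    by (rule sum.mono_neutral_cong_left) (auto simp: laurent_monomial_upd power_int_0_left_if)
  finally show ?thesis by (simp add: lp_eval_def)
qed

text \<open>The formal result of substituting \<open>q\<close> divided by the \<open>i\<close>-th variable for the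
  \<open>i\<close>-th variable, which must not occur with negative exponents.\<close>

definition lp_swap :: "nat \<Rightarrow> int lpoly \<Rightarrow> int lpoly \<Rightarrow> int lpoly" where
  "lp_swap i q f = (\<Sum>e\<in>keys f.
     single (e - single i (2 * lookup e i)) (lookup f e)
       * q ^ nat (lookup e i))"

context
  fixes m i :: nat and q f :: "int lpoly"
  assumes i: "i \<in> {1..m}" and q: "q \<in> laurent_polys {} {1..m}" and f: "f \<in> laurent_polys {} {1..m}"
begin

lemma swap_term_in:
  assumes "e \<in> keys f"
  shows "single (e - single i k) (c :: int) \<in> laurent_polys {} {1..m}"
proof (rule single_in_laurent_polys)
  show "\<forall>j. j \<notin> {} \<union> {1..m} \<longrightarrow> lookup (e - single i k) j = 0"
    using f i assms by (auto simp: laurent_polys_iff in_keys_iff lookup_minus lookup_single when_def simp del: atLeastAtMost_iff)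
qed auto

lemma lp_swap_in: "lp_swap i q f \<in> laurent_polys {} {1..m}"
  unfolding lp_swap_def
  by (intro is_subring_sum is_subring_laurent_polys is_subringD(4) is_subring_power swap_term_in q)

text \<open>Every term in which the variable occurs acquires a positive power of
  \<open>q\<close>.\<close>

lemma lp_swap_cong_free_part:
  assumes nonneg: "\<And>e. e \<in> keys f \<Longrightarrow> 0 \<le> lookup e i"
  shows "dvd_in (laurent_polys {} {1..m}) q (lp_swap i q f - free_part i f)"
proof -
  let ?L = "laurent_polys {} {1..m} :: int lpoly set"
  let ?s = "\<lambda>e. single (e - single i (2 * lookup e i)) (lookup f e)"
  let ?t = "\<lambda>e. ?s e * q ^ nat (lookup e i)"
  let ?Z = "{e \<in> keys f. lookup e i = 0}"
  have "lp_swap i q f = sum ?t (keys f - ?Z) + sum ?t ?Z"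
    unfolding lp_swap_def by (rule sum.subset_diff) auto
  also have "sum ?t ?Z = free_part i f"
    unfolding lp_part_def by (intro sum.cong) auto
  finally have eq: "lp_swap i q f - free_part i f = sum ?t (keys f - ?Z)" by simp
  show ?thesis unfolding eq
  proof (intro dvd_in_sum is_subring_laurent_polys)
    fix e assume e: "e \<in> keys f - ?Z"
    then have "nat (lookup e i) = Suc (nat (lookup e i) - 1)"
      using nonneg[of e] by auto
    then have "q ^ nat (lookup e i) = q * q ^ (nat (lookup e i) - 1)"
      by (metis power_Suc)
    then have "?t e = q * (?s e * q ^ (nat (lookup e i) - 1))"
      by (simp only: mult.left_commute)
    moreover have "?s e * q ^ (nat (lookup e i) - 1) \<in> ?L"
      using e by (intro is_subring_laurent_polys is_subringD(4) is_subring_power swap_term_in q) auto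
    ultimately show "dvd_in ?L q (?t e)" by (rule dvd_inI[rotated])
  qed
qed

lemma ev_lp_swap:
  assumes nonneg: "\<And>e. e \<in> keys f \<Longrightarrow> 0 \<le> lookup e i"
    and w: "\<And>k. k \<in> {1..m} \<Longrightarrow> w k \<noteq> 0"
  shows "ev w (lp_swap i q f) = ev (w(i := ev w q / w i)) f"
proof -
  have "ev w (single (e - single i (2 * lookup e i)) c * q ^ nat (lookup e i))
      = of_int c * laurent_monomial (w(i := ev w q / w i)) e" if e: "e \<in> keys f" for e c
  proof -
    define k where "k = nat (lookup e i)"
    have k: "lookup e i = int k" using nonneg[OF e] by (simp add: k_def)
    have ks: "keys (e - single i l) \<subseteq> {1..m}" for l
      using swap_term_in[OF e, of l 1] by (simp add: laurent_polys_def)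
    \<comment> \<open>Subtracting twice the exponent \<open>k\<close> changes it to
      \<open>- k\<close>, which is the power of the variable left in the denominator by
      \<open>(q / w i) ^ k\<close>.\<close>
    have "laurent_monomial w (e - single i (2 * int k)) =
        laurent_monomial w (single i (- int k) + (e - single i (int k)))"
      by (rule arg_cong[where f = "laurent_monomial w"], rule poly_mapping_eqI)
         (auto simp: lookup_add lookup_minus lookup_single when_def)
    also have "\<dots> = w i powi (- int k) * laurent_monomial w (e - single i (int k))"
      using ks[of "int k"] i w by (subst laurent_monomial_add) (auto split: if_splits)
    finally have "ev w q ^ k * laurent_monomial w (e - single i (2 * int k)) =
        (ev w q / w i) ^ k * laurent_monomial w (e - single i (int k))"
      by (simp add: power_int_minus power_mult_distrib power_inverse divide_inverse mult_ac)
    moreover have "ev w (single (e - single i (2 * int k)) c * q ^ k) =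
        of_int c * laurent_monomial w (e - single i (2 * int k)) * ev w q ^ k"
      using ev_mult[OF swap_term_in[OF e] is_subring_power[OF is_subring_laurent_polys q] w]
        ev_power[of q "{1..m}" w k] q w by simp
    ultimately show ?thesis by (simp add: laurent_monomial_upd k mult_ac)
  qed
  then show ?thesis unfolding lp_swap_def by (simp add: ev_sum lp_eval_def[of _ _ f])
qed

end

text \<open>The exponent vector of the monomial that turns an exchange polynomial into its hat
  polynomial.\<close>

definition hat_shift :: "nat \<Rightarrow> nat \<Rightarrow> (nat \<Rightarrow> 'f::field_char_0) \<Rightarrow> (nat \<Rightarrow> int lpoly) \<Rightarrow> nat \<Rightarrow> nat \<Rightarrow>\<^sub>0 int" where
  "hat_shift n m x P k = (\<Sum>j\<in>{1..n}. single j (- int (hat_exponent m x P k j)))"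

lemma hat_poly_eq: "hat_poly n m x P k = P k * single (hat_shift n m x P k) 1"
  by (simp add: hat_poly_def hat_shift_def)

lemma lookup_hat_shift:
  "lookup (hat_shift n m x P k) j = (if j \<in> {1..n} then - int (hat_exponent m x P k j) else 0)"
  unfolding hat_shift_def by (rule lookup_sum_single) simp

lemma hat_shift_self [simp]: "lookup (hat_shift n m x P k) k = 0"
  by (simp add: lookup_hat_shift hat_exponent_def)

lemma keys_hat_shift: "keys (hat_shift n m x P k) \<subseteq> {1..n} - {k}"
  by (auto simp: in_keys_iff lookup_hat_shift hat_exponent_def split: if_splits)

lemma keys_hat_shift_subset: "n \<le> m \<Longrightarrow> keys (hat_shift n m x P k) \<subseteq> {1..m}"
  using keys_hat_shift[of n m x P k] by (auto dest!: subsetD)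

lemma lp_seedD:
  assumes nm: "n \<le> m" and s: "lp_seed n m (x, P)"
  shows "laurent_independent m x"
    and "i \<in> {1..n} \<Longrightarrow> P i \<in> laurent_polys {} {1..m}"
    and "i \<in> {1..n} \<Longrightarrow> prime_in (laurent_polys {} {1..m}) (P i)"
    and "i \<in> {1..n} \<Longrightarrow> j \<in> {1..n} \<Longrightarrow> low j (P i) = 0"
    and "i \<in> {1..n} \<Longrightarrow> \<not> depends_on (P i) i"
proof -
  show "laurent_independent m x"
    using s by (auto simp: lp_seed_def intro: free_generators_independent)
  assume i: "i \<in> {1..n}"
  have P: "P i \<in> laurent_polys {1..n} {n+1..m}" "ring_irreducible\<^bsub>exchange_ring n m\<^esub> (P i)"
      "\<And>j. j \<in> {1..n} \<Longrightarrow> \<not> dvd_in (laurent_polys {1..n} {n+1..m}) (lvar j) (P i)"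
    using s i by (auto simp: lp_seed_def mem_exchange_ring divides_exchange_ring simp del: atLeastAtMost_iff)
  show pr: "prime_in (laurent_polys {} {1..m}) (P i)" by (rule exchange_poly_prime[OF nm P])
  then show "P i \<in> laurent_polys {} {1..m}" by (rule prime_inD)
  show "low j (P i) = 0" if "j \<in> {1..n}"
    by (rule low_eq_0[OF nm P(1) prime_inD(2)[OF pr] that P(3)[OF that]])
  show "\<not> depends_on (P i) i" using s i by (auto simp: lp_seed_def)
qed

lemma lp_seed_nonneg:
  assumes "n \<le> m" "lp_seed n m (x, P)" "i \<in> {1..n}" "j \<in> {1..n}" "e \<in> keys (P i)"
  shows "0 \<le> lookup e j"
  using lp_seedD(4)[OF assms(1-4)] trop_le[OF assms(5), of "\<lambda>e. lookup e j"] by simp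

lemma lp_mutation_var:
  assumes "lp_mutation n m k (x, P) (x', P')"
  shows "i \<in> {1..m} \<Longrightarrow> i \<noteq> k \<Longrightarrow> x' i = x i" "x' k = ev x (hat_poly n m x P k) / x k"
    "j \<in> {1..n} \<Longrightarrow> \<not> depends_on (P j) k \<Longrightarrow> P' j = P j"
  using assms by (auto simp: lp_mutation_def)

lemma lp_mutation_poly:
  assumes mut: "lp_mutation n m k (x, P) (x', P')" and j: "j \<in> {1..n}" "depends_on (P j) k"
    and Q: "Q = ev (x(j := 0)) (hat_poly n m x P k)" and G: "G = ev (x(k := Q / x' k)) (P j)"
  obtains D e where "D \<in> laurent_ring ({1..m} - {j}) x'" "D gcdof\<^bsub>laurent_subring x' ({1..m} - {j})\<^esub> G Q"
    "keys e \<subseteq> {1..n}" "ev x' (P' j) = laurent_monomial x' e * (G / D)"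
proof -
  from mut have "\<forall>j\<in>{1..n}.
        if depends_on (P j) k then
          (let Q = ev (x(j := 0)) (hat_poly n m x P k);
               N = Q / x' k;
               G = ev (x(k := N)) (P j);
               L = laurent_subring x' ({1..m} - {j})
           in \<exists>D \<in> carrier L. \<exists>e.
                D gcdof\<^bsub>L\<^esub> G Q \<and>
                keys e \<subseteq> {1..n} \<and>
                ev x' (P' j) = laurent_monomial x' e * (G / D) \<and>
                P' j \<in> carrier (exchange_ring n m) \<and>
                (\<forall>i\<in>{1..n}. \<not> (lvar i divides\<^bsub>exchange_ring n m\<^esub> P' j)))
        else P' j = P j"
    unfolding lp_mutation_def split by blast
  from bspec[OF this j(1)] j(2) show thesis
    unfolding Let_def Q[symmetric] G[symmetric] carrier_laurent_subring using that by auto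
qed

lemma ev_hat_poly:
  assumes nm: "n \<le> m" and s: "lp_seed n m (x, P)" and k: "k \<in> {1..n}"
  shows "ev x (hat_poly n m x P k) = ev x (P k) * laurent_monomial x (hat_shift n m x P k)"
    and "hat_poly n m x P k \<in> laurent_polys {} {1..m}"
proof -
  have s1: "single (hat_shift n m x P k) 1 \<in> (laurent_polys {} {1..m} :: int lpoly set)"
    using keys_hat_shift_subset[OF nm] by (simp add: laurent_polys_def)
  show "ev x (hat_poly n m x P k) = ev x (P k) * laurent_monomial x (hat_shift n m x P k)"
    unfolding hat_poly_eq
    using ev_mult[OF lp_seedD(2)[OF nm s k] s1 laurent_independentD(1)[OF lp_seedD(1)[OF nm s]]] by simp
  show "hat_poly n m x P k \<in> laurent_polys {} {1..m}"
    unfolding hat_poly_eq by (intro is_subringD(4) is_subring_laurent_polys lp_seedD(2)[OF nm s k] s1)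
qed

section \<open>One mutation and the local ring of its exchange polynomial\<close>

locale mutation_pair =
  fixes n m i :: nat and x x1 :: "nat \<Rightarrow> 'f::field_char_0" and P P1 :: "nat \<Rightarrow> int lpoly"
  assumes nm: "n \<le> m" and i: "i \<in> {1..n}"
    and s0: "lp_seed n m (x, P)" and s1: "lp_seed n m (x1, P1)"
    and mut1: "lp_mutation n m i (x, P) (x1, P1)"
begin

abbreviation "L \<equiv> laurent_polys {} {1..m} :: int lpoly set"
abbreviation "A \<equiv> laurent_ring {1..m} x"
definition "p = ev x (P i)"
abbreviation "loc \<equiv> localization A p"
text \<open>Chosen so that \<open>x1 i = p / T\<close>: the hat monomial is absorbed into
  \<open>T\<close>. Since \<open>T\<close> is a unit of \<open>A\<close>, replacing
  \<open>x i\<close> by \<open>T\<close> gives coordinates \<open>z\<close> with the same Laurent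
  ring, in which the mutation is a plain swap by \<open>P i\<close>.\<close>

definition "T = x i / laurent_monomial x (hat_shift n m x P i)"
definition "z = x(i := T)"

lemma im: "i \<in> {1..m}" using i nm by auto

lemmas indep = lp_seedD(1)[OF nm s0]
lemmas indep1 = lp_seedD(1)[OF nm s1]

lemma x_nz: "k \<in> {1..m} \<Longrightarrow> x k \<noteq> 0" and x1_nz: "k \<in> {1..m} \<Longrightarrow> x1 k \<noteq> 0"
  using laurent_independentD(1)[OF indep] laurent_independentD(1)[OF indep1] by auto

lemma A_subring: "is_subring A" using is_subring_laurent_ring[OF x_nz] .

lemma p_prime: "prime_in A p"
  unfolding p_def by (rule prime_in_laurent_ring[OF indep lp_seedD(3)[OF nm s0 i]])

lemma p_nz: "p \<noteq> 0" using prime_inD(2)[OF p_prime] .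

lemma loc_subring: "is_subring loc" by (rule is_subring_localization[OF A_subring p_prime])

lemma A_loc: "A \<subseteq> loc" by (rule subset_localization[OF A_subring p_prime])

lemma unit_A_loc: "unit_in A u \<Longrightarrow> unit_in loc u"
  using A_loc by (auto simp: unit_in_field)

lemma x_unit: "k \<in> {1..m} \<Longrightarrow> unit_in A (x k)"
  by (rule unit_in_laurent_ring_var[OF _ x_nz])

lemma shift_unit: "unit_in A (laurent_monomial x (hat_shift n m x P i))"
  by (rule unit_in_laurent_ring[OF keys_hat_shift_subset[OF nm] x_nz])

lemma T_unit: "unit_in A T"
  unfolding T_def by (rule unit_in_field_divide[OF A_subring x_unit[OF im] shift_unit])

lemma T_nz: "T \<noteq> 0" using T_unit by (simp add: unit_in_field)

lemma x1_other: "k \<in> {1..m} \<Longrightarrow> k \<noteq> i \<Longrightarrow> x1 k = x k"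
  by (rule lp_mutation_var(1)[OF mut1])

lemma x1_i: "x1 i = p / T"
  unfolding lp_mutation_var(2)[OF mut1] ev_hat_poly(1)[OF nm s0 i] by (simp add: p_def T_def)

lemma P1_i: "P1 i = P i"
  by (rule lp_mutation_var(3)[OF mut1 i lp_seedD(5)[OF nm s0 i]])

lemma Pi: "P i \<in> L" "prime_in L (P i)" "\<not> depends_on (P i) i"
  using lp_seedD(2,3,5)[OF nm s0 i] by blast+

lemma ev_indep: "f \<in> L \<Longrightarrow> \<not> depends_on f i \<Longrightarrow> ev x1 f = ev x f"
  using ev_upd_indep[of f i x "x1 i"] ev_cong[of f "{}" "{1..m}" "x(i := x1 i)" x1] x1_other by simp

lemma ev_x1_Pi: "ev x1 (P i) = p"
  unfolding p_def by (rule ev_indep[OF Pi(1,3)])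

lemma lm_z: "laurent_monomial z e = laurent_monomial x (e - frag_cmul (lookup e i) (hat_shift n m x P i))"
  if "keys e \<subseteq> {1..m}"
proof -
  let ?d = "hat_shift n m x P i" and ?k = "lookup e i"
  have kd: "keys ?d \<subseteq> {1..m}" by (rule keys_hat_shift_subset[OF nm])
  have kd': "keys (frag_cmul (- ?k) ?d) \<subseteq> {1..m}" using kd keys_cmul by blast
  have ke: "keys (e - single i ?k) \<subseteq> {1..m}"
    using that by (auto simp: in_keys_iff lookup_minus lookup_single when_def split: if_splits)
  have "laurent_monomial x (e - frag_cmul ?k ?d) =
      laurent_monomial x (single i ?k + ((e - single i ?k) + frag_cmul (- ?k) ?d))"
    by (rule arg_cong[where f = "laurent_monomial x"], rule poly_mapping_eqI) (simp add: lookup_add lookup_minus)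
  also have "\<dots> = x i powi ?k * (laurent_monomial x (e - single i ?k) * laurent_monomial x ?d powi (- ?k))"
    using im kd' ke keys_add[of "e - single i ?k" "frag_cmul (- ?k) ?d"] x_nz
    by (subst laurent_monomial_add, force split: if_splits, subst laurent_monomial_add) (auto simp: laurent_monomial_frag_cmul)
  also have "\<dots> = T powi ?k * laurent_monomial x (e - single i ?k)"
    by (simp add: T_def divide_inverse power_int_mult_distrib power_int_inverse power_int_minus mult_ac)
  finally show ?thesis by (simp add: z_def laurent_monomial_upd)
qed

lemma z_nz: "k \<in> {1..m} \<Longrightarrow> z k \<noteq> 0"
  using x_nz T_nz by (auto simp: z_def)

text \<open>Monomials in \<open>z\<close> are monomials in \<open>x\<close> after the linear change
  \<open>\<sigma>\<close> of exponents. The hat shift has no component in direction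
  \<open>i\<close>, so \<open>\<sigma>\<close> preserves that coordinate and is injective: no two
  terms of \<open>f\<close> merge.\<close>

lemma indep_z: "laurent_independent m z"
  unfolding laurent_independent_def
proof (intro conjI ballI impI)
  fix f assume f: "f \<in> laurent_polys {} {1..m}" "ev z f = 0"
  define \<sigma> where "\<sigma> = (\<lambda>e. e - frag_cmul (lookup e i) (hat_shift n m x P i))"
  have \<sigma>i: "lookup (\<sigma> e) i = lookup e i" for e
    by (simp add: \<sigma>_def lookup_minus)
  have inj: "\<sigma> e = \<sigma> e' \<longleftrightarrow> e = e'" for e e'
  proof
    assume eq: "\<sigma> e = \<sigma> e'"
    then have "lookup e i = lookup e' i" using \<sigma>i by metis
    with eq show "e = e'" by (simp add: \<sigma>_def)
  qed simp
  define F where "F = (\<Sum>e\<in>keys f. single (\<sigma> e) (lookup f e))"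
  have keys: "keys e \<subseteq> {1..m}" if "e \<in> keys f" for e
    using f(1) that by (auto simp: laurent_polys_def)
  have "keys (\<sigma> e) \<subseteq> {1..m}" if "e \<in> keys f" for e
  proof -
    have "keys (\<sigma> e) \<subseteq> keys e \<union> keys (hat_shift n m x P i)"
      unfolding \<sigma>_def by (rule order_trans[OF keys_diff Un_mono[OF order_refl keys_cmul]])
    then show ?thesis using keys[OF that] keys_hat_shift_subset[OF nm, of x P i] by blast
  qed
  then have "F \<in> laurent_polys {} {1..m}"
    unfolding F_def by (intro is_subring_sum is_subring_laurent_polys) (auto simp: laurent_polys_def split: if_splits)
  moreover have "ev x F = ev z f"
    unfolding F_def by (simp add: ev_sum lp_eval_def[of _ z] lm_z[OF keys] \<sigma>_def)
  ultimately have "F = 0" using indep f(2) by (simp add: laurent_independent_def)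
  moreover have "lookup F (\<sigma> e) = lookup f e" for e
    by (auto simp: F_def lookup_sum lookup_single inj when_def in_keys_iff sum.delta')
  ultimately show "f = 0" by (intro poly_mapping_eqI) (metis lookup_zero)
qed (rule z_nz)

lemma laurent_ring_z: "laurent_ring {1..m} z = A"
proof (rule equalityI; rule laurent_ring_least)
  fix k assume k: "k \<in> {1..m}"
  show "unit_in A (z k)" using T_unit x_unit[OF k] by (simp add: z_def)
  have zk: "unit_in (laurent_ring {1..m} z) (z k)" if "k \<in> {1..m}" for k
    by (rule unit_in_laurent_ring_var[OF that z_nz])
  show "unit_in (laurent_ring {1..m} z) (x k)"
  proof (cases "k = i")
    case True
    have "laurent_monomial x (hat_shift n m x P i) = laurent_monomial z (hat_shift n m x P i)"
      using keys_hat_shift[of n m x P i] by (intro laurent_monomial_cong) (auto simp: z_def)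
    then have "x i = z i * laurent_monomial z (hat_shift n m x P i)"
      using shift_unit by (simp add: z_def T_def unit_in_field)
    moreover have "unit_in (laurent_ring {1..m} z) (laurent_monomial z (hat_shift n m x P i))"
      by (rule unit_in_laurent_ring[OF keys_hat_shift_subset[OF nm] z_nz])
    ultimately show ?thesis
      using unit_in_mult[OF is_subring_laurent_ring[OF z_nz] zk[OF im]] True by simp
  next
    case False
    then show ?thesis using zk[OF k] by (simp add: z_def)
  qed
qed (rule A_subring is_subring_laurent_ring z_nz | assumption)+

lemma ev_z_Pi: "ev z (P i) = p"
  unfolding z_def p_def by (rule ev_upd_indep[OF Pi(3)])

text \<open>In the coordinates \<open>z\<close> the swap replaces \<open>T\<close> by
  \<open>p / T\<close>, which is \<open>x1 i\<close>. So values in the second cluster become Laurent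
  polynomials in the first.\<close>

lemma ev_x1_eq_ev_z_swap:
  assumes f: "f \<in> L" "\<And>e. e \<in> keys f \<Longrightarrow> 0 \<le> lookup e i"
  shows "ev x1 f = ev z (lp_swap i (P i) f)"
proof -
  have "ev z (lp_swap i (P i) f) = ev (z(i := ev z (P i) / z i)) f"
    by (rule ev_lp_swap[OF im Pi(1) f z_nz])
  also have "\<dots> = ev x1 f"
    using x1_other x1_i by (intro ev_cong[OF f(1)]) (auto simp: z_def ev_z_Pi[unfolded z_def])
  finally show ?thesis ..
qed

text \<open>The exponent of the new variable in the modified exchange polynomial is the order of
  vanishing of the exchange polynomial along \<open>p\<close>.\<close>

lemma hat_exponent_order:
  assumes j: "j \<in> {1..n}" "j \<noteq> i" and b: "b = hat_exponent m x1 P1 j i"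
  shows "\<exists>c\<in>L. lp_swap i (P i) (P1 j) = P i ^ b * c \<and> \<not> dvd_in L (P i) c"
proof -
  let ?r = "lp_swap i (P i) (P1 j)"
  have P1j: "P1 j \<in> L" "P1 j \<noteq> 0" using lp_seedD(2,3)[OF nm s1 j(1)] prime_inD(2) by auto
  have nonneg: "0 \<le> lookup e i" if "e \<in> keys (P1 j)" for e
    by (rule lp_seed_nonneg[OF nm s1 j(1) i that])
  have rL: "?r \<in> L" by (rule lp_swap_in[OF im Pi(1) P1j(1)])
  have "ev x1 (P1 j) \<noteq> 0" using indep1 P1j by (auto simp: laurent_independent_def)
  then have r0: "?r \<noteq> 0" using ev_x1_eq_ev_z_swap[OF P1j(1) nonneg] by auto
  have ev_r: "ev (x1(i := p / x1 i)) (P1 j) = ev x1 ?r"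
    using ev_lp_swap[OF im Pi(1) P1j(1) nonneg x1_nz] by (simp add: ev_x1_Pi)
  define S where "S = {s. ev (x1(i := ev x1 (P1 i) / x1 i)) (P1 j) / ev x1 (P1 i) ^ s \<in> carrier (laurent_subring x1 {1..m})}"
  \<comment> \<open>The right-hand side is formal. It may be evaluated in \<open>x1\<close>, where
    the hat exponent is defined, but also in \<open>z\<close>, where it measures the order along
    \<open>p\<close>.\<close>
  have S_iff: "s \<in> S \<longleftrightarrow> dvd_in L (P i ^ s) ?r" for s
  proof -
    have "s \<in> S \<longleftrightarrow> ev x1 ?r / p ^ s \<in> laurent_ring {1..m} x1"
      by (simp add: S_def P1_i ev_x1_Pi ev_r carrier_laurent_subring)
    also have "\<dots> \<longleftrightarrow> dvd_in (laurent_ring {1..m} x1) (p ^ s) (ev x1 ?r)"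
      using p_nz by (auto simp: dvd_in_def intro!: bexI[of _ "ev x1 ?r / p ^ s"])
    also have "p ^ s = ev x1 (P i ^ s)"
      using ev_power[of "P i" "{1..m}" x1 s] Pi(1) x1_nz ev_x1_Pi by simp
    also have "dvd_in (laurent_ring {1..m} x1) (ev x1 (P i ^ s)) (ev x1 ?r) \<longleftrightarrow> dvd_in L (P i ^ s) ?r"
      using Pi(1) rL by (intro dvd_in_laurent_ring_iff[OF indep1] is_subring_power is_subring_laurent_polys)
    finally show ?thesis .
  qed
  \<comment> \<open>Factoriality bounds the order, so that \<open>Max\<close> is taken over a finite
    set.\<close>
  obtain N where "\<And>s. dvd_in L (P i ^ s) ?r \<Longrightarrow> s \<le> N"
    using factorial_in_power_bound[OF factorial_in_laurent_polys Pi(2) rL r0] by blast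
  then have fin: "finite S" by (intro finite_subset[of S "{..N}"]) (auto simp: S_iff)
  have "0 \<in> S" using rL by (auto simp: S_iff intro: dvd_inI)
  have bS: "b = Max S" using j by (simp add: b hat_exponent_def S_def)
  then have "b \<in> S" using Max_in[OF fin] \<open>0 \<in> S\<close> by auto
  then obtain c where c: "c \<in> L" "?r = P i ^ b * c" by (auto simp: S_iff dvd_in_def)
  moreover have "\<not> dvd_in L (P i) c"
  proof
    assume "dvd_in L (P i) c"
    then obtain c' where "c' \<in> L" "c = P i * c'" by (auto simp: dvd_in_def)
    then have "Suc b \<in> S" using c by (auto simp: S_iff mult_ac intro: dvd_inI)
    then show False using Max_ge[OF fin] bS by force
  qed
  ultimately show ?thesis by blast
qed

text \<open>The hat monomial contains \<open>x1 i\<close> with exponent \<open>- b\<close>, that is,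
  the factor \<open>T ^ b / p ^ b\<close>, and \<open>b\<close> is exactly the order of the exchange
  polynomial along \<open>p\<close>. The powers of \<open>p\<close> cancel and only units of
  \<open>loc\<close> remain.\<close>

lemma hat_value_unit:
  assumes j: "j \<in> {1..n}" "j \<noteq> i"
  shows "unit_in loc (ev x1 (hat_poly n m x1 P1 j))"
proof -
  define b where "b = hat_exponent m x1 P1 j i"
  let ?d = "hat_shift n m x1 P1 j"
  let ?d' = "?d - single i (lookup ?d i)"
  have P1j: "P1 j \<in> L" using lp_seedD(2)[OF nm s1 j(1)] .
  have nonneg: "0 \<le> lookup e i" if "e \<in> keys (P1 j)" for e
    by (rule lp_seed_nonneg[OF nm s1 j(1) i that])
  obtain c where c: "c \<in> L" "lp_swap i (P i) (P1 j) = P i ^ b * c" "\<not> dvd_in L (P i) c"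
    using hat_exponent_order[OF j b_def] by blast
  have "ev x1 (P1 j) = p ^ b * ev z c"
  proof -
    have "ev x1 (P1 j) = ev z (P i ^ b * c)"
      using ev_x1_eq_ev_z_swap[OF P1j nonneg] c(2) by simp
    also have "\<dots> = ev z (P i ^ b) * ev z c"
      by (intro ev_mult[of _ "{1..m}"] z_nz c(1) is_subring_power is_subring_laurent_polys Pi(1))
    also have "ev z (P i ^ b) = p ^ b"
      using ev_power[of "P i" "{1..m}" z b] Pi(1) z_nz ev_z_Pi by simp
    finally show ?thesis .
  qed
  moreover have "laurent_monomial x1 ?d = x1 i powi (- int b) * laurent_monomial x1 ?d'"
    using laurent_monomial_upd[of x1 i "x1 i" ?d] i by (simp add: lookup_hat_shift b_def)
  moreover have "x1 i powi (- int b) = T ^ b / p ^ b"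
    by (simp add: x1_i power_int_minus power_divide)
  ultimately have eq: "ev x1 (hat_poly n m x1 P1 j) = ev z c * T ^ b * laurent_monomial x1 ?d'"
    using p_nz by (simp add: ev_hat_poly(1)[OF nm s1 j(1)])
  have "ev z c \<in> A" using c(1) laurent_ring_z by (auto simp: laurent_ring_def)
  moreover have "\<not> dvd_in A p (ev z c)"
    using dvd_in_laurent_ring_iff[OF indep_z Pi(1) c(1)] c(3) unfolding laurent_ring_z ev_z_Pi by simp
  ultimately have "unit_in loc (ev z c)" by (rule unit_in_localizationI[OF A_subring p_prime])
  moreover have "unit_in loc (laurent_monomial x1 ?d')"
  proof (intro unit_in_laurent_monomial loc_subring)
    fix k assume "k \<in> keys ?d'"
    then have "k \<in> {1..m}" "k \<noteq> i"
      using nm by (auto simp: in_keys_iff lookup_minus lookup_single lookup_hat_shift split: if_splits)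
    then show "unit_in loc (x1 k)" using x_unit unit_A_loc x1_other by simp
  qed
  ultimately show ?thesis
    unfolding eq by (intro unit_in_mult loc_subring unit_in_power unit_A_loc[OF T_unit])
qed

lemma x1_in_A: "k \<in> {1..m} \<Longrightarrow> x1 k \<in> A"
  using T_unit prime_inD(1)[OF p_prime] is_subringD(4)[OF A_subring] x1_other[of k] x_unit[of k]
  by (cases "k = i") (simp_all add: x1_i unit_in_field divide_inverse)

end

lemma power_cong_in:
  assumes B: "is_subring B" and "a \<in> B" "b \<in> B" "h \<in> B" "a = b + r * h" "r \<in> B"
  shows "\<exists>h'\<in>B. a ^ k = b ^ k + r * h'"
proof (induction k)
  case 0
  then show ?case using is_subring_zero[OF B] by (auto intro: bexI[of _ 0])
next
  case (Suc k)
  then obtain h' where h': "h' \<in> B" "a ^ k = b ^ k + r * h'" by blast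
  have "a ^ Suc k = b ^ Suc k + r * (b * h' + h * a ^ k)"
    using assms(5) h'(2) by (simp add: algebra_simps)
  moreover have "b * h' + h * a ^ k \<in> B"
    using assms h' by (intro is_subringD[OF B] is_subring_power[OF B]) auto
  ultimately show ?case by blast
qed

section \<open>Three mutations in directions i, j, i\<close>

locale mutation_triple = mutation_pair +
  fixes j :: nat and x2 x3 :: "nat \<Rightarrow> 'a" and P2 P3 :: "nat \<Rightarrow> int lpoly"
  assumes j: "j \<in> {1..n}" "j \<noteq> i"
    and s2: "lp_seed n m (x2, P2)"
    and mut2: "lp_mutation n m j (x1, P1) (x2, P2)"
    and mut3: "lp_mutation n m i (x2, P2) (x3, P3)"
begin

definition "H = hat_poly n m x1 P1 j"
definition "hp = ev x1 H"
text \<open>This is the value of the hat polynomial at 0 in the \<open>i\<close>-th variable, as it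
  enters the mutation rule. Being free of that variable, it has the same value in \<open>x\<close>
  and in \<open>x1\<close>.\<close>

definition "q = ev x (free_part i H)"
definition "t = inverse (x i)"

lemma jm: "j \<in> {1..m}" using j nm by auto

lemma H_in: "H \<in> L" unfolding H_def by (rule ev_hat_poly(2)[OF nm s1 j(1)])

lemma hp_unit: "unit_in loc hp" unfolding hp_def H_def by (rule hat_value_unit[OF j])

lemma hp_nz: "hp \<noteq> 0" using hp_unit by (simp add: unit_in_field)

lemma x2_j: "x2 j = hp / x j"
  using lp_mutation_var(2)[OF mut2] x1_other[OF jm j(2)] by (simp add: hp_def H_def)

lemma x2_other: "k \<in> {1..m} \<Longrightarrow> k \<noteq> j \<Longrightarrow> x2 k = x1 k"
  by (rule lp_mutation_var(1)[OF mut2])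

lemma x2_unit:
  assumes "k \<in> {1..m}" "k \<noteq> i"
  shows "unit_in loc (x2 k)"
proof (cases "k = j")
  case True
  then show ?thesis unfolding True x2_j
    by (intro unit_in_field_divide loc_subring hp_unit unit_A_loc x_unit jm)
next
  case False
  then show ?thesis using x2_other x1_other assms unit_A_loc[OF x_unit] by simp
qed

lemma ev_free_part: "ev x1 (free_part i H) = q"
  unfolding q_def by (intro ev_indep lp_part_in_laurent_polys H_in not_depends_on_free_part)

lemma q_in: "q \<in> A"
  using lp_part_in_laurent_polys[OF H_in] by (auto simp: q_def laurent_ring_def)

text \<open>The elements of \<open>A\<close> which are polynomial in \<open>t\<close>, the inverse of the \<open>i\<close>-th variable.\<close>

definition "Bf = {f \<in> L. \<forall>e\<in>keys f. lookup e i \<le> 0}"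
definition "B = ev x ` Bf"

lemma Bf_subring: "is_subring Bf"
proof -
  have L: "is_subring L" by (rule is_subring_laurent_polys)
  have "f + g \<in> Bf" if "f \<in> Bf" "g \<in> Bf" for f g
  proof -
    have "lookup e i \<le> 0" if "e \<in> keys (f + g)" for e
      using subsetD[OF keys_add that] \<open>f \<in> Bf\<close> \<open>g \<in> Bf\<close> by (auto simp: Bf_def)
    then show ?thesis using that is_subringD(3)[OF L] by (auto simp: Bf_def)
  qed
  moreover have "f * g \<in> Bf" if "f \<in> Bf" "g \<in> Bf" for f g
  proof -
    have "lookup e i \<le> 0" if e: "e \<in> keys (f * g)" for e
    proof -
      obtain a b where "e = a + b" "a \<in> keys f" "b \<in> keys g"
        using subsetD[OF keys_mult e] by blast
      then show ?thesis using \<open>f \<in> Bf\<close> \<open>g \<in> Bf\<close> by (force simp: Bf_def lookup_add intro: add_nonpos_nonpos)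
    qed
    then show ?thesis using that is_subringD(4)[OF L] by (auto simp: Bf_def)
  qed
  moreover have "1 \<in> Bf" using is_subringD(1)[OF L] by (auto simp: Bf_def)
  moreover have "- f \<in> Bf" if "f \<in> Bf" for f using that is_subringD(2)[OF L] by (auto simp: Bf_def)
  ultimately show ?thesis by (simp add: is_subring_def)
qed

lemma B_subring: "is_subring B"
  unfolding B_def by (rule is_subring_ev_image[OF Bf_subring, where S = "{1..m}"]) (auto simp: Bf_def x_nz)

lemma B_A: "B \<subseteq> A" by (auto simp: B_def Bf_def laurent_ring_def)

lemma B_evI: "f \<in> L \<Longrightarrow> \<not> depends_on f i \<Longrightarrow> ev x f \<in> B"
  by (force simp: B_def Bf_def depends_on_def)

lemma B_monomialI:
  assumes "keys e \<subseteq> {1..m}" "lookup e i \<le> 0"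
  shows "laurent_monomial x e \<in> B"
  unfolding B_def using assms
  by (intro image_eqI[of _ _ "single e 1"]) (auto simp: Bf_def laurent_polys_def)

lemma t_B: "t \<in> B"
  using B_monomialI[of "single i (- 1)"] im by (simp add: t_def power_int_minus)

lemma p_B: "p \<in> B" unfolding p_def by (rule B_evI[OF Pi(1,3)])

lemma q_B: "q \<in> B"
  unfolding q_def by (intro B_evI lp_part_in_laurent_polys H_in not_depends_on_free_part)

lemma x1_i_eq: "x1 i = p * t * laurent_monomial x (hat_shift n m x P i)"
  using shift_unit by (simp add: x1_i T_def t_def unit_in_field field_simps)

lemma shift_B: "laurent_monomial x (hat_shift n m x P i) \<in> B"
  by (intro B_monomialI keys_hat_shift_subset nm) simp

lemma x1_i_B: "x1 i \<in> B"
  unfolding x1_i_eq by (intro is_subringD(4)[OF B_subring] p_B t_B shift_B)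

lemma exponent_removed_B:
  assumes "keys e \<subseteq> {1..m}"
  shows "laurent_monomial x (e - single i (lookup e i)) \<in> B"
  using assms by (intro B_monomialI) (auto simp: in_keys_iff lookup_minus lookup_single when_def split: if_splits)

text \<open>A positive exponent makes \<open>P i\<close> divide the swapped polynomial, which is
  congruent to the free part modulo \<open>P i\<close>.\<close>

lemma free_part_dvd_if_hat_exponent:
  assumes "hat_exponent m x1 P1 j i \<noteq> 0"
  shows "dvd_in L (P i) (free_part i (P1 j))"
proof -
  obtain c where c: "c \<in> L" "lp_swap i (P i) (P1 j) = P i ^ hat_exponent m x1 P1 j i * c"
    using hat_exponent_order[OF j refl] by blast
  obtain b where "hat_exponent m x1 P1 j i = Suc b" using assms not0_implies_Suc by blast
  then have "dvd_in L (P i) (lp_swap i (P i) (P1 j))"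
    unfolding c(2) using c(1) Pi(1)
    by (intro dvd_inI[of "P i ^ b * c"] is_subringD(4) is_subring_power is_subring_laurent_polys) (auto simp: mult_ac)
  moreover have "dvd_in L (P i) (lp_swap i (P i) (P1 j) - free_part i (P1 j))"
    using lp_swap_cong_free_part[OF im Pi(1) lp_seedD(2)[OF nm s1 j(1)]] lp_seed_nonneg[OF nm s1 j(1) i] by blast
  ultimately show ?thesis
    using dvd_in_diff[OF is_subring_laurent_polys] by fastforce
qed

context
  assumes dep: "depends_on (P i) j"
begin

text \<open>Otherwise \<open>P i\<close> would divide the nonzero free part of \<open>P1 j\<close>.
  The latter is free of \<open>x j\<close>, and so then is its divisor \<open>P i\<close>, contrary
  to \<open>dep\<close>. The vanishing of the exponent is what gives substituting 0 for
  \<open>x1 i\<close> its usual meaning in the hat polynomial.\<close>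

lemma hat_exponent_0: "hat_exponent m x1 P1 j i = 0"
proof (rule ccontr)
  assume "hat_exponent m x1 P1 j i \<noteq> 0"
  then obtain c where c: "c \<in> L" "free_part i (P1 j) = P i * c"
    using free_part_dvd_if_hat_exponent by (auto simp: dvd_in_def)
  let ?f = "free_part i (P1 j)"
  have P1j0: "P1 j \<noteq> 0" using prime_inD(2)[OF lp_seedD(3)[OF nm s1 j(1)]] .
  obtain e where "e \<in> keys (P1 j)" "lookup e i = 0"
    using trop_attained[OF P1j0, of "\<lambda>e. lookup e i"] lp_seedD(4)[OF nm s1 j(1) i] by auto
  then have "?f \<noteq> 0" using keys_lp_part[of "\<lambda>e. lookup e i = 0" "P1 j"] by auto
  then have nz: "?f \<noteq> 0" "P i \<noteq> 0" "c \<noteq> 0" using c by auto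
  have no_j: "lookup e j = 0" if "e \<in> keys ?f" for e
    using lp_seedD(5)[OF nm s1 j(1)] that by (auto simp: depends_on_def keys_lp_part)
  then have "low j ?f = 0" "trop (\<lambda>e. - lookup e j) ?f = 0"
    using trop_attained[OF nz(1), of "\<lambda>e. lookup e j"]
      trop_attained[OF nz(1), of "\<lambda>e. - lookup e j"] by force+
  moreover have "low j ?f = low j (P i) + low j c"
    unfolding c(2) by (rule low_mult[OF nz(2,3)])
  \<comment> \<open>The opposite weight gives minus the degree in \<open>x j\<close>, so lowest and
    highest exponents are both additive on the product.\<close>
  moreover have "trop (\<lambda>e. - lookup e j) ?f =
      trop (\<lambda>e. - lookup e j) (P i) + trop (\<lambda>e. - lookup e j) c"
    unfolding c(2) by (rule trop_mult[OF _ nz(2,3)]) (simp add: lookup_add)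
  moreover have "low j (P i) = 0" by (rule lp_seedD(4)[OF nm s0 i j(1)])
  moreover have "trop (\<lambda>e. - lookup e j) c \<le> - low j c"
    using trop_attained[OF nz(3), of "\<lambda>e. lookup e j"] trop_le[of _ c "\<lambda>e. - lookup e j"] by force
  ultimately have "trop (\<lambda>e. - lookup e j) (P i) \<ge> 0" by linarith
  then have "lookup e j \<le> 0" if "e \<in> keys (P i)" for e
    using trop_le[OF that, of "\<lambda>e. - lookup e j"] by simp
  then show False
    using dep lp_seed_nonneg[OF nm s0 i j(1)] by (force simp: depends_on_def)
qed

lemma H_nonneg: "e \<in> keys H \<Longrightarrow> 0 \<le> lookup e i"
proof -
  assume "e \<in> keys H"
  then have "e - hat_shift n m x1 P1 j \<in> keys (P1 j)"
    by (simp add: H_def hat_poly_eq in_keys_iff lookup_mult_single)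
  from lp_seed_nonneg[OF nm s1 j(1) i this] show "0 \<le> lookup e i"
    using hat_exponent_0 by (simp add: lookup_minus lookup_hat_shift split: if_splits)
qed

text \<open>All terms of \<open>H\<close> outside the free part contain \<open>x1 i\<close>, which
  is \<open>p * t\<close> times a monomial free of \<open>x i\<close>. That the cofactor lies in
  \<open>B\<close>, and not merely in \<open>A\<close>, keeps the correction free of a constant term
  in \<open>t\<close>.\<close>

lemma hp_eq: "\<exists>h\<in>B. hp = q + (p * t) * h"
proof -
  let ?N = "\<lambda>e. lookup e i \<noteq> 0"
  have "\<exists>h\<in>B. of_int c * laurent_monomial x1 e = (p * t) * h"
    if e: "e \<in> keys (lp_part ?N H)" for e c
  proof -
    have eH: "e \<in> keys H" "lookup e i \<noteq> 0" using e by (auto simp: keys_lp_part)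
    then obtain k where k: "lookup e i = int (Suc k)"
      using H_nonneg[of e] by (metis int_nat_eq not0_implies_Suc of_nat_0)
    have ke: "keys e \<subseteq> {1..m}" using H_in eH by (auto simp: laurent_polys_def)
    let ?e = "e - single i (lookup e i)"
    have "laurent_monomial x1 ?e = laurent_monomial x ?e"
    proof (rule laurent_monomial_cong)
      fix l assume "l \<in> keys ?e"
      then have "l \<noteq> i" "l \<in> keys e"
        by (auto simp: in_keys_iff lookup_minus lookup_single when_def split: if_splits)
      then show "x1 l = x l" using ke x1_other by blast
    qed
    then have "laurent_monomial x1 e = x1 i ^ Suc k * laurent_monomial x ?e"
      using laurent_monomial_upd[of x1 i "x1 i" e] k by (simp add: power_int_add power_int_of_nat del: of_nat_Suc)
    also have "\<dots> = (p * t) * (laurent_monomial x (hat_shift n m x P i) * x1 i ^ k * laurent_monomial x ?e)"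
      by (simp add: x1_i_eq mult_ac)
    finally have "of_int c * laurent_monomial x1 e =
        (p * t) * (of_int c * (laurent_monomial x (hat_shift n m x P i) * x1 i ^ k * laurent_monomial x ?e))"
      by (simp add: mult_ac)
    moreover have "of_int c * (laurent_monomial x (hat_shift n m x P i) * x1 i ^ k * laurent_monomial x ?e) \<in> B"
      by (intro is_subringD(4)[OF B_subring] is_subring_of_int[OF B_subring] is_subring_power[OF B_subring]
          shift_B x1_i_B exponent_removed_B[OF ke])
    ultimately show ?thesis by blast
  qed
  then have "dvd_in B (p * t) (ev x1 (lp_part ?N H))"
    unfolding lp_eval_def by (intro dvd_in_sum[OF B_subring]) (auto simp: dvd_in_def)
  moreover have "hp = q + ev x1 (lp_part ?N H)"
    unfolding hp_def ev_free_part[symmetric] ev_add[symmetric] using lp_part_split by metis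
  ultimately show ?thesis by (auto simp: dvd_in_def)
qed

text \<open>Modulo \<open>p\<close>, \<open>q\<close> agrees with \<open>hp\<close>, which is a unit
  of the local ring.\<close>

lemma p_not_dvd_q: "\<not> dvd_in A p q"
proof
  assume q: "dvd_in A p q"
  obtain h where h: "h \<in> B" "hp = q + (p * t) * h" using hp_eq by blast
  have "t * h \<in> A" using is_subringD(4)[OF B_subring t_B h(1)] B_A by blast
  then have "dvd_in A p (p * t * h)" by (auto simp: mult.assoc intro: dvd_inI)
  then have "dvd_in A p hp" unfolding h(2) by (intro dvd_in_add[OF A_subring] q)
  moreover from this have "hp \<in> A"
    using prime_inD(1)[OF p_prime] is_subringD(4)[OF A_subring] by (auto simp: dvd_in_def)
  ultimately show False using unit_in_localizationD[OF A_subring p_prime _ hp_unit] by blast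
qed

lemma q_unit: "unit_in loc q"
  by (rule unit_in_localizationI[OF A_subring p_prime q_in p_not_dvd_q])

text \<open>Multiplying the value by \<open>hp ^ d\<close> clears its denominators and gives \<open>p\<close> times a polynomial
  in \<open>t\<close> whose constant term \<open>q ^ d\<close> is not divisible by \<open>p\<close>; as \<open>p\<close> is free of \<open>t\<close>, that
  polynomial is not divisible by \<open>p\<close> either.\<close>

lemma substituted_unit: "\<exists>u. unit_in loc u \<and> ev (x1(j := q / x2 j)) (P i) = p * u"
proof -
  let ?G = "ev (x1(j := q / x2 j)) (P i)"
  \<comment> \<open>A bound for the degree of \<open>P i\<close> in \<open>x j\<close>, so that
    \<open>hp ^ d\<close> clears all denominators \<open>hp\<close> brought in by the
    substitution.\<close>
  obtain d where d: "\<And>e. e \<in> keys (P i) \<Longrightarrow> nat (lookup e j) \<le> d"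
    using finite_nat_set_iff_bounded_le[of "(\<lambda>e. nat (lookup e j)) ` keys (P i)"] by auto
  obtain h where h: "h \<in> B" "hp = q + (p * t) * h" using hp_eq by blast
  have pt: "p * t \<in> B" using is_subringD(4)[OF B_subring p_B t_B] .
  have hpB: "hp \<in> B" unfolding h(2) by (intro is_subringD[OF B_subring] q_B pt h(1))
  \<comment> \<open>Here \<open>q / x2 j\<close> is \<open>x j * q / hp\<close>, so the power
    \<open>k\<close> of \<open>x j\<close> brings in the factor \<open>(q / hp) ^ k\<close>.
    Multiplied by \<open>hp ^ d\<close> it becomes \<open>q ^ k * hp ^ (d - k)\<close>, which is
    congruent to \<open>q ^ d\<close> modulo \<open>p * t\<close>, the same factor for every
    term.\<close>
  have term_eq: "\<exists>g\<in>B. of_int c * laurent_monomial (x1(j := q / x2 j)) e * hp ^ d =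
      of_int c * laurent_monomial x e * q ^ d + (p * t) * g"
    if e: "e \<in> keys (P i)" for e c
  proof -
    let ?e = "e - single j (lookup e j)"
    define k where "k = nat (lookup e j)"
    have k: "lookup e j = int k"
      using lp_seed_nonneg[OF nm s0 i j(1) e] by (simp add: k_def)
    have ke: "keys e \<subseteq> {1..m}" using Pi(1) e by (auto simp: laurent_polys_def)
    have ei: "lookup e i = 0" using Pi(3) e by (auto simp: depends_on_def)
    have xe: "laurent_monomial x1 ?e = laurent_monomial x ?e"
    proof (rule laurent_monomial_cong)
      fix l assume "l \<in> keys ?e"
      then have "l \<noteq> i" "l \<in> keys e"
        using ei j(2) by (auto simp: in_keys_iff lookup_minus lookup_single when_def split: if_splits)
      then show "x1 l = x l" using ke x1_other by blast
    qed
    have lx: "laurent_monomial x e = x j ^ k * laurent_monomial x ?e"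
      using laurent_monomial_upd[of x j "x j" e] k by simp
    have "laurent_monomial (x1(j := q / x2 j)) e = (q / x2 j) ^ k * laurent_monomial x ?e"
      by (simp add: laurent_monomial_upd k xe[unfolded k])
    also have "\<dots> * hp ^ k = q ^ k * laurent_monomial x e"
      using hp_nz x_nz[OF jm] by (simp add: lx x2_j power_divide power_mult_distrib)
    finally have *: "laurent_monomial (x1(j := q / x2 j)) e * hp ^ k = q ^ k * laurent_monomial x e" .
    obtain g where g: "g \<in> B" "hp ^ (d - k) = q ^ (d - k) + (p * t) * g"
      using power_cong_in[OF B_subring hpB q_B h(1) h(2) pt] by blast
    have kd: "k + (d - k) = d" using d[OF e] by (simp add: k_def)
    have "of_int c * laurent_monomial (x1(j := q / x2 j)) e * hp ^ d =
        of_int c * (laurent_monomial (x1(j := q / x2 j)) e * hp ^ k) * hp ^ (d - k)"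
      by (subst kd[symmetric], subst power_add) (simp add: mult_ac)
    also have "\<dots> = of_int c * laurent_monomial x e * q ^ (k + (d - k)) + (p * t) * (of_int c * laurent_monomial x e * q ^ k * g)"
      unfolding * g(2) power_add by (simp add: algebra_simps)
    finally have "of_int c * laurent_monomial (x1(j := q / x2 j)) e * hp ^ d =
      of_int c * laurent_monomial x e * q ^ d + (p * t) * (of_int c * laurent_monomial x e * q ^ k * g)"
      unfolding kd .
    moreover have "of_int c * laurent_monomial x e * q ^ k * g \<in> B"
      by (intro is_subringD(4)[OF B_subring] is_subring_of_int[OF B_subring] is_subring_power[OF B_subring] q_B g(1) B_monomialI ke)
         (simp add: ei)
    ultimately show ?thesis by blast
  qed
  have "dvd_in B (p * t) (\<Sum>e\<in>keys (P i).
      of_int (lookup (P i) e) * laurent_monomial (x1(j := q / x2 j)) e * hp ^ d -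
      of_int (lookup (P i) e) * laurent_monomial x e * q ^ d)"
  proof (intro dvd_in_sum[OF B_subring])
    fix e assume "e \<in> keys (P i)"
    from term_eq[OF this, of "lookup (P i) e"] show "dvd_in B (p * t)
      (of_int (lookup (P i) e) * laurent_monomial (x1(j := q / x2 j)) e * hp ^ d -
      of_int (lookup (P i) e) * laurent_monomial x e * q ^ d)"
      unfolding dvd_in_def by (metis add_diff_cancel_left')
  qed
  then have "dvd_in B (p * t) (?G * hp ^ d - p * q ^ d)"
    by (simp add: lp_eval_def[of _ _ "P i"] p_def sum_subtractf sum_distrib_right)
  then obtain w where w: "w \<in> B" "?G * hp ^ d = p * (q ^ d + t * w)"
    by (auto simp: dvd_in_def algebra_simps)
  define v where "v = q ^ d + t * w"
  have "v \<in> B"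
    unfolding v_def by (intro is_subringD(3,4)[OF B_subring] is_subring_power[OF B_subring] q_B t_B w(1))
  then have vA: "v \<in> A" using B_A by blast
  have "\<not> dvd_in A p v"
  proof
    assume "dvd_in A p v"
    then obtain g where g: "g \<in> L" "v = p * ev x g" by (auto simp: dvd_in_def laurent_ring_def)
    obtain f where f: "f \<in> Bf" "w = ev x f" using w(1) by (auto simp: B_def)
    let ?q = "free_part i H" and ?t = "single (single i (- 1)) 1 :: int lpoly"
    have qL: "?q \<in> L" by (rule lp_part_in_laurent_polys[OF H_in])
    have tL: "?t \<in> L" using im by (intro single_in_laurent_polys) (auto simp: lookup_single when_def)
    have fL: "f \<in> L" using f by (simp add: Bf_def)
    have tfL: "?t * f \<in> L" and qdL: "?q ^ d \<in> L"
      by (intro is_subringD(4) is_subring_power is_subring_laurent_polys tL fL qL)+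
    have "ev x (P i * g) = ev x (?q ^ d + ?t * f)"
      using g(2) ev_mult[OF Pi(1) g(1) x_nz] ev_mult[OF tL fL x_nz] ev_power[of ?q "{1..m}" x d] qL x_nz
      by (simp add: ev_add v_def f(2) p_def q_def t_def power_int_minus)
    then have eq: "P i * g = ?q ^ d + ?t * f"
      by (intro laurent_independentD(2)[OF indep] is_subringD(3,4) is_subring_laurent_polys Pi(1) g(1) qdL tfL)
    have "free_part i (?t * f) = 0"
    proof (rule lp_part_eq_0)
      fix e assume e: "e \<in> keys (?t * f)"
      then have "e - single i (- 1) \<in> keys f"
        by (subst (asm) mult.commute) (simp add: in_keys_iff lookup_mult_single)
      then show "lookup e i \<noteq> 0" using f(1) by (fastforce simp: Bf_def lookup_minus)
    qed
    moreover have "free_part i (?q ^ d) = ?q ^ d"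
      using depends_on_power[OF not_depends_on_free_part, of i H d] by (intro lp_part_id) (auto simp: depends_on_def)
    \<comment> \<open>This compares the constant terms in \<open>t\<close> of \<open>P i * g\<close>
      and of \<open>?q ^ d + ?t * f\<close>.\<close>
    ultimately have "P i * free_part i g = ?q ^ d"
      unfolding free_part_mult[OF Pi(3), symmetric] eq lp_part_add by simp
    then have "dvd_in L (P i) (?q ^ d)"
      using lp_part_in_laurent_polys[OF g(1)] by (metis dvd_inI)
    then have "dvd_in L (P i) ?q" by (rule prime_in_power[OF is_subring_laurent_polys Pi(2) qL])
    then have "dvd_in A p q"
      using dvd_in_laurent_ring_iff[OF indep Pi(1) qL] by (simp add: p_def q_def)
    then show False using p_not_dvd_q by blast
  qed
  then have "unit_in loc v" by (rule unit_in_localizationI[OF A_subring p_prime vA])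
  then have "unit_in loc (v / hp ^ d)"
    by (intro unit_in_field_divide loc_subring unit_in_power hp_unit)
  moreover have "?G = p * (v / hp ^ d)" using w(2) hp_nz by (simp add: v_def field_simps)
  ultimately show ?thesis by blast
qed

end

text \<open>Mutation keeps the order 1 along \<open>p\<close>. The divisor \<open>D\<close> of
  \<open>q\<close> is a unit of the local ring because \<open>q\<close> is, and the normalizing
  monomial could disturb the order only through \<open>x2 i\<close>, which it turns out not to
  contain.\<close>

lemma P2_i_value: "\<exists>u. unit_in loc u \<and> ev x2 (P2 i) = p * u"
proof (cases "depends_on (P i) j")
  case False
  then have "P2 i = P i" using lp_mutation_var(3)[OF mut2 i] P1_i by simp
  moreover have "ev x2 (P i) = ev x1 (P i)"
    using ev_upd_indep[OF False, of x1 "x2 j"] ev_cong[OF Pi(1), of "x1(j := x2 j)" x2] x2_other by simp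
  ultimately show ?thesis using ev_x1_Pi unit_in_one[OF loc_subring] by (intro exI[of _ 1]) simp
next
  case True
  let ?G = "ev (x1(j := q / x2 j)) (P i)"
  let ?S = "{1..m} - {i}"
  have Q: "q = ev (x1(i := 0)) (hat_poly n m x1 P1 j)"
    by (simp add: ev_upd_0 ev_free_part flip: H_def)
  obtain D e where De: "D \<in> laurent_ring ?S x2" "D gcdof\<^bsub>laurent_subring x2 ?S\<^esub> ?G q"
      "keys e \<subseteq> {1..n}" "ev x2 (P2 i) = laurent_monomial x2 e * (?G / D)"
    using lp_mutation_poly[OF mut2 i _ Q refl, unfolded P1_i, OF True] by blast
  obtain u where u: "unit_in loc u" "?G = p * u" using substituted_unit[OF True] by blast
  have sub: "laurent_ring ?S x2 \<subseteq> loc"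
    using x2_unit by (intro laurent_ring_least loc_subring) auto
  have D_dvd: "dvd_in (laurent_ring ?S x2) D q" "dvd_in (laurent_ring ?S x2) D ?G"
    using De(2) unfolding isgcd_def divides_laurent_subring laurent_ring_def by blast+
  obtain c where c: "c \<in> laurent_ring ?S x2" "q = D * c" using D_dvd(1) by (auto simp: dvd_in_def)
  obtain g where g: "g \<in> laurent_polys {} ?S" "?G = D * ev x2 g"
    using D_dvd(2) unfolding dvd_in_def laurent_ring_def by blast
  have D_unit: "unit_in loc D"
    using unit_in_left[OF loc_subring, of D c] De(1) c sub q_unit[OF True] by auto
  then have D0: "D \<noteq> 0" by (simp add: unit_in_field)
  have gL: "g \<in> L" using g(1) by (auto simp: laurent_polys_def)
  have indep2: "laurent_independent m x2" by (rule lp_seedD(1)[OF nm s2])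
  have eL: "single e 1 \<in> L" using De(3) nm by (auto simp: laurent_polys_def dest: subsetD)
  have "ev x2 (P2 i) = ev x2 (single e 1 * g)"
    using De(4) g(2) D0 ev_mult[OF eL gL laurent_independentD(1)[OF indep2]] by simp
  then have P2: "P2 i = single e 1 * g"
    by (intro laurent_independentD(2)[OF indep2] lp_seedD(2)[OF nm s2 i] is_subringD(4) is_subring_laurent_polys eL gL)
  have P20: "P2 i \<noteq> 0" using prime_inD(2)[OF lp_seedD(3)[OF nm s2 i]] .
  then have g0: "g \<noteq> 0" using P2 by auto
  \<comment> \<open>The quotient \<open>g\<close> of \<open>?G\<close> by \<open>D\<close> omits the
    \<open>i\<close>-th variable, since the greatest common divisor is taken in the Laurent ring
    without it. Comparing orders along this variable shows that the monomial omits it too.\<close>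
  have "low i (P2 i) = lookup e i + low i g"
    unfolding P2 using g0 low_mult[of "single e 1" g i] by (simp add: trop_single)
  moreover have "low i (P2 i) = 0" by (rule lp_seedD(4)[OF nm s2 i i])
  moreover have "low i g = 0"
    using trop_attained[OF g0, of "\<lambda>e. lookup e i"] g(1) by (auto simp: laurent_polys_iff in_keys_iff)
  ultimately have ei: "lookup e i = 0" by simp
  have "unit_in loc (laurent_monomial x2 e)"
  proof (intro unit_in_laurent_monomial loc_subring x2_unit)
    fix k assume k: "k \<in> keys e"
    then show "k \<in> {1..m}" using De(3) nm by auto
    show "k \<noteq> i" using k ei by (auto simp: in_keys_iff)
  qed
  then have "unit_in loc (laurent_monomial x2 e * (u / D))"
    by (intro unit_in_mult unit_in_field_divide loc_subring u(1) D_unit)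
  then show ?thesis using De(4) u(2) by (intro exI[of _ "laurent_monomial x2 e * (u / D)"]) simp
qed

text \<open>In direction \<open>i\<close> the new variable is a hat value divided by
  \<open>x2 i = x1 i = p / T\<close>; numerator and denominator contain \<open>p\<close> exactly
  once.\<close>

lemma x3_unit:
  assumes "k \<in> {1..m}"
  shows "unit_in loc (x3 k)"
proof (cases "k = i")
  case False
  then show ?thesis using lp_mutation_var(1)[OF mut3 assms] x2_unit[OF assms] by simp
next
  case True
  obtain u where u: "unit_in loc u" "ev x2 (P2 i) = p * u" using P2_i_value by blast
  have "x3 i = p * u * laurent_monomial x2 (hat_shift n m x2 P2 i) / (p / T)"
    using lp_mutation_var(2)[OF mut3] ev_hat_poly(1)[OF nm s2 i] u(2) x2_other[OF im] j(2) x1_i by auto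
  also have "\<dots> = u * laurent_monomial x2 (hat_shift n m x2 P2 i) * T"
    using p_nz by simp
  finally have "x3 i = u * laurent_monomial x2 (hat_shift n m x2 P2 i) * T" .
  moreover have "unit_in loc (laurent_monomial x2 (hat_shift n m x2 P2 i))"
    using keys_hat_shift[of n m x2 P2 i] nm by (intro unit_in_laurent_monomial loc_subring x2_unit) auto
  ultimately show ?thesis
    unfolding True using unit_in_mult[OF loc_subring] u(1) unit_A_loc[OF T_unit] by simp
qed

lemma laurent_step:
  assumes "y \<in> laurent_ring {1..m} x1" "y \<in> laurent_ring {1..m} x3"
  shows "y \<in> A"
proof -
  have "laurent_ring {1..m} x3 \<subseteq> loc"
    by (rule laurent_ring_least[OF loc_subring x3_unit])
  then have y_loc: "y \<in> loc" using assms(2) by blast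
  \<comment> \<open>\<open>C\<close> is \<open>A[1/p]\<close>, in which \<open>x1 i = p / T\<close>
    is invertible.\<close>
  define C where "C = {y. \<exists>k. p ^ k * y \<in> A}"
  have pA: "p ^ k \<in> A" for k by (rule is_subring_power[OF A_subring prime_inD(1)[OF p_prime]])
  have AC: "A \<subseteq> C" by (force simp: C_def intro: exI[of _ 0])
  have C: "is_subring C"
    unfolding is_subring_def
  proof (intro conjI ballI)
    show "1 \<in> C" using AC is_subringD(1)[OF A_subring] by blast
    fix a assume "a \<in> C"
    then obtain k where k: "p ^ k * a \<in> A" by (auto simp: C_def)
    show "- a \<in> C" using is_subringD(2)[OF A_subring k] by (auto simp: C_def intro: exI[of _ k])
    fix b assume "b \<in> C"
    then obtain l where l: "p ^ l * b \<in> A" by (auto simp: C_def)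
    have "p ^ (k + l) * (a + b) = p ^ l * (p ^ k * a) + p ^ k * (p ^ l * b)"
      "p ^ (k + l) * (a * b) = (p ^ k * a) * (p ^ l * b)"
      by (simp_all add: power_add algebra_simps)
    then show "a + b \<in> C" "a * b \<in> C"
      using k l pA is_subringD(3,4)[OF A_subring] unfolding C_def by (metis (mono_tags, lifting) mem_Collect_eq)+
  qed
  have "unit_in C (x1 k)" if k: "k \<in> {1..m}" for k
  proof (cases "k = i")
    case True
    have "inverse (x1 i) \<in> C"
      unfolding C_def using T_unit p_nz by (auto simp: x1_i unit_in_field intro!: exI[of _ 1])
    then show ?thesis unfolding True using x1_nz[OF im] x1_in_A[OF im] AC by (auto simp: unit_in_field)
  next
    case False
    then show ?thesis using x_unit[OF k] x1_other[OF k] AC by (auto simp: unit_in_field)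
  qed
  then have "laurent_ring {1..m} x1 \<subseteq> C" by (rule laurent_ring_least[OF C])
  then obtain k where "p ^ k * y \<in> A" using assms(1) by (auto simp: C_def)
  then show ?thesis by (rule in_ring_if_localization[OF A_subring p_prime y_loc])
qed

end

section \<open>The Laurent phenomenon\<close>

definition adjacency :: "nat \<Rightarrow> (nat list \<times> nat list) set" where
  "adjacency n = {(t, t'). \<exists>k\<in>{1..n}. tree_edge n k t t'}"

lemma adjacency_connected:
  assumes "t \<in> tree_vertices n" "t' \<in> tree_vertices n"
  shows "(t, t') \<in> (adjacency n)\<^sup>*"
proof -
  have root: "(t, []) \<in> (adjacency n)\<^sup>*" if "t \<in> tree_vertices n" for t
    using that
  proof (induction t)
    case (Cons k t)
    then have "t \<in> tree_vertices n" "k \<in> {1..n}" by (auto simp: tree_vertices_def successively_Cons)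
    then have "(k # t, t) \<in> adjacency n" using Cons.prems by (auto simp: adjacency_def tree_edge_def)
    then show ?case using Cons.IH[OF \<open>t \<in> tree_vertices n\<close>] by (rule converse_rtrancl_into_rtrancl)
  qed simp
  have "sym (adjacency n)" using tree_edge_sym by (auto simp: sym_def adjacency_def)
  then have "([], t') \<in> (adjacency n)\<^sup>*" using symD[OF sym_rtrancl] root[OF assms(2)] by metis
  with root[OF assms(1)] show ?thesis by (rule rtrancl_trans)
qed

text \<open>The target \<open>t\<close> is fixed and the base \<open>t0\<close> moves along the
  walk. The induction is on the length of an arbitrary walk, not on the distance in the tree: a walk
  that starts by backtracking returns to \<open>t0\<close> and is shortened by two edges.\<close>

theorem laurent_phenomenon:
  assumes nm: "n \<le> m" and pat: "lp_pattern n m \<Sigma>"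
    and "t0 \<in> tree_vertices n" "t \<in> tree_vertices n" "k \<in> {1..m}"
  shows "fst (\<Sigma> t) k \<in> laurent_ring {1..m} (fst (\<Sigma> t0))"
proof -
  have seed: "lp_seed n m (fst (\<Sigma> t), snd (\<Sigma> t))" if "t \<in> tree_vertices n" for t
    using pat that by (simp add: lp_pattern_def)
  have mut: "lp_mutation n m i (fst (\<Sigma> t), snd (\<Sigma> t)) (fst (\<Sigma> t'), snd (\<Sigma> t'))" if "i \<in> {1..n}" "tree_edge n i t t'" for i t t'
    using pat that by (simp add: lp_pattern_def)
  have edgeD: "t \<in> tree_vertices n" "t' \<in> tree_vertices n" if "tree_edge n i t t'" for i t t'
    using that by (auto simp: tree_edge_def)
  have pair: "mutation_pair n m i (fst (\<Sigma> t)) (fst (\<Sigma> t')) (snd (\<Sigma> t)) (snd (\<Sigma> t'))"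
    if "i \<in> {1..n}" "tree_edge n i t t'" for i t t'
    using mut[OF that] seed edgeD[OF that(2)] that(1) nm by unfold_locales auto
  obtain d where d: "(t0, t) \<in> adjacency n ^^ d"
    using adjacency_connected[OF assms(3,4)] rtrancl_power by blast
  from d assms(3) show ?thesis
  proof (induction d arbitrary: t0 rule: less_induct)
    case (less d)
    consider "d = 0" | "d = 1" | e where "d = Suc (Suc e)"
      by (metis One_nat_def not0_implies_Suc)
    then show ?case
    proof cases
      case 1
      then have "t = t0" using less.prems by simp
      then show ?thesis
        using unit_in_laurent_ring_var[OF \<open>k \<in> {1..m}\<close>, of "fst (\<Sigma> t0)"]
          laurent_independentD(1)[OF lp_seedD(1)[OF nm seed[OF less.prems(2)]]]
        by (simp add: unit_in_field)
    next
      case 2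
      then obtain i where i: "i \<in> {1..n}" "tree_edge n i t0 t" using less.prems by (auto simp: adjacency_def)
      show ?thesis by (rule mutation_pair.x1_in_A[OF pair[OF i] \<open>k \<in> {1..m}\<close>])
    next
      case 3
      then have "(t0, t) \<in> adjacency n O (adjacency n O adjacency n ^^ e)"
        using less.prems(1) by (simp only: relpow_commute[symmetric] relpow.simps O_assoc)
      then obtain t1 t2 where t12: "(t0, t1) \<in> adjacency n" "(t1, t2) \<in> adjacency n" "(t2, t) \<in> adjacency n ^^ e"
        by blast
      obtain i j where i: "i \<in> {1..n}" "tree_edge n i t0 t1" and j: "j \<in> {1..n}" "tree_edge n j t1 t2"
        using t12(1,2) by (auto simp: adjacency_def)
      note V = edgeD[OF i(2)] edgeD[OF j(2)]
      show ?thesis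
      proof (cases "j = i")
        case True
        then have "t2 = t0"
          using tree_edge_unique[OF V(2) i(1)] i(2) j(2) tree_edge_sym by blast
        then show ?thesis using less.IH[of e t0] t12(3) 3 V by simp
      next
        case False
        obtain t3 where t3: "tree_edge n i t2 t3" using tree_edge_unique[OF V(4) i(1)] by blast
        have tr: "mutation_triple n m i (fst (\<Sigma> t0)) (fst (\<Sigma> t1)) (snd (\<Sigma> t0)) (snd (\<Sigma> t1))
            j (fst (\<Sigma> t2)) (fst (\<Sigma> t3)) (snd (\<Sigma> t2)) (snd (\<Sigma> t3))"
          unfolding mutation_triple_def mutation_triple_axioms_def
          using pair[OF i] j False seed[OF V(4)] mut[OF j] mut[OF i(1) t3] by blast
        \<comment> \<open>The fourth seed \<open>t3\<close> need not lie on the walk; going back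
          through \<open>t2\<close> it reaches \<open>t\<close> in \<open>Suc e\<close> steps, as
          many as \<open>t1\<close> and one fewer than \<open>t0\<close>.\<close>
        have "(t3, t2) \<in> adjacency n" using t3 i(1) tree_edge_sym by (auto simp: adjacency_def)
        then have "(t1, t) \<in> adjacency n ^^ Suc e" "(t3, t) \<in> adjacency n ^^ Suc e"
          using t12(2,3) by (auto simp only: relpow_Suc_I2)
        then have "fst (\<Sigma> t) k \<in> laurent_ring {1..m} (fst (\<Sigma> t1))" "fst (\<Sigma> t) k \<in> laurent_ring {1..m} (fst (\<Sigma> t3))"
          using less.IH[of "Suc e"] 3 V edgeD[OF t3] by auto
        then show ?thesis by (rule mutation_triple.laurent_step[OF tr])
      qed
    qed
  qed
qed

section \<open>Positivity and tropical values\<close>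

definition nonneg_poly :: "int lpoly \<Rightarrow> bool" where
  "nonneg_poly f \<longleftrightarrow> f \<noteq> 0 \<and> (\<forall>e. 0 \<le> lookup f e)"

lemma nonneg_poly_single: "c > 0 \<Longrightarrow> nonneg_poly (single e c)"
  by (auto simp: nonneg_poly_def lookup_single when_def dest: arg_cong[where f = "\<lambda>p. lookup p e"])

lemma nonneg_poly_mult:
  assumes "nonneg_poly f" "nonneg_poly g"
  shows "nonneg_poly (f * g)"
proof -
  have "0 \<le> lookup (f * g) e" for e
  proof -
    have "f * g = f * (\<Sum>a\<in>keys g. single a (lookup g a))"
      using poly_mapping_sum_single[of g] by simp
    also have "lookup \<dots> e = (\<Sum>a\<in>keys g. lookup f (e - a) * lookup g a)"
      by (simp add: sum_distrib_left lookup_sum lookup_mult_single)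
    also have "\<dots> \<ge> 0" using assms by (intro sum_nonneg mult_nonneg_nonneg) (auto simp: nonneg_poly_def)
    finally show ?thesis .
  qed
  then show ?thesis using assms by (simp add: nonneg_poly_def)
qed

text \<open>Nonnegative coefficients cannot cancel, so the support of the sum is the union of the
  supports.\<close>

lemma nonneg_poly_add:
  assumes "nonneg_poly f" "nonneg_poly g"
  shows "nonneg_poly (f + g)" "trop w (f + g) = min (trop w f) (trop w g)"
proof -
  have k: "keys (f + g) = keys f \<union> keys g"
    using assms by (auto simp: in_keys_iff lookup_add nonneg_poly_def add_nonneg_eq_0_iff)
  have ne: "keys f \<noteq> {}" "keys g \<noteq> {}" using assms by (auto simp: nonneg_poly_def)
  then show "nonneg_poly (f + g)" using assms k by (auto simp: nonneg_poly_def lookup_add simp flip: keys_eq_empty)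
  show "trop w (f + g) = min (trop w f) (trop w g)"
    unfolding trop_def k image_Un by (rule Min_Un) (use ne in auto)
qed

text \<open>On quotients of polynomials with nonnegative coefficients \<open>trop w\<close> is a homomorphism to
  the tropical semifield.\<close>

definition trop_value :: "nat \<Rightarrow> (nat \<Rightarrow> 'f::field_char_0) \<Rightarrow> ((nat \<Rightarrow>\<^sub>0 int) \<Rightarrow> int) \<Rightarrow> 'f \<Rightarrow> int \<Rightarrow> bool" where
  "trop_value m z w u k \<longleftrightarrow> (\<exists>f\<in>laurent_polys {} {1..m}. \<exists>g\<in>laurent_polys {} {1..m}.
     nonneg_poly f \<and> nonneg_poly g \<and> u = ev z f / ev z g \<and> k = trop w f - trop w g)"

context
  fixes m :: nat and z :: "nat \<Rightarrow> 'f::field_char_0" and w :: "(nat \<Rightarrow>\<^sub>0 int) \<Rightarrow> int"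
  assumes z: "laurent_independent m z" and w: "\<And>a b. w (a + b) = w a + w b"
begin

lemma ev_nonzero: "f \<in> laurent_polys {} {1..m} \<Longrightarrow> nonneg_poly f \<Longrightarrow> ev z f \<noteq> 0"
  using z by (auto simp: laurent_independent_def nonneg_poly_def)

lemma ev_times: "f \<in> laurent_polys {} {1..m} \<Longrightarrow> g \<in> laurent_polys {} {1..m} \<Longrightarrow> ev z (f * g) = ev z f * ev z g"
  by (rule ev_mult[OF _ _ laurent_independentD(1)[OF z]])

lemma trop_times: "nonneg_poly f \<Longrightarrow> nonneg_poly g \<Longrightarrow> trop w (f * g) = trop w f + trop w g"
  using trop_mult[OF w] by (auto simp: nonneg_poly_def)

lemma laurent_polys_times: "f \<in> laurent_polys {} {1..m} \<Longrightarrow> g \<in> laurent_polys {} {1..m} \<Longrightarrow> f * g \<in> (laurent_polys {} {1..m} :: int lpoly set)"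
  by (rule is_subringD(4)[OF is_subring_laurent_polys])

lemma trop_value_mult:
  assumes "trop_value m z w u k" "trop_value m z w v l"
  shows "trop_value m z w (u * v) (k + l)"
proof -
  obtain f g f' g' where "f \<in> laurent_polys {} {1..m}" "g \<in> laurent_polys {} {1..m}" "nonneg_poly f" "nonneg_poly g"
      "u = ev z f / ev z g" "k = trop w f - trop w g"
      "f' \<in> laurent_polys {} {1..m}" "g' \<in> laurent_polys {} {1..m}" "nonneg_poly f'" "nonneg_poly g'"
      "v = ev z f' / ev z g'" "l = trop w f' - trop w g'"
    using assms unfolding trop_value_def by blast
  then show ?thesis unfolding trop_value_def
    by (intro bexI[of _ "f * f'"] bexI[of _ "g * g'"] conjI laurent_polys_times nonneg_poly_mult)
       (simp_all add: ev_times trop_times)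
qed

lemma trop_value_inverse:
  assumes "trop_value m z w u k"
  shows "trop_value m z w (inverse u) (- k)"
proof -
  obtain f g where "f \<in> laurent_polys {} {1..m}" "g \<in> laurent_polys {} {1..m}" "nonneg_poly f" "nonneg_poly g"
      "u = ev z f / ev z g" "k = trop w f - trop w g"
    using assms unfolding trop_value_def by blast
  then show ?thesis unfolding trop_value_def
    by (intro bexI[of _ g] bexI[of _ f]) simp_all
qed

lemma trop_value_add:
  assumes "trop_value m z w u k" "trop_value m z w v l"
  shows "trop_value m z w (u + v) (min k l)"
proof -
  obtain f g f' g' where *: "f \<in> laurent_polys {} {1..m}" "g \<in> laurent_polys {} {1..m}" "nonneg_poly f" "nonneg_poly g"
      "u = ev z f / ev z g" "k = trop w f - trop w g"
      "f' \<in> laurent_polys {} {1..m}" "g' \<in> laurent_polys {} {1..m}" "nonneg_poly f'" "nonneg_poly g'"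
      "v = ev z f' / ev z g'" "l = trop w f' - trop w g'"
    using assms unfolding trop_value_def by blast
  have nn: "nonneg_poly (f * g')" "nonneg_poly (f' * g)" "nonneg_poly (g * g')"
    using * nonneg_poly_mult by blast+
  show ?thesis unfolding trop_value_def
  proof (rule bexI[of _ "f * g' + f' * g"], rule bexI[of _ "g * g'"], intro conjI)
    show "nonneg_poly (f * g' + f' * g)" by (rule nonneg_poly_add(1)[OF nn(1,2)])
    show "u + v = ev z (f * g' + f' * g) / ev z (g * g')"
      using * ev_nonzero by (simp add: ev_add ev_times add_frac_eq)
    show "min k l = trop w (f * g' + f' * g) - trop w (g * g')"
      using * by (simp add: nonneg_poly_add(2)[OF nn(1,2)] trop_times)
    show "f * g' + f' * g \<in> laurent_polys {} {1..m}"
      using * by (intro is_subringD(3)[OF is_subring_laurent_polys] laurent_polys_times)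
  qed (use * nn laurent_polys_times in auto)
qed

lemma trop_value_single:
  assumes "c > 0" "keys e \<subseteq> {1..m}"
  shows "trop_value m z w (of_int c * laurent_monomial z e) (w e)"
proof -
  have "w 0 = 0" using w[of 0 0] by simp
  then have "trop w (1 :: int lpoly) = 0" using trop_single[of "1::int" w 0] by simp
  moreover have "nonneg_poly 1" "nonneg_poly (single e c)"
    using nonneg_poly_single[of 1 0] nonneg_poly_single[OF assms(1)] by simp_all
  ultimately show ?thesis unfolding trop_value_def
    using assms is_subringD(1)[OF is_subring_laurent_polys]
    by (intro bexI[of _ "single e c"] bexI[of _ 1]) (auto simp: trop_single laurent_polys_def)
qed

lemma trop_value_of_int: "c > 0 \<Longrightarrow> trop_value m z w (of_int c) 0"
  using trop_value_single[of c 0] w[of 0 0] by simp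

lemma trop_value_power: "trop_value m z w u k \<Longrightarrow> trop_value m z w (u ^ n) (int n * k)"
proof (induction n)
  case 0
  then show ?case using trop_value_of_int[of 1] by simp
next
  case (Suc n)
  then show ?case using trop_value_mult[of u k "u ^ n" "int n * k"] by (simp add: algebra_simps)
qed

lemma trop_value_powi: "trop_value m z w u k \<Longrightarrow> trop_value m z w (u powi n) (n * k)"
  using trop_value_power[of u k "nat n"] trop_value_power[OF trop_value_inverse, of u k "nat (- n)"]
  by (cases "0 \<le> n") (auto simp: power_int_def)

lemma trop_value_prod:
  "finite I \<Longrightarrow> (\<And>i. i \<in> I \<Longrightarrow> trop_value m z w (u i) (k i)) \<Longrightarrow> trop_value m z w (prod u I) (sum k I)"
proof (induction I rule: finite_induct)
  case empty
  then show ?case using trop_value_of_int[of 1] by simp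
qed (auto intro: trop_value_mult)

text \<open>Two fractions for the same element are compared by cross-multiplication. Minimal weights
  are multiplicative for coefficients of any sign, so \<open>f / g\<close> may be an arbitrary
  fraction; in particular tropical values are unique.\<close>

lemma trop_value_eq:
  assumes f: "f \<in> laurent_polys {} {1..m}" "g \<in> laurent_polys {} {1..m}" "f \<noteq> 0" "g \<noteq> 0"
    and u: "u = ev z f / ev z g" "trop_value m z w u k"
  shows "k = trop w f - trop w g"
proof -
  obtain f' g' where *: "f' \<in> laurent_polys {} {1..m}" "g' \<in> laurent_polys {} {1..m}" "nonneg_poly f'" "nonneg_poly g'"
      "u = ev z f' / ev z g'" "k = trop w f' - trop w g'"
    using u(2) unfolding trop_value_def by blast
  have nz: "ev z g \<noteq> 0" "ev z g' \<noteq> 0" using f z ev_nonzero[OF *(2,4)] by (auto simp: laurent_independent_def)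
  have "ev z (f * g') = ev z (f' * g)"
    using u(1) *(5) nz by (simp add: ev_times[OF f(1) *(2)] ev_times[OF *(1) f(2)] frac_eq_eq)
  then have "f * g' = f' * g"
    by (rule laurent_independentD(2)[OF z laurent_polys_times[OF f(1) *(2)] laurent_polys_times[OF *(1) f(2)]])
  then have "trop w f + trop w g' = trop w f' + trop w g"
    using trop_mult[of w f g'] trop_mult[of w f' g] f * w by (simp add: nonneg_poly_def)
  then show ?thesis using *(6) by simp
qed

text \<open>A homomorphism to the tropical semifield is determined on subtraction-free expressions
  by its values \<open>b\<close> at the variables. So a weight in \<open>z\<close> induces a weight
  in \<open>x\<close>, namely the linear form with coefficients \<open>b\<close>.\<close>

lemma trop_value_subst:
  assumes b: "\<And>i. i \<in> {1..m} \<Longrightarrow> trop_value m z w (x i) (b i)"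
    and f: "f \<in> laurent_polys {} {1..m}" "nonneg_poly f"
  shows "trop_value m z w (ev x f) (trop (\<lambda>e. \<Sum>i\<in>{1..m}. lookup e i * b i) f)"
proof -
  let ?v = "\<lambda>e. \<Sum>i\<in>{1..m}. lookup e i * b i"
  have mono: "trop_value m z w (laurent_monomial x e) (?v e)" if "keys e \<subseteq> {1..m}" for e
    unfolding laurent_monomial_superset[OF finite_atLeastAtMost that]
    by (intro trop_value_prod trop_value_powi b) auto
  have "trop_value m z w (\<Sum>e\<in>E. of_int (lookup f e) * laurent_monomial x e) (Min (?v ` E))"
    if "finite E" "E \<noteq> {}" "E \<subseteq> keys f" for E
    using that
  proof (induction E rule: finite_ne_induct)
    case (singleton e)
    then have "0 < lookup f e" "keys e \<subseteq> {1..m}"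
      using f by (auto simp: nonneg_poly_def in_keys_iff laurent_polys_def order.strict_iff_order)
    then show ?case using trop_value_mult[OF trop_value_of_int mono] by force
  next
    case (insert e E)
    then have "0 < lookup f e" "keys e \<subseteq> {1..m}"
      using f by (auto simp: nonneg_poly_def in_keys_iff laurent_polys_def order.strict_iff_order)
    then have "trop_value m z w (of_int (lookup f e) * laurent_monomial x e) (?v e)"
      using trop_value_mult[OF trop_value_of_int mono] by force
    then show ?case using trop_value_add insert by simp
  qed
  then show ?thesis using f(2) unfolding lp_eval_def trop_def by (auto simp: nonneg_poly_def)
qed

end

text \<open>With equal semifields this gives the variables of one cluster a tropical value with
  respect to any other.\<close>

lemma Q_sf_trop_value:
  assumes "u \<in> Q_sf m x"
  shows "\<exists>k. trop_value m x w u k"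
proof -
  obtain F G :: "nat lpoly" where FG: "F \<in> laurent_polys {1..m} {}" "G \<in> laurent_polys {1..m} {}" "F \<noteq> 0" "G \<noteq> 0"
      "u = lp_eval of_nat x F / lp_eval of_nat x G"
    using assms by (auto simp: Q_sf_def)
  define h where "h = (Poly_Mapping.map int :: nat lpoly \<Rightarrow> int lpoly)"
  have look: "lookup (h f) e = int (lookup f e)" for f e
    by (auto simp: h_def map.rep_eq when_def)
  have keys: "keys (h f) = keys f" for f by (auto simp: in_keys_iff look)
  have "lp_eval of_nat x f = ev x (h f)" for f by (simp add: lp_eval_def keys look)
  moreover have "nonneg_poly (h f)" if "f \<noteq> 0" for f
  proof -
    obtain e where "e \<in> keys f" using \<open>f \<noteq> 0\<close> by (metis poly_mapping_eqI in_keys_iff lookup_zero)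
    then have "h f \<noteq> 0" using keys[of f] by auto
    then show ?thesis by (simp add: nonneg_poly_def look)
  qed
  moreover have "h f \<in> laurent_polys {} {1..m}" if "f \<in> laurent_polys {1..m} {}" for f
    using that by (auto simp: laurent_polys_def keys)
  ultimately show ?thesis unfolding trop_value_def using FG by (metis (no_types, lifting))
qed

lemma var_in_Q_sf:
  assumes "k \<in> {1..m}"
  shows "x k \<in> Q_sf m x"
proof -
  have "x k = lp_eval of_nat x (lvar k :: nat lpoly) / lp_eval of_nat x (1 :: nat lpoly)"
    by (simp add: lp_eval_def lvar_def)
  moreover have "(lvar k :: nat lpoly) \<in> laurent_polys {1..m} {}" "(1 :: nat lpoly) \<in> laurent_polys {1..m} {}"
    using assms by (auto simp: laurent_polys_def lvar_def lookup_single when_def)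
  moreover have "(lvar k :: nat lpoly) \<noteq> 0"
    unfolding lvar_def by (metis lookup_single_eq lookup_zero one_neq_zero)
  ultimately show ?thesis unfolding Q_sf_def using one_neq_zero by blast
qed

text \<open>If the nonnegative exponent \<open>v\<close> occurs in the expansion of \<open>z\<^sup>h\<close> in \<open>x\<close>, then every tropical
  point takes a value at \<open>x\<^sup>v\<close> that is at least its value at \<open>z\<^sup>h\<close>; so the Newton polytope of the
  Laurent expansion of \<open>x\<^sup>v\<close> in \<open>z\<close> is the single point \<open>h\<close>.\<close>

lemma nonproper_exponent_imp_monomial:
  assumes x: "laurent_independent m x" and z: "laurent_independent m z" and sf: "Q_sf m x = Q_sf m z"
    and h: "keys h \<subseteq> {1..m}" and f: "f \<in> laurent_polys {} {1..m}" "ev x f = laurent_monomial z h"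
    and v: "v \<in> keys f" and g: "g \<in> laurent_polys {} {1..m}" "ev z g = laurent_monomial x v"
  shows "f = single v 1"
proof -
  have kv: "keys v \<subseteq> {1..m}" using f(1) v by (auto simp: laurent_polys_def)
  have f0: "f \<noteq> 0" using v by auto
  have "laurent_monomial x v \<noteq> 0" by (rule laurent_monomial_nonzero) (use kv laurent_independentD(1)[OF x] in auto)
  then have g0: "g \<noteq> 0" using g by auto
  \<comment> \<open>The zero weight is a placeholder: the tropical values are discarded, and what is
    kept is an expression of the monomial in \<open>z\<close> as a fraction \<open>A / B\<close> of
    nonnegative Laurent polynomials in \<open>x\<close>.\<close>
  let ?w0 = "\<lambda>_ :: nat \<Rightarrow>\<^sub>0 int. 0 :: int"
  have "\<exists>b. \<forall>i\<in>{1..m}. trop_value m x ?w0 (z i) (b i)"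
    using Q_sf_trop_value var_in_Q_sf[of _ m z] unfolding sf[symmetric] by (intro bchoice ballI) blast
  then obtain b where b: "\<And>i. i \<in> {1..m} \<Longrightarrow> trop_value m x ?w0 (z i) (b i)" by blast
  have zL: "single h 1 \<in> (laurent_polys {} {1..m} :: int lpoly set)"
    and xL: "single v 1 \<in> (laurent_polys {} {1..m} :: int lpoly set)"
    using h kv by (simp_all add: laurent_polys_def)
  have "trop_value m x ?w0 (ev z (single h 1))
      (trop (\<lambda>e. \<Sum>i\<in>{1..m}. lookup e i * b i) (single h 1 :: int lpoly))"
    by (rule trop_value_subst[OF x _ b zL]) (simp_all add: nonneg_poly_single)
  then obtain A B where AB: "A \<in> laurent_polys {} {1..m}" "B \<in> laurent_polys {} {1..m}" "nonneg_poly A" "nonneg_poly B"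
      "laurent_monomial z h = ev x A / ev x B"
    unfolding trop_value_def by auto
  have B0: "ev x B \<noteq> 0" using x AB(2,4) by (auto simp: laurent_independent_def nonneg_poly_def)
  have "ev x (f * B) = ev x A"
    using AB(5) B0 f(2) ev_mult[OF f(1) AB(2) laurent_independentD(1)[OF x]] by simp
  \<comment> \<open>The coefficients of \<open>f\<close> may have any sign. Its minimal weight is
    obtained from those of \<open>A\<close> and \<open>B\<close> through this equation.\<close>
  then have fB: "f * B = A"
    by (rule laurent_independentD(2)[OF x is_subringD(4)[OF is_subring_laurent_polys f(1) AB(2)] AB(1)])
  \<comment> \<open>Let \<open>?v\<close> be the weight on exponents of \<open>x\<close> induced by
    \<open>w\<close>. Then \<open>w h\<close> is the minimal weight \<open>trop ?v f\<close>, hence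
    at most \<open>?v v\<close>, and this is \<open>trop w g\<close>, which is at most
    \<open>w e\<close>.\<close>
  have key: "w h \<le> w e" if w: "\<And>a b. w (a + b) = w a + w b" and e: "e \<in> keys g"
    for w :: "(nat \<Rightarrow>\<^sub>0 int) \<Rightarrow> int" and e
  proof -
    have "\<exists>b. \<forall>i\<in>{1..m}. trop_value m z w (x i) (b i)"
      using Q_sf_trop_value var_in_Q_sf[of _ m x] unfolding sf by (intro bchoice ballI) blast
    then obtain b where b: "\<And>i. i \<in> {1..m} \<Longrightarrow> trop_value m z w (x i) (b i)" by blast
    let ?v = "\<lambda>e. \<Sum>i\<in>{1..m}. lookup e i * b i"
    have vadd: "?v (a + c) = ?v a + ?v c" for a c by (simp add: lookup_add ring_distribs sum.distrib)
    have subst: "trop_value m z w (ev x f) (trop ?v f)" if "f \<in> laurent_polys {} {1..m}" "nonneg_poly f" for f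
      by (rule trop_value_subst[OF z w b that])
    have zh: "trop_value m z w (laurent_monomial z h) (trop ?v A - trop ?v B)"
      using trop_value_mult[OF z w subst[OF AB(1,3)] trop_value_inverse[OF z w subst[OF AB(2,4)]]]
      by (simp add: AB(5) divide_inverse)
    have "trop ?v A - trop ?v B = trop w (single h (1::int)) - trop w (1 :: int lpoly)"
    proof (rule trop_value_eq[OF z w zL is_subringD(1)[OF is_subring_laurent_polys] _ _ _ zh])
      show "single h (1::int) \<noteq> 0" using nonneg_poly_single[of 1 h] by (simp add: nonneg_poly_def)
    qed simp_all
    also have "\<dots> = w h" using trop_single[of "1::int" w h] trop_single[of "1::int" w 0] w[of 0 0] by simp
    finally have "w h = trop ?v A - trop ?v B" by simp
    also have "\<dots> = trop ?v f"
      using trop_mult[of ?v f B] vadd f0 AB(4) fB by (simp add: nonneg_poly_def)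
    also have "\<dots> \<le> ?v v" by (rule trop_le[OF v])
    also have "?v v = trop w g - trop w (1 :: int lpoly)"
    proof (rule trop_value_eq[OF z w g(1) is_subringD(1)[OF is_subring_laurent_polys] g0])
      show "trop_value m z w (laurent_monomial x v) (?v v)"
        using subst[OF xL] by (simp add: nonneg_poly_single trop_single)
    qed (simp_all add: g(2))
    also have "\<dots> = trop w g" using trop_single[of "1::int" w 0] w[of 0 0] by simp
    also have "\<dots> \<le> w e" by (rule trop_le[OF e])
    finally show ?thesis .
  qed
  \<comment> \<open>Coordinates and their negatives are both additive weights, so all inequalities
    become equalities.\<close>
  have kg: "e = h" if "e \<in> keys g" for e
  proof (rule poly_mapping_eqI)
    fix i
    show "lookup e i = lookup h i"
      using key[of "\<lambda>e. lookup e i" e] key[of "\<lambda>e. - lookup e i" e] that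
      by (simp add: lookup_add)
  qed
  define c where "c = lookup g h"
  have "g = single h c"
    by (rule poly_mapping_eqI) (use kg in \<open>auto simp: c_def lookup_single when_def in_keys_iff\<close>)
  moreover have "ev x (f * single 0 c) = ev x f * ev x (single 0 c)"
    by (rule ev_mult[OF f(1) single_in_laurent_polys laurent_independentD(1)[OF x]]) auto
  ultimately have "ev x (single v 1) = ev x (f * single 0 c)"
    using g(2) f(2) by (simp add: mult.commute)
  then have eq: "single v 1 = f * single 0 c"
    by (intro laurent_independentD(2)[OF x] xL is_subringD(4) is_subring_laurent_polys f(1) single_in_laurent_polys)
       simp_all
  have look: "lookup f e * c = (if e = v then 1 else 0)" for e
    using arg_cong[OF eq, of "\<lambda>f. lookup f e"] by (auto simp: lookup_mult_single lookup_single when_def)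
  define c' where "c' = lookup f v"
  have cc: "c' * c = 1" using look[of v] by (simp add: c'_def)
  have "lookup f e = 0" if "e \<noteq> v" for e using look[of e] that cc by auto
  then have fs: "f = single v c'"
    by (intro poly_mapping_eqI) (auto simp: c'_def lookup_single when_def)
  obtain e where e: "e \<in> keys A" using AB(3) by (metis nonneg_poly_def poly_mapping_eqI in_keys_iff lookup_zero)
  \<comment> \<open>The two integers satisfy \<open>c' * c = 1\<close>, which leaves a sign; it is
    fixed by the nonnegative coefficients of \<open>A\<close> and \<open>B\<close>.\<close>
  have "lookup A e = lookup B (e - v) * c'"
    unfolding fB[symmetric] fs by (subst mult.commute) (simp add: lookup_mult_single)
  moreover have "0 < lookup A e" "0 \<le> lookup B (e - v)"
    using AB(3,4) e by (auto simp: nonneg_poly_def in_keys_iff order.strict_iff_order)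
  ultimately have "0 < c'" by (metis zero_less_mult_pos2 mult_nonneg_nonpos not_less)
  then have "c' = 1" using cc by (metis pos_zmult_eq_1_iff)
  then show ?thesis using fs by simp
qed


section \<open>Cluster monomials: proper expansions and linear independence\<close>

lemma monomial_eq:
  "(\<Prod>i\<in>{1..m}. x i ^ h i) = laurent_monomial x (\<Sum>i\<in>{1..m}. single i (int (h i)))" (is "_ = laurent_monomial x ?e")
proof -
  have look: "lookup ?e i = (if i \<in> {1..m} then int (h i) else 0)" for i
    by (rule lookup_sum_single) simp
  then have "keys ?e \<subseteq> {1..m}" by (auto simp: in_keys_iff split: if_splits)
  from laurent_monomial_superset[OF finite_atLeastAtMost this, of x] show ?thesis
    unfolding look by simp
qed

lemma monomials_of_iff:
  "u \<in> monomials_of m x \<longleftrightarrow>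
     (\<exists>e. keys e \<subseteq> {1..m} \<and> \<not> proper_exponent m e \<and> u = laurent_monomial x e)"
proof
  assume "u \<in> monomials_of m x"
  then obtain h where "u = (\<Prod>i\<in>{1..m}. x i ^ h i)" by (auto simp: monomials_of_def)
  moreover define e where "e = (\<Sum>i\<in>{1..m}. single i (int (h i)))"
  have "lookup e i = (if i \<in> {1..m} then int (h i) else 0)" for i
    unfolding e_def by (rule lookup_sum_single) simp
  then have "keys e \<subseteq> {1..m}" "\<not> proper_exponent m e"
    by (auto simp: in_keys_iff proper_exponent_def split: if_splits)
  ultimately show "\<exists>e. keys e \<subseteq> {1..m} \<and> \<not> proper_exponent m e \<and> u = laurent_monomial x e"
    using monomial_eq[of x h m] e_def by blast
next
  assume "\<exists>e. keys e \<subseteq> {1..m} \<and> \<not> proper_exponent m e \<and> u = laurent_monomial x e"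
  then obtain e where e: "keys e \<subseteq> {1..m}" "\<not> proper_exponent m e" "u = laurent_monomial x e" by blast
  have "u = (\<Prod>i\<in>{1..m}. x i ^ nat (lookup e i))"
    unfolding e(3) laurent_monomial_superset[OF finite_atLeastAtMost e(1)]
    using e(2) by (intro prod.cong refl) (auto simp: proper_exponent_def power_int_def not_less)
  then show "u \<in> monomials_of m x"
    unfolding monomials_of_def by (intro CollectI exI[of _ "\<lambda>i. nat (lookup e i)"]) simp
qed

lemma cluster_monomials_in_algebra: "cluster_monomials n m \<Sigma> \<subseteq> lp_algebra n m \<Sigma>"
proof
  fix u assume "u \<in> cluster_monomials n m \<Sigma>"
  then obtain t h where t: "t \<in> tree_vertices n" and u: "u = (\<Prod>i\<in>{1..m}. fst (\<Sigma> t) i ^ h i)"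
    by (auto simp: cluster_monomials_def monomials_of_def)
  let ?A = "lp_algebra n m \<Sigma>"
  have mult: "a * b \<in> ?A" if "a \<in> ?A" "b \<in> ?A" for a b
    using generate_ring.eng_mult[of a ring_of_type_algebra _ b] that
    by (auto simp: lp_algebra_def ring_of_type_algebra_def)
  have var: "fst (\<Sigma> t) i \<in> ?A" if "i \<in> {1..m}" for i
    unfolding lp_algebra_def using t that by (intro generate_ring.incl) blast
  have one: "1 \<in> ?A" using generate_ring.one[of ring_of_type_algebra] by (simp add: lp_algebra_def ring_of_type_algebra_def)
  have pow: "a ^ k \<in> ?A" if "a \<in> ?A" for a k
    by (induction k) (auto intro: one mult that)
  have "(\<Prod>i\<in>I. fst (\<Sigma> t) i ^ h i) \<in> ?A" if "I \<subseteq> {1..m}" for I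
    using finite_subset[OF that finite_atLeastAtMost] that
  proof (induction I rule: finite_induct)
    case (insert i I)
    then show ?case by (simp add: mult pow var)
  qed (simp add: one)
  then show "u \<in> ?A" unfolding u by blast
qed

context
  fixes \<Sigma> :: "nat list \<Rightarrow> 'f::field_char_0 seed" and n m :: nat
  assumes nm: "n \<le> m" and pat: "lp_pattern n m \<Sigma>"
begin

lemma pattern_independent: "t \<in> tree_vertices n \<Longrightarrow> laurent_independent m (fst (\<Sigma> t))"
  using lp_seedD(1)[OF nm, of "fst (\<Sigma> t)" "snd (\<Sigma> t)"] pat by (simp add: lp_pattern_def)

lemma cluster_laurent_monomial:
  assumes t: "t0 \<in> tree_vertices n" "t \<in> tree_vertices n" and e: "keys e \<subseteq> {1..m}" "\<not> proper_exponent m e"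
  shows "laurent_monomial (fst (\<Sigma> t)) e \<in> laurent_ring {1..m} (fst (\<Sigma> t0))"
proof -
  have A: "is_subring (laurent_ring {1..m} (fst (\<Sigma> t0)))"
    by (rule is_subring_laurent_ring[OF laurent_independentD(1)[OF pattern_independent[OF t(1)]]])
  show ?thesis
    unfolding laurent_monomial_def
  proof (intro is_subring_prod[OF A])
    fix i assume i: "i \<in> keys e"
    then have "0 \<le> lookup e i" using e by (auto simp: proper_exponent_def not_less)
    then show "fst (\<Sigma> t) i powi lookup e i \<in> laurent_ring {1..m} (fst (\<Sigma> t0))"
      using laurent_phenomenon[OF nm pat t] i e(1) is_subring_power[OF A] by (auto simp: power_int_def)
  qed
qed

lemma cluster_monomial_expansion:
  assumes "t0 \<in> tree_vertices n" "u \<in> cluster_monomials n m \<Sigma>"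
  shows "\<exists>p. laurent_expansion m (fst (\<Sigma> t0)) u p"
proof -
  obtain t e where "t \<in> tree_vertices n" "keys e \<subseteq> {1..m}" "\<not> proper_exponent m e" "u = laurent_monomial (fst (\<Sigma> t)) e"
    using assms(2) by (auto simp: cluster_monomials_def monomials_of_iff)
  then have "u \<in> laurent_ring {1..m} (fst (\<Sigma> t0))" using cluster_laurent_monomial[OF assms(1)] by simp
  then show ?thesis unfolding laurent_ring_def laurent_expansion_def by blast
qed

text \<open>The Laurent phenomenon is used in both directions: besides the expansion
  \<open>p\<close> of \<open>u\<close> in the cluster at \<open>t0\<close>, the nonproper monomial
  found there is expanded as \<open>g\<close> in the cluster of \<open>u\<close>.\<close>

lemma expansion_dichotomy:
  assumes pos: "positive_pattern n m \<Sigma>" and t0: "t0 \<in> tree_vertices n" and u: "u \<in> cluster_monomials n m \<Sigma>"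
    and p: "laurent_expansion m (fst (\<Sigma> t0)) u p" and e: "e \<in> keys p" "\<not> proper_exponent m e"
  shows "p = single e 1"
proof -
  obtain t h where t: "t \<in> tree_vertices n" and h: "keys h \<subseteq> {1..m}" "u = laurent_monomial (fst (\<Sigma> t)) h"
    using u by (auto simp: cluster_monomials_def monomials_of_iff)
  have pL: "p \<in> laurent_polys {} {1..m}" "ev (fst (\<Sigma> t0)) p = laurent_monomial (fst (\<Sigma> t)) h"
    using p h(2) by (auto simp: laurent_expansion_def)
  have ke: "keys e \<subseteq> {1..m}" using pL(1) e(1) by (auto simp: laurent_polys_def)
  obtain g where g: "g \<in> laurent_polys {} {1..m}" "ev (fst (\<Sigma> t)) g = laurent_monomial (fst (\<Sigma> t0)) e"
    using cluster_laurent_monomial[OF t t0 ke e(2)] by (auto simp: laurent_ring_def)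
  have "Q_sf m (fst (\<Sigma> t0)) = Q_sf m (fst (\<Sigma> t))" using pos t t0 unfolding positive_pattern_def by blast
  then show ?thesis
    by (rule nonproper_exponent_imp_monomial[OF pattern_independent[OF t0] pattern_independent[OF t] _ h(1) pL e(1) g])
qed

text \<open>Given a relation in which \<open>u0\<close> has a nonzero coefficient, expand everything
  in a cluster in which \<open>u0\<close> is a monomial. The exponent of \<open>u0\<close> is
  nonproper, so no other cluster monomial can contribute to it.\<close>

lemma cluster_monomials_independent:
  assumes pos: "positive_pattern n m \<Sigma>"
  shows "\<not> module.dependent (\<lambda>(c::int) (v::'f). of_int c * v) (cluster_monomials n m \<Sigma>)"
proof
  interpret Modules.module "\<lambda>(c::int) (v::'f). of_int c * v"
    by unfold_locales (auto simp: algebra_simps)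
  assume "dependent (cluster_monomials n m \<Sigma>)"
  then obtain U c u0 where U: "finite U" "U \<subseteq> cluster_monomials n m \<Sigma>" "(\<Sum>u\<in>U. of_int (c u) * u) = 0"
      "u0 \<in> U" "c u0 \<noteq> 0"
    unfolding dependent_explicit by auto
  obtain t0 e0 where t0: "t0 \<in> tree_vertices n" and e0: "keys e0 \<subseteq> {1..m}" "\<not> proper_exponent m e0"
      "u0 = laurent_monomial (fst (\<Sigma> t0)) e0"
    using subsetD[OF U(2,4)] by (auto simp: cluster_monomials_def monomials_of_iff)
  let ?x = "fst (\<Sigma> t0)"
  have "\<exists>p. \<forall>u\<in>U. laurent_expansion m ?x u (p u)"
    using cluster_monomial_expansion[OF t0] U(2) by (intro bchoice) auto
  then obtain p where p: "\<And>u. u \<in> U \<Longrightarrow> laurent_expansion m ?x u (p u)" by blast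
  define F where "F = (\<Sum>u\<in>U. single 0 (c u) * p u)"
  have c_in: "single 0 (k::int) \<in> laurent_polys {} {1..m}" for k by (rule single_in_laurent_polys) auto
  have pL: "p u \<in> laurent_polys {} {1..m}" "ev ?x (p u) = u" if "u \<in> U" for u
    using p[OF that] by (auto simp: laurent_expansion_def)
  have "ev ?x (single 0 (c u) * p u) = of_int (c u) * u" if "u \<in> U" for u
    using ev_mult[OF c_in pL(1)[OF that] laurent_independentD(1)[OF pattern_independent[OF t0]]] pL(2)[OF that] by simp
  then have "ev ?x F = 0" unfolding F_def using U(3) by (simp add: ev_sum)
  moreover have "F \<in> laurent_polys {} {1..m}"
    unfolding F_def by (intro is_subring_sum is_subringD(4) is_subring_laurent_polys c_in pL(1))
  ultimately have F0: "F = 0" using pattern_independent[OF t0] by (simp add: laurent_independent_def)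
  \<comment> \<open>If the nonproper exponent \<open>e0\<close> occurs in the expansion of
    \<open>u\<close>, the dichotomy leaves only that monomial, and \<open>u\<close> is the same
    field element as \<open>u0\<close>.\<close>
  have coeff: "lookup (p u) e0 = (if u = u0 then 1 else 0)" if u: "u \<in> U" for u
  proof (cases "e0 \<in> keys (p u)")
    case True
    then have pu: "p u = single e0 1"
      using expansion_dichotomy[OF pos t0 _ p[OF u] _ e0(2)] u U(2) by blast
    then have "u = u0" using pL(2)[OF u] e0(3) by simp
    then show ?thesis using pu by simp
  next
    case False
    have "u \<noteq> u0"
    proof
      assume "u = u0"
      then have "ev ?x (p u) = ev ?x (single e0 1)" using pL(2)[OF u] e0(3) by simp
      then have "p u = single e0 1"
        using laurent_independentD(2)[OF pattern_independent[OF t0] pL(1)[OF u], of "single e0 1"] e0(1)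
        by (simp add: laurent_polys_def)
      then show False using False by simp
    qed
    then show ?thesis using False by (simp add: in_keys_iff)
  qed
  have "lookup F e0 = (\<Sum>u\<in>U. c u * lookup (p u) e0)"
    unfolding F_def lookup_sum by (intro sum.cong refl) (subst mult.commute, simp add: lookup_mult_single)
  also have "\<dots> = (\<Sum>u\<in>U. if u = u0 then c u else 0)" by (intro sum.cong refl) (simp add: coeff)
  also have "\<dots> = c u0" using U(1,4) by simp
  finally show False using F0 U(5) by simp
qed

end

theorem corollary3p19:
  fixes \<Sigma> :: "nat list \<Rightarrow> 'f::field_char_0 seed"
    and n m :: nat and \<A> :: "'f set"
  assumes "0 < n" and "n \<le> m"
    and "lp_pattern n m \<Sigma>"
    and "positive_pattern n m \<Sigma>"
    and "\<A> = lp_algebra n m \<Sigma>"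
  shows
    "(\<forall>t\<^sub>0 \<in> tree_vertices n. \<forall>u \<in> cluster_monomials n m \<Sigma>.
       u \<notin> monomials_of m (fst (\<Sigma> t\<^sub>0)) \<longrightarrow>
       (\<exists>p. laurent_expansion m (fst (\<Sigma> t\<^sub>0)) u p \<and>
            (\<forall>e \<in> Poly_Mapping.keys p. proper_exponent m e))) \<and>
     cluster_monomials n m \<Sigma> \<subseteq> \<A> \<and>
     \<not> module.dependent (\<lambda>(c::int) (v::'f). of_int c * v) (cluster_monomials n m \<Sigma>)"
proof (intro conjI ballI impI)
  fix t0 u
  assume t0: "t0 \<in> tree_vertices n" and u: "u \<in> cluster_monomials n m \<Sigma>" "u \<notin> monomials_of m (fst (\<Sigma> t0))"
  obtain p where p: "laurent_expansion m (fst (\<Sigma> t0)) u p"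
    using cluster_monomial_expansion[OF assms(2,3) t0 u(1)] by blast
  have "proper_exponent m e" if e: "e \<in> keys p" for e
  proof (rule ccontr)
    assume np: "\<not> proper_exponent m e"
    have "p = single e 1" by (rule expansion_dichotomy[OF assms(2,3,4) t0 u(1) p e np])
    moreover have "keys e \<subseteq> {1..m}" using p e by (auto simp: laurent_expansion_def laurent_polys_def)
    ultimately have "u \<in> monomials_of m (fst (\<Sigma> t0))"
      using p np by (auto simp: laurent_expansion_def monomials_of_iff)
    then show False using u(2) by blast
  qed
  then show "\<exists>p. laurent_expansion m (fst (\<Sigma> t0)) u p \<and> (\<forall>e \<in> keys p. proper_exponent m e)"
    using p by blast
next
  show "cluster_monomials n m \<Sigma> \<subseteq> \<A>" unfolding assms(5) by (rule cluster_monomials_in_algebra)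
  show "\<not> module.dependent (\<lambda>(c::int) (v::'f). of_int c * v) (cluster_monomials n m \<Sigma>)"
    by (rule cluster_monomials_independent[OF assms(2-4)])
qed

end
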